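(* Let $K$ be a sequentially compact and compact Hausdorff space. Then the dual weak essential norm $T\mapsto\|T^*\|_w$ has Bonsall's minimality property on the weak Calkin algebra $\mathscr{B}(C(K))/\mathscr{W}(C(K))$; that is, every algebra norm $|||\cdot|||$ on $\mathscr{B}(C(K))/\mathscr{W}(C(K))$ satisfying $|||T+\mathscr{W}(C(K))|||\le\|T^*\|_w$ for all $T\in\mathscr{B}(C(K))$ satisfies $|||T+\mathscr{W}(C(K))|||=\|T^*\|_w$ for all $T\in\mathscr{B}(C(K))$.
   Context: Scalars are real or complex. For a Banach space $E$, $\mathscr{B}(E)$ is the algebra of bounded linear operators on $E$ and $\mathscr{W}(E)$ is the ideal of weakly compact operators (those mapping the unit ball to a relatively weakly compact set). For $R\in\mathscr{B}(E)$, $\|R\|_w=\inf\{\|R-W\|: W\in\mathscr{W}(E)\}$. Thus $\|T^*\|_w$ is the distance of $T^*\in\mathscr{B}(C(K)^* )$ to $\mathscr{W}(C(K)^* )$; it depends only on the class of $T$ modulo $\mathscr{W}(C(K))$ and induces an algebra norm on the weak Calkin algebra. An algebra norm is a submultiplicative norm (completeness is not assumed). *)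

theory Defs
  imports "HOL-Analysis.Analysis"
begin

text \<open>
  The scalar field is a type \<open>'k\<close> of class \<^class>\<open>real_normed_field\<close>, to be instantiated to
  \<^typ>\<open>real\<close> and to \<^typ>\<open>complex\<close>. The library only provides real normed spaces, so a normed
  space over \<open>'k\<close> is a real normed space with an explicit scalar multiplication
  \<open>s :: 'k \<Rightarrow> 'e \<Rightarrow> 'e\<close>, and a bounded \<open>'k\<close>-linear map is a bounded real-linear map that commutes
  with the scalar multiplications. For \<open>'k = real\<close> this last condition is automatic.
\<close>

definition klinear_maps ::
    "('k \<Rightarrow> 'e \<Rightarrow> 'e) \<Rightarrow> ('k \<Rightarrow> 'f \<Rightarrow> 'f) \<Rightarrow> ('e::real_normed_vector \<Rightarrow>\<^sub>L 'f::real_normed_vector) set"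
  where "klinear_maps s t = {T. \<forall>c x. blinfun_apply T (s c x) = t c (blinfun_apply T x)}"

abbreviation operators :: "('k \<Rightarrow> 'e \<Rightarrow> 'e) \<Rightarrow> ('e::real_normed_vector \<Rightarrow>\<^sub>L 'e) set"
  where "operators s \<equiv> klinear_maps s s"

abbreviation functionals ::
    "('k \<Rightarrow> 'e \<Rightarrow> 'e) \<Rightarrow> ('e::real_normed_vector \<Rightarrow>\<^sub>L 'k::real_normed_field) set"
  where "functionals s \<equiv> klinear_maps s (*)"

definition weak_topology ::
    "('k::real_normed_field \<Rightarrow> 'e \<Rightarrow> 'e) \<Rightarrow> 'e::real_normed_vector topology"
  where "weak_topology s =
    topology_generated_by {blinfun_apply f -` U | f U. f \<in> functionals s \<and> open U}"

definition weakly_compact_operators ::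
    "('k::real_normed_field \<Rightarrow> 'e \<Rightarrow> 'e) \<Rightarrow> ('e::real_normed_vector \<Rightarrow>\<^sub>L 'e) set"
  where "weakly_compact_operators s =
    {T \<in> operators s.
      compactin (weak_topology s)
        (weak_topology s closure_of (blinfun_apply T ` cball 0 1))}"

text \<open>\<^const>\<open>infdist\<close> is the infimum of the distances \<open>\<parallel>R - W\<parallel>\<close> in operator norm; the set of
  weakly compact operators always contains \<open>0\<close>, so its convention for the empty set is not used.\<close>

definition weak_essential_norm ::
    "('k::real_normed_field \<Rightarrow> 'e \<Rightarrow> 'e) \<Rightarrow> ('e::real_normed_vector \<Rightarrow>\<^sub>L 'e) \<Rightarrow> real"
  where "weak_essential_norm s R = infdist R (weakly_compact_operators s)"

lemma topspace_weak_topology [simp]: "topspace (weak_topology s) = UNIV"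
proof -
  have "0 \<in> functionals s"
    by (simp add: klinear_maps_def)
  then have "UNIV \<in> {blinfun_apply f -` U | f U. f \<in> functionals s \<and> open U}"
    by blast
  then show ?thesis
    unfolding weak_topology_def topology_generated_by_topspace by blast
qed

lemma zero_weakly_compact:
  assumes "\<And>c. s c 0 = 0"
  shows "0 \<in> weakly_compact_operators s"
proof -
  let ?W = "weak_topology s"
  have im: "blinfun_apply (0 :: 'b \<Rightarrow>\<^sub>L 'b) ` cball 0 1 = {0}"
    by (auto simp: image_iff intro!: exI[of _ 0])
  have "compactin ?W (?W closure_of {0})"
    unfolding compactin_def
  proof (intro conjI allI impI)
    show "?W closure_of {0} \<subseteq> topspace ?W"
      by (rule closure_of_subset_topspace)
    fix \<U> assume \<U>: "Ball \<U> (openin ?W) \<and> ?W closure_of {0} \<subseteq> \<Union>\<U>"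
    have "0 \<in> ?W closure_of {0}"
      using closure_of_subset[of "{0}" ?W] by simp
    then obtain U where U: "U \<in> \<U>" "0 \<in> U"
      using \<U> by blast
    have "x \<in> U" if "x \<in> ?W closure_of {0}" for x
    proof -
      have same: "blinfun_apply f x = 0" if "f \<in> functionals s" for f
      proof (rule ccontr)
        assume "blinfun_apply f x \<noteq> 0"
        have "openin ?W (blinfun_apply f -` (- {0}))"
          unfolding weak_topology_def
          by (rule topology_generated_by_Basis) (use \<open>f \<in> functionals s\<close> in blast)
        moreover have "x \<in> blinfun_apply f -` (- {0})"
          using \<open>blinfun_apply f x \<noteq> 0\<close> by simp
        ultimately have "\<exists>y. y \<in> {0} \<and> y \<in> blinfun_apply f -` (- {0})"
          using \<open>x \<in> ?W closure_of {0}\<close>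
          by (meson in_closure_of)
        then show False
          by simp
      qed
      have "generate_topology_on {blinfun_apply f -` U | f U. f \<in> functionals s \<and> open U} U"
        using \<U> U(1) unfolding weak_topology_def openin_topology_generated_by_iff by blast
      then have "0 \<in> U \<longleftrightarrow> x \<in> U"
        by induction (auto simp: same)
      with U show ?thesis
        by simp
    qed
    with U(1) show "\<exists>\<F>. finite \<F> \<and> \<F> \<subseteq> \<U> \<and> ?W closure_of {0} \<subseteq> \<Union>\<F>"
      by (intro exI[of _ "{U}"]) auto
  qed
  with im show ?thesis
    using assms by (simp add: weakly_compact_operators_def klinear_maps_def)
qed


text \<open>
  For compact \<open>K = 'a\<close>, the space \<open>C(K)\<close> is \<^typ>\<open>'a \<Rightarrow>\<^sub>C 'k\<close>, since continuous functions on \<open>K\<close>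
  are bounded.
\<close>

definition ck_scale ::
    "'k::real_normed_field \<Rightarrow> ('a::topological_space \<Rightarrow>\<^sub>C 'k) \<Rightarrow> ('a \<Rightarrow>\<^sub>C 'k)"
  where "ck_scale c f = Bcontfun (\<lambda>x. c * apply_bcontfun f x)"

lemma ck_scale_apply [simp]: "apply_bcontfun (ck_scale c f) x = c * apply_bcontfun f x"
proof -
  have "norm (c * apply_bcontfun f x) \<le> norm c * norm f" for x
    by (simp add: norm_mult mult_left_mono norm_bounded)
  then have "(\<lambda>x. c * apply_bcontfun f x) \<in> bcontfun"
    by (intro bcontfun_normI continuous_intros) auto
  then show ?thesis
    by (simp add: ck_scale_def Bcontfun_inverse)
qed

text \<open>The dual \<open>C(K)\<^sup>*\<close>, with the operator norm.\<close>

typedef (overloaded) ('a, 'k) ck_dual =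
  "functionals ck_scale :: (('a::topological_space \<Rightarrow>\<^sub>C 'k::real_normed_field) \<Rightarrow>\<^sub>L 'k) set"
  morphisms ck_functional Ck_dual
  by (rule exI[of _ 0]) (simp add: klinear_maps_def)

setup_lifting type_definition_ck_dual

instantiation ck_dual :: (topological_space, real_normed_field) real_normed_vector
begin

lift_definition zero_ck_dual :: "('a, 'b) ck_dual" is 0
  by (simp add: klinear_maps_def)

lift_definition plus_ck_dual :: "('a, 'b) ck_dual \<Rightarrow> ('a, 'b) ck_dual \<Rightarrow> ('a, 'b) ck_dual" is "(+)"
  by (simp add: klinear_maps_def blinfun.add_left algebra_simps)

lift_definition minus_ck_dual :: "('a, 'b) ck_dual \<Rightarrow> ('a, 'b) ck_dual \<Rightarrow> ('a, 'b) ck_dual" is "(-)"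
  by (simp add: klinear_maps_def blinfun.diff_left algebra_simps)

lift_definition uminus_ck_dual :: "('a, 'b) ck_dual \<Rightarrow> ('a, 'b) ck_dual" is uminus
  by (simp add: klinear_maps_def blinfun.minus_left)

lift_definition scaleR_ck_dual :: "real \<Rightarrow> ('a, 'b) ck_dual \<Rightarrow> ('a, 'b) ck_dual" is "(*\<^sub>R)"
  by (simp add: klinear_maps_def blinfun.scaleR_left)

lift_definition norm_ck_dual :: "('a, 'b) ck_dual \<Rightarrow> real" is norm .

definition dist_ck_dual :: "('a, 'b) ck_dual \<Rightarrow> ('a, 'b) ck_dual \<Rightarrow> real"
  where "dist_ck_dual x y = norm (x - y)"

definition sgn_ck_dual :: "('a, 'b) ck_dual \<Rightarrow> ('a, 'b) ck_dual"
  where "sgn_ck_dual x = scaleR (inverse (norm x)) x"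

definition uniformity_ck_dual :: "(('a, 'b) ck_dual \<times> ('a, 'b) ck_dual) filter"
  where "uniformity_ck_dual = (INF e\<in>{0 <..}. principal {(x, y). dist x y < e})"

definition open_ck_dual :: "('a, 'b) ck_dual set \<Rightarrow> bool"
  where "open_ck_dual S = (\<forall>x\<in>S. \<forall>\<^sub>F (x', y) in uniformity. x' = x \<longrightarrow> y \<in> S)"

instance
  apply standard
  unfolding dist_ck_dual_def open_ck_dual_def sgn_ck_dual_def uniformity_ck_dual_def
  apply (rule refl | (transfer, force simp: algebra_simps norm_triangle_ineq))+
  done

end

lift_definition ck_dual_scale ::
    "'k::real_normed_field \<Rightarrow> ('a::topological_space, 'k) ck_dual \<Rightarrow> ('a, 'k) ck_dual"
  is "\<lambda>c \<phi>. blinfun_mult_right c o\<^sub>L \<phi>"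
  by (simp add: klinear_maps_def)

lemma ck_dual_eqI:
  "(\<And>f. blinfun_apply (ck_functional \<phi>) f = blinfun_apply (ck_functional \<psi>) f) \<Longrightarrow> \<phi> = \<psi>"
  by (rule ck_functional_inject[THEN iffD1], rule blinfun_eqI)

text \<open>The adjoint \<open>T\<^sup>*\<close> of \<open>T \<in> \<B>(C(K))\<close>. \<^const>\<open>Ck_dual\<close> is only meaningful on
  \<open>'k\<close>-linear functionals, so this is meant for \<open>T \<in> operators ck_scale\<close>.\<close>

definition adjoint_op ::
    "(('a::topological_space \<Rightarrow>\<^sub>C 'k::real_normed_field) \<Rightarrow>\<^sub>L ('a \<Rightarrow>\<^sub>C 'k))
      \<Rightarrow> (('a, 'k) ck_dual \<Rightarrow>\<^sub>L ('a, 'k) ck_dual)"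
  where "adjoint_op T = Blinfun (\<lambda>\<phi>. Ck_dual (ck_functional \<phi> o\<^sub>L T))"

lemma ck_functional_adjoint_op:
  assumes T: "T \<in> operators ck_scale"
  shows "blinfun_apply (ck_functional (blinfun_apply (adjoint_op T) \<phi>)) f =
    blinfun_apply (ck_functional \<phi>) (blinfun_apply T f)"
proof -
  have in_dual: "ck_functional \<phi> o\<^sub>L T \<in> functionals ck_scale" for \<phi>
    using ck_functional[of \<phi>] T by (simp add: klinear_maps_def)
  have Rep: "ck_functional (Ck_dual (ck_functional \<phi> o\<^sub>L T)) = ck_functional \<phi> o\<^sub>L T" for \<phi>
    by (rule Ck_dual_inverse) (rule in_dual)
  have "bounded_linear (\<lambda>\<phi>. Ck_dual (ck_functional \<phi> o\<^sub>L T))"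
  proof (rule bounded_linear_intro)
    fix \<phi> \<psi> :: "('a, 'b) ck_dual" and r :: real
    show "Ck_dual (ck_functional (\<phi> + \<psi>) o\<^sub>L T)
        = Ck_dual (ck_functional \<phi> o\<^sub>L T) + Ck_dual (ck_functional \<psi> o\<^sub>L T)"
      by (rule ck_dual_eqI, unfold plus_ck_dual.rep_eq[of "Ck_dual _"] Rep)
        (simp add: plus_ck_dual.rep_eq blinfun.add_left)
    show "Ck_dual (ck_functional (r *\<^sub>R \<phi>) o\<^sub>L T) = r *\<^sub>R Ck_dual (ck_functional \<phi> o\<^sub>L T)"
      by (rule ck_dual_eqI, unfold scaleR_ck_dual.rep_eq[of _ "Ck_dual _"] Rep)
        (simp add: scaleR_ck_dual.rep_eq blinfun.scaleR_left)
    show "norm (Ck_dual (ck_functional \<phi> o\<^sub>L T)) \<le> norm \<phi> * norm T"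
      by (simp add: norm_ck_dual.rep_eq Rep norm_blinfun_compose)
  qed
  then show ?thesis
    by (simp add: adjoint_op_def bounded_linear_Blinfun_apply Rep)
qed

lemma adjoint_op_in_operators:
  assumes "T \<in> operators ck_scale"
  shows "adjoint_op T \<in> operators ck_dual_scale"
  unfolding klinear_maps_def
  by (auto intro!: ck_dual_eqI simp: ck_functional_adjoint_op[OF assms] ck_dual_scale.rep_eq)

definition dual_weak_essential_norm ::
    "(('a::topological_space \<Rightarrow>\<^sub>C 'k::real_normed_field) \<Rightarrow>\<^sub>L ('a \<Rightarrow>\<^sub>C 'k)) \<Rightarrow> real"
  where "dual_weak_essential_norm T = weak_essential_norm ck_dual_scale (adjoint_op T)"


text \<open>The coset \<open>T + \<W>(C(K))\<close>.\<close>

definition weak_coset ::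
    "(('a::topological_space \<Rightarrow>\<^sub>C 'k::real_normed_field) \<Rightarrow>\<^sub>L ('a \<Rightarrow>\<^sub>C 'k))
      \<Rightarrow> (('a \<Rightarrow>\<^sub>C 'k) \<Rightarrow>\<^sub>L ('a \<Rightarrow>\<^sub>C 'k)) set"
  where "weak_coset T = (\<lambda>W. T + W) ` weakly_compact_operators ck_scale"

definition op_scale ::
    "'k \<Rightarrow> (('a::topological_space \<Rightarrow>\<^sub>C 'k::real_normed_field) \<Rightarrow>\<^sub>L ('a \<Rightarrow>\<^sub>C 'k))
      \<Rightarrow> (('a \<Rightarrow>\<^sub>C 'k) \<Rightarrow>\<^sub>L ('a \<Rightarrow>\<^sub>C 'k))"
  where "op_scale c T = Blinfun (\<lambda>f. ck_scale c (blinfun_apply T f))"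

lemma norm_ck_scale_le: "norm (ck_scale c f) \<le> norm c * norm f"
proof (rule norm_bound)
  fix x
  show "norm (apply_bcontfun (ck_scale c f) x) \<le> norm c * norm f"
    by (simp add: norm_mult mult_left_mono norm_bounded)
qed

lemma op_scale_apply [simp]: "blinfun_apply (op_scale c T) f = ck_scale c (blinfun_apply T f)"
proof -
  have "bounded_linear (\<lambda>f. ck_scale c (blinfun_apply T f))"
  proof (rule bounded_linear_intro)
    fix f g :: "'a \<Rightarrow>\<^sub>C 'b" and r :: real
    show "ck_scale c (blinfun_apply T (f + g)) = ck_scale c (blinfun_apply T f) + ck_scale c (T g)"
      by (rule bcontfun_eqI) (simp add: blinfun.add_right algebra_simps)
    show "ck_scale c (blinfun_apply T (r *\<^sub>R f)) = r *\<^sub>R ck_scale c (blinfun_apply T f)"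
      by (rule bcontfun_eqI) (simp add: blinfun.scaleR_right)
    show "norm (ck_scale c (blinfun_apply T f)) \<le> norm f * (norm c * norm T)"
      using order_trans[OF norm_ck_scale_le[of c "blinfun_apply T f"]
          mult_left_mono[OF norm_blinfun[of T f] norm_ge_zero[of c]]]
      by (simp add: mult_ac)
  qed
  then show ?thesis
    by (simp add: op_scale_def bounded_linear_Blinfun_apply)
qed

text \<open>
  An algebra norm on the quotient algebra \<open>\<B>(C(K))/\<W>(C(K))\<close> is a function of the coset.
  The operations of the quotient are written through representatives, for instance
  \<open>(S + \<W>)(T + \<W>) = ST + \<W>\<close>; only values of \<open>N\<close> at cosets matter.
\<close>

definition weak_calkin_algebra_norm ::
    "((('a::topological_space \<Rightarrow>\<^sub>C 'k::real_normed_field) \<Rightarrow>\<^sub>L ('a \<Rightarrow>\<^sub>C 'k)) set \<Rightarrow> real) \<Rightarrow> bool"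
  where "weak_calkin_algebra_norm N \<longleftrightarrow>
    (\<forall>T \<in> operators ck_scale. 0 \<le> N (weak_coset T)) \<and>
    (\<forall>T \<in> operators ck_scale. N (weak_coset T) = 0 \<longleftrightarrow> weak_coset T = weak_coset 0) \<and>
    (\<forall>c. \<forall>T \<in> operators ck_scale.
      N (weak_coset (op_scale c T)) = norm c * N (weak_coset T)) \<and>
    (\<forall>S \<in> operators ck_scale. \<forall>T \<in> operators ck_scale.
      N (weak_coset (S + T)) \<le> N (weak_coset S) + N (weak_coset T)) \<and>
    (\<forall>S \<in> operators ck_scale. \<forall>T \<in> operators ck_scale.
      N (weak_coset (S o\<^sub>L T)) \<le> N (weak_coset S) * N (weak_coset T))"

text \<open>Minimality for a seminorm \<open>\<nu>\<close> on \<open>\<B>(C(K))\<close> that induces a norm on the quotient.\<close>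

definition bonsall_minimal ::
    "((('a::topological_space \<Rightarrow>\<^sub>C 'k::real_normed_field) \<Rightarrow>\<^sub>L ('a \<Rightarrow>\<^sub>C 'k)) \<Rightarrow> real) \<Rightarrow> bool"
  where "bonsall_minimal \<nu> \<longleftrightarrow>
    (\<forall>N. weak_calkin_algebra_norm N \<longrightarrow>
      (\<forall>T \<in> operators ck_scale. N (weak_coset T) \<le> \<nu> T) \<longrightarrow>
      (\<forall>T \<in> operators ck_scale. N (weak_coset T) = \<nu> T))"

end

theory Submission
  imports Defs
begin

text \<open>
  The proof bounds an arbitrary algebra norm \<open>N \<le> \<nu>\<close> on the quotient from below, where
  \<open>\<nu> T = \<parallel>T\<^sup>*\<parallel>\<^sub>w\<close>. If \<open>P\<close> is an idempotent operator that is not weakly compact, then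
  \<open>N P \<le> (N P)\<^sup>2\<close> gives \<open>1 \<le> N P\<close>. So it is enough to write a multiple \<open>c P\<close>, with \<open>c\<close>
  close to \<open>\<nu> T\<close>, as \<open>R T S\<close> up to an operator on which \<open>\<nu>\<close> is small, with \<open>\<nu> R \<le> 1\<close> and
  \<open>\<nu> S \<le> 1\<close>: then \<open>c \<le> c N P \<le> N R N T N S + \<epsilon> \<le> N T + \<epsilon>\<close>.

  The operators \<open>P\<close>, \<open>R\<close>, \<open>S\<close> all have the form \<open>g \<mapsto> \<Sum>k. (g x\<^sub>k - g x\<^sub>\<infinity>) q\<^sub>k\<close> with a sequence
  \<open>x\<^sub>k \<longlonglongrightarrow> x\<^sub>\<infinity>\<close>, which sequential compactness provides, and disjointly supported \<open>q\<^sub>k\<close> in the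
  unit ball of \<open>C(K)\<close>; that is, they factor through \<open>c\<^sub>0\<close>. The norm of such an operator may
  be \<open>2\<close>, but its adjoint \<open>\<phi> \<mapsto> \<Sum>k. \<phi> q\<^sub>k (\<delta>(x\<^sub>k) - \<delta>(x\<^sub>\<infinity>))\<close> differs by an operator of rank one
  from \<open>\<phi> \<mapsto> \<Sum>k. \<phi> q\<^sub>k \<delta>(x\<^sub>k)\<close>, which has norm at most \<open>1\<close>. So \<open>\<nu>\<close>, which
  admits corrections that are not adjoints, is at most \<open>1\<close>
  (\<open>dual_weak_essential_norm_series_operator\<close>).

  It remains to find points \<open>x\<^sub>k\<close> and disjointly supported \<open>f\<^sub>k\<close> in the unit ball with
  \<open>\<bar>(T f\<^sub>k)(x\<^sub>k)\<bar> > c\<close>, for every \<open>c < \<nu> T\<close>. Write \<open>\<mu>\<^sub>x = T\<^sup>* \<delta>(x)\<close>. Suppose that for some positive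
  functional \<open>\<lambda>\<close> every \<open>\<mu>\<^sub>x\<close> lies within \<open>c\<close> of the set of functionals bounded by the seminorm
  \<open>f \<mapsto> (\<lambda> \<bar>f\<bar>\<^sup>2)\<^sup>1\<^sup>/\<^sup>2\<close>. The best approximations \<open>\<psi>\<^sub>x\<close> can then be integrated against functionals, with
  partitions of unity and Tychonoff's theorem in place of measurability, to an operator \<open>W\<close> on
  the dual with \<open>\<parallel>T\<^sup>* - W\<parallel> \<le> c\<close>, and \<open>W\<close> is weakly compact because it factors through a Hilbert
  space; so \<open>\<nu> T \<le> c\<close> (\<open>dual_weak_essential_norm_le_of_domination\<close>). For \<open>c < \<nu> T\<close> this fails
  for every \<open>\<lambda>\<close>, in particular for large multiples of sums of variations \<open>\<bar>\<mu>\<^sub>y\<bar>\<close>. So for any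
  finitely many \<open>\<mu>\<^sub>y\<close> there are \<open>x\<close> and \<open>f\<close> with \<open>\<bar>\<mu>\<^sub>x f\<bar> > c\<close> such that these \<open>\<mu>\<^sub>y\<close> have almost no
  mass where \<open>f\<close> is not small. Cutting off and a pigeonhole argument turn such \<open>f\<close> into a
  disjoint sequence (\<open>escapes_disjoint_sequence\<close>).

  The scalars are any type that is both a normed field and a Euclidean space, which covers the real and the complex case at once.
\<close>

section \<open>Linear functionals below sublinear ones\<close>

definition sublinear :: "('v::real_vector \<Rightarrow> real) \<Rightarrow> bool" where
  "sublinear q \<longleftrightarrow> (\<forall>v w. q (v + w) \<le> q v + q w) \<and> (\<forall>t v. 0 \<le> t \<longrightarrow> q (t *\<^sub>R v) = t * q v)"

lemma sublinear_zero: "sublinear q \<Longrightarrow> q 0 = 0"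
  unfolding sublinear_def by (metis mult_zero_left order_refl scaleR_zero_left)

lemma sublinear_lower: "sublinear q \<Longrightarrow> - q (- v) \<le> q v"
  using sublinear_zero[of q] unfolding sublinear_def
  by (metis add.right_inverse add_le_cancel_right minus_add_cancel neg_le_iff_le add.commute add.inverse_inverse diff_le_eq le_minus_iff uminus_add_conv_diff)

text \<open>A pointwise infimum of sublinear functionals is in general not subadditive; along a chain it is,
  because two members \<open>a\<close>, \<open>b\<close> that nearly attain the infimum at \<open>v\<close> and at \<open>w\<close> can be replaced by the
  smaller of the two. This is the step for chains in Zorn's lemma.\<close>

lemma sublinear_INF:
  fixes C :: "('v::real_vector \<Rightarrow> real) set"
  assumes C: "C \<noteq> {}" "\<And>s. s \<in> C \<Longrightarrow> sublinear s"
    and bdd: "\<And>v. bdd_below ((\<lambda>s. s v) ` C)"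
    and chain: "\<And>s r. s \<in> C \<Longrightarrow> r \<in> C \<Longrightarrow> s \<le> r \<or> r \<le> s"
  shows "sublinear (\<lambda>v. INF s\<in>C. s v)"
proof -
  have "(INF s\<in>C. s (v + w)) \<le> (INF s\<in>C. s v) + (INF s\<in>C. s w)" for v w
  proof -
    have *: "(INF s\<in>C. s (v + w)) \<le> a v + b w" if ab: "a \<in> C" "b \<in> C" for a b
    proof -
      obtain m where m: "m \<in> C" "m \<le> a" "m \<le> b"
        using chain[OF ab] ab by blast
      have "(INF s\<in>C. s (v + w)) \<le> m (v + w)"
        by (rule cINF_lower[OF bdd m(1)])
      also have "\<dots> \<le> m v + m w"
        using C(2)[OF m(1)] by (simp add: sublinear_def)
      also have "\<dots> \<le> a v + b w"
        using m(2,3) by (simp add: le_fun_def add_mono)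
      finally show ?thesis .
    qed
    have "(INF s\<in>C. s (v + w)) - b w \<le> (INF s\<in>C. s v)" if "b \<in> C" for b
      by (rule cINF_greatest[OF C(1)]) (use *[OF _ that] in \<open>simp add: algebra_simps\<close>)
    then have "(INF s\<in>C. s (v + w)) - (INF s\<in>C. s v) \<le> (INF s\<in>C. s w)"
      by (intro cINF_greatest[OF C(1)]) (simp add: algebra_simps)
    then show ?thesis by simp
  qed
  moreover have "(INF s\<in>C. s (t *\<^sub>R v)) = t * (INF s\<in>C. s v)" if t: "0 \<le> t" for t v
  proof (cases "t = 0")
    case True
    then have "(\<lambda>s. s (t *\<^sub>R v)) ` C = {0}"
      using C by (auto simp: sublinear_zero image_iff)
    then show ?thesis using True by simp
  next
    case False
    with t have t: "t > 0" by simp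
    have le: "r * (INF s\<in>C. s w) \<le> (INF s\<in>C. s (r *\<^sub>R w))" if "r > 0" for r w
    proof (rule cINF_greatest[OF C(1)])
      fix s assume s: "s \<in> C"
      have "(INF s\<in>C. s w) \<le> s w" by (rule cINF_lower[OF bdd s])
      then show "r * (INF s\<in>C. s w) \<le> s (r *\<^sub>R w)"
        using C(2)[OF s] that by (simp add: sublinear_def)
    qed
    have "inverse t * (INF s\<in>C. s (t *\<^sub>R v)) \<le> (INF s\<in>C. s v)"
      using le[of "inverse t" "t *\<^sub>R v"] t by simp
    then have "(INF s\<in>C. s (t *\<^sub>R v)) \<le> t * (INF s\<in>C. s v)"
      using t by (simp add: field_simps)
    with le[OF t, of v] show ?thesis by simp
  qed
  ultimately show ?thesis by (simp add: sublinear_def)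
qed

text \<open>The functional \<open>x \<mapsto> INF t. m (x + t v) - t m v\<close> is sublinear and lies below \<open>m\<close>. So it equals a
  minimal \<open>m\<close>, and \<open>t = 1\<close> then gives superadditivity.\<close>

lemma minimal_sublinear_additive:
  fixes m :: "'v::real_vector \<Rightarrow> real"
  assumes m: "sublinear m" and min: "\<And>r. sublinear r \<Longrightarrow> r \<le> m \<Longrightarrow> r = m"
  shows "m (v + w) = m v + m w"
proof -
  have msub: "m (a + b) \<le> m a + m b" and mhom: "0 \<le> t \<Longrightarrow> m (t *\<^sub>R a) = t * m a" for a b t
    using m by (auto simp: sublinear_def)
  define r where "r x = (INF t\<in>{0..}. m (x + t *\<^sub>R v) - t * m v)" for x
  have low: "- m (- x) \<le> m (x + t *\<^sub>R v) - t * m v" if "t \<ge> 0" for x t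
    using msub[of "x + t *\<^sub>R v" "- x"] mhom[OF that, of v] by simp
  have bdd: "bdd_below ((\<lambda>t. m (x + t *\<^sub>R v) - t * m v) ` {0..})" for x
    by (rule bdd_belowI2[where m="- m (- x)"]) (use low in auto)
  have rle: "r x \<le> m (x + t *\<^sub>R v) - t * m v" if "t \<ge> 0" for x t
    unfolding r_def by (rule cINF_lower[OF bdd]) (use that in auto)
  have "r (x + y) \<le> r x + r y" for x y
  proof -
    have "r (x + y) \<le> (m (x + t *\<^sub>R v) - t * m v) + (m (y + u *\<^sub>R v) - u * m v)"
      if "t \<ge> 0" "u \<ge> 0" for t u
      using rle[of "t + u" "x + y"] msub[of "x + t *\<^sub>R v" "y + u *\<^sub>R v"] that
      by (simp add: algebra_simps)
    then have "r (x + y) - (m (y + u *\<^sub>R v) - u * m v) \<le> r x" if "u \<ge> 0" for u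
      unfolding r_def[of x] by (intro cINF_greatest) (use that in \<open>auto simp: algebra_simps\<close>)
    then have "r (x + y) - r x \<le> r y"
      unfolding r_def[of y] by (intro cINF_greatest) (auto simp: algebra_simps)
    then show ?thesis by simp
  qed
  moreover have "r (t *\<^sub>R x) = t * r x" if t: "0 \<le> t" for t x
  proof (cases "t = 0")
    case True
    have "r 0 = 0"
    proof (rule antisym)
      show "r 0 \<le> 0" using rle[of 0 0] sublinear_zero[OF m] by simp
      show "0 \<le> r 0" unfolding r_def by (rule cINF_greatest) (use mhom in auto)
    qed
    with True show ?thesis by simp
  next
    case False
    with t have t: "t > 0" by simp
    have le: "r (t *\<^sub>R x) \<le> t * r x" if t: "t > 0" for t x
    proof -
      have "inverse t * r (t *\<^sub>R x) \<le> r x"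
        unfolding r_def[of x]
      proof (rule cINF_greatest)
        fix u :: real assume "u \<in> {0..}"
        then have "r (t *\<^sub>R x) \<le> m (t *\<^sub>R (x + u *\<^sub>R v)) - (t * u) * m v"
          using rle[of "t * u" "t *\<^sub>R x"] t by (simp add: scaleR_add_right)
        also have "\<dots> = t * (m (x + u *\<^sub>R v) - u * m v)"
          using mhom[of t "x + u *\<^sub>R v"] t by (simp add: right_diff_distrib)
        finally show "inverse t * r (t *\<^sub>R x) \<le> m (x + u *\<^sub>R v) - u * m v"
          using t by (simp add: field_simps)
      qed auto
      then show ?thesis using t by (simp add: field_simps)
    qed
    have "r x \<le> inverse t * r (t *\<^sub>R x)"
      using le[of "inverse t" "t *\<^sub>R x"] t by simp
    then have "t * r x \<le> r (t *\<^sub>R x)"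
      using t by (simp add: field_simps)
    with le[OF t, of x] show ?thesis by simp
  qed
  ultimately have "sublinear r" by (simp add: sublinear_def)
  moreover have "r \<le> m"
    using rle[of 0] by (simp add: le_fun_def)
  ultimately have "r = m" by (rule min)
  then have "m w \<le> m (w + v) - m v"
    using rle[of 1 w] by simp
  with msub[of v w] show ?thesis by (simp add: add.commute)
qed

text \<open>A form of the Hahn--Banach theorem: a minimal sublinear functional below \<open>q\<close> is linear.\<close>

lemma sublinear_dominates_linear:
  fixes q :: "'v::real_vector \<Rightarrow> real"
  assumes q: "sublinear q"
  obtains l where "linear l" "\<And>v. l v \<le> q v"
proof -
  let ?A = "{r. sublinear r \<and> r \<le> q}"
  have po: "partial_order_on ?A (relation_of (\<ge>) ?A)"
    by (rule partial_order_on_relation_ofI) auto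
  have "\<exists>m\<in>?A. \<forall>a\<in>?A. a \<le> m \<longrightarrow> a = m"
  proof (rule predicate_Zorn[OF po])
    fix C assume "C \<in> Chains (relation_of (\<ge>) ?A)"
    then have C: "C \<subseteq> ?A" and chain: "\<And>s r. s \<in> C \<Longrightarrow> r \<in> C \<Longrightarrow> s \<le> r \<or> r \<le> s"
      by (auto simp: Chains_def relation_of_def)
    show "\<exists>u\<in>?A. \<forall>a\<in>C. u \<le> a"
    proof (cases "C = {}")
      case True then show ?thesis using q by auto
    next
      case False
      have bdd: "bdd_below ((\<lambda>s. s v) ` C)" for v
      proof (rule bdd_belowI2)
        fix s assume "s \<in> C"
        then have "sublinear s" "s (- v) \<le> q (- v)" using C by (auto simp: le_fun_def)
        then show "- q (- v) \<le> s v" using sublinear_lower[of s v] by linarith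
      qed
      let ?u = "\<lambda>v. INF s\<in>C. s v"
      have u: "?u \<le> s" if "s \<in> C" for s
        by (rule le_funI) (rule cINF_lower[OF bdd that])
      have "sublinear ?u"
        by (rule sublinear_INF[OF False _ bdd chain]) (use C in auto)
      moreover obtain s where "s \<in> C" using False by blast
      then have "?u \<le> q" using u[of s] C by auto
      ultimately show ?thesis using u by blast
    qed
  qed
  then obtain m where m: "sublinear m" "m \<le> q"
    and min: "\<And>r. sublinear r \<Longrightarrow> r \<le> m \<Longrightarrow> r = m"
    by (smt (verit, best) mem_Collect_eq order_trans)
  have add: "m (v + w) = m v + m w" for v w
    by (rule minimal_sublinear_additive[OF m(1) min])
  have neg: "m (- v) = - m v" for v
    using add[of v "- v"] sublinear_zero[OF m(1)] by simp
  have "m (t *\<^sub>R v) = t *\<^sub>R m v" for t v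
  proof -
    show ?thesis
    proof (cases "t \<ge> 0")
      case True then show ?thesis using m(1) by (simp add: sublinear_def)
    next
      case False
      then have "0 \<le> - t" by simp
      then have "m ((- t) *\<^sub>R v) = (- t) * m v" using m(1) unfolding sublinear_def by blast
      then show ?thesis using neg[of "t *\<^sub>R v"] by simp
    qed
  qed
  then have "linear m" by (intro linearI add)
  then show ?thesis using that m(2) by (auto simp: le_fun_def)
qed

text \<open>The functional \<open>z \<mapsto> inner z 1\<close> plays the role of the real part. Representing real-linear
  functionals on the scalars by it is what turns real-linear functionals into linear ones
  over the scalar field, as in the usual passage from \<open>Re \<psi>\<close> to \<open>\<psi>\<close>. The representation holds because
  \<open>z \<mapsto> (c \<mapsto> inner (c * z) 1)\<close> is injective and the dimensions agree.\<close>

lemma field_riesz: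
  fixes l :: "'k::{real_normed_field,euclidean_space} \<Rightarrow> real"
  assumes "linear l"
  shows "\<exists>!z. \<forall>c. l c = inner (c * z) 1"
proof -
  define A :: "'k \<Rightarrow> 'k" where "A z = (\<Sum>b\<in>Basis. inner (b * z) 1 *\<^sub>R b)" for z
  have Ab: "inner (A z) b = inner (b * z) 1" if "b \<in> Basis" for z b
    using that by (simp add: A_def inner_sum_left inner_Basis if_distrib cong: if_cong)
  have A: "inner (A z) c = inner (c * z) 1" for z c
  proof -
    have "inner (A z) c = inner (A z) (\<Sum>b\<in>Basis. inner c b *\<^sub>R b)"
      by (simp add: euclidean_representation)
    also have "\<dots> = (\<Sum>b\<in>Basis. inner c b * inner (b * z) 1)"
      by (simp add: inner_sum_right Ab)
    also have "\<dots> = inner ((\<Sum>b\<in>Basis. inner c b *\<^sub>R b) * z) 1"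
      by (simp add: inner_sum_left sum_distrib_right)
    finally show ?thesis by (simp add: euclidean_representation)
  qed
  have lin: "linear A"
    by (rule linearI) (simp_all add: A_def algebra_simps inner_add_left sum.distrib scaleR_sum_right)
  have one: "inner (1::'k) 1 = 1"
    by (simp add: norm_eq_1[symmetric])
  have z0: "z = 0" if "\<And>c. inner (c * z) 1 = 0" for z :: 'k
    using that[of "inverse z"] one by (cases "z = 0") auto
  have "inj A"
    unfolding linear_injective_0[OF lin] by (metis A inner_zero_left z0)
  then have "surj A" by (rule linear_inj_imp_surj[OF lin])
  then obtain z where z: "A z = (\<Sum>b\<in>Basis. l b *\<^sub>R b)" by (metis surjD)
  have zl: "l c = inner (c * z) 1" for c
  proof -
    have "l c = l (\<Sum>b\<in>Basis. inner c b *\<^sub>R b)" by (simp add: euclidean_representation)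
    also have "\<dots> = (\<Sum>b\<in>Basis. inner c b * l b)"
      using assms by (simp add: linear_sum linear_scale)
    also have "\<dots> = inner (A z) c"
      unfolding z by (simp add: inner_sum_left inner_commute[of c] mult.commute)
    finally show ?thesis by (simp add: A)
  qed
  show ?thesis
  proof (rule ex1I[of _ z])
    show "\<forall>c. l c = inner (c * z) 1" using zl by blast
    fix y assume y: "\<forall>c. l c = inner (c * y) 1"
    have "y - z = 0"
      by (rule z0) (use y zl in \<open>simp add: right_diff_distrib inner_diff_left\<close>)
    then show "y = z" by simp
  qed
qed

section \<open>Functionals on \<open>C(K)\<close> and their decomposition\<close>

text \<open>Multiplying by a scalar of modulus one makes a value real and nonnegative. This replaces
  statements about moduli by additive ones throughout.\<close>

lemma norm_rotation:
  fixes z :: "'k::real_normed_field"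
  obtains c where "norm c = 1" "c * z = of_real (norm z)"
proof (cases "z = 0")
  case True then show ?thesis using that[of 1] by simp
next
  case False
  then show ?thesis using that[of "of_real (norm z) / z"] by (simp add: norm_divide)
qed

lemma ck_scale_algebra:
  "ck_scale c (f + g) = ck_scale c f + ck_scale c g"
  "ck_scale (c + d) f = ck_scale c f + ck_scale d f"
  "ck_scale (c * d) f = ck_scale c (ck_scale d f)"
  "ck_scale c (f - g) = ck_scale c f - ck_scale c g"
  "ck_scale 1 f = f"
  "ck_scale (of_real r) f = r *\<^sub>R f"
  "ck_scale c 0 = 0"
  by (rule bcontfun_eqI; simp add: algebra_simps scaleR_conv_of_real)+

lemma norm_ck_scale: "norm (ck_scale c f) = norm c * norm f"
proof (cases "c = 0")
  case True
  then show ?thesis using norm_ck_scale_le[of c f] by simp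
next
  case False
  have "norm c * norm f = norm c * norm (ck_scale (inverse c) (ck_scale c f))"
    using False by (simp add: ck_scale_algebra(3)[symmetric] ck_scale_algebra(5))
  also have "\<dots> \<le> norm c * (norm (inverse c) * norm (ck_scale c f))"
    by (intro mult_left_mono norm_ck_scale_le) simp
  also have "\<dots> = norm (ck_scale c f)"
    using False by (simp add: norm_inverse)
  finally have "norm c * norm f \<le> norm (ck_scale c f)" .
  then show ?thesis using norm_ck_scale_le[of c f] by simp
qed

definition ck_seminorm :: "(('a::topological_space \<Rightarrow>\<^sub>C 'k::real_normed_field) \<Rightarrow> real) \<Rightarrow> bool" where
  "ck_seminorm p \<longleftrightarrow> (\<forall>f g. p (f + g) \<le> p f + p g) \<and> (\<forall>c f. p (ck_scale c f) = norm c * p f)"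

lemma ck_seminormD:
  assumes "ck_seminorm p"
  shows "p (f + g) \<le> p f + p g" "p (ck_scale c f) = norm c * p f"
    "p (r *\<^sub>R f) = \<bar>r\<bar> * p f" "p 0 = 0" "p (- f) = p f" "0 \<le> p f"
proof -
  show 1: "p (f + g) \<le> p f + p g" "p (ck_scale c f) = norm c * p f" for f g c
    using assms by (auto simp: ck_seminorm_def)
  show 3: "p (r *\<^sub>R f) = \<bar>r\<bar> * p f" for r f
    using 1(2)[of "of_real r" f] by (simp add: ck_scale_algebra)
  show "p 0 = 0" "p (- f) = p f" using 3[of 0 0] 3[of "-1" f] by auto
  then show "0 \<le> p f" using 1(1)[of f "- f"] by simp
qed

text \<open>The real-linear functionals \<open>\<psi>\<close> with \<open>\<psi> \<le> p1\<close> and \<open>Re \<mu> - \<psi> \<le> p2\<close> are exactly those below the infimal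
  convolution \<open>q h = INF g. p1 g + p2 (h - g) + Re (\<mu> (h - g))\<close>, and the hypothesis says that this infimum
  is finite.\<close>

lemma functional_decomposition:
  fixes \<mu> :: "('a::topological_space \<Rightarrow>\<^sub>C 'k::{real_normed_field,euclidean_space}) \<Rightarrow>\<^sub>L 'k"
  assumes \<mu>: "\<mu> \<in> functionals ck_scale"
    and p1: "ck_seminorm p1" and p2: "ck_seminorm p2"
    and L: "\<And>f. p1 f \<le> L * norm f"
    and dom: "\<And>f. norm (\<mu> f) \<le> p1 f + p2 f"
  obtains \<psi> where "\<psi> \<in> functionals ck_scale" "\<And>f. norm (blinfun_apply \<psi> f) \<le> p1 f"
    "\<And>f. norm (blinfun_apply \<mu> f - blinfun_apply \<psi> f) \<le> p2 f"
proof -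
  note p1 = ck_seminormD[OF p1] and p2 = ck_seminormD[OF p2]
  define re :: "'k \<Rightarrow> real" where "re z = inner z 1" for z
  have one: "inner (1::'k) 1 = 1" by (simp add: norm_eq_1[symmetric])
  have re: "re (x + y) = re x + re y" "re (r *\<^sub>R x) = r * re x" "re (of_real r) = r" "re x \<le> norm x"
    "re (x - y) = re x - re y" "re (- x) = - re x" "re 0 = 0"
    for x y r
    using norm_cauchy_schwarz[of x 1] one
    by (auto simp: re_def inner_add_left inner_diff_left of_real_def)
  define q where "q h = (INF g. p1 g + p2 (h - g) + re (\<mu> (h - g)))" for h
  have low: "re (\<mu> h) - p2 h \<le> p1 g + p2 (h - g) + re (\<mu> (h - g))" for h g
  proof -
    have "re (\<mu> g) \<le> p1 g + p2 g" using re(4)[of "\<mu> g"] dom[of g] by linarith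
    moreover have "p2 g \<le> p2 (h - g) + p2 h"
      using p2(1)[of "g - h" h] p2(5)[of "h - g"] by simp
    ultimately show ?thesis by (simp add: blinfun.diff_right re)
  qed
  have bdd: "bdd_below (range (\<lambda>g. p1 g + p2 (h - g) + re (\<mu> (h - g))))" for h
    by (rule bdd_belowI2[OF low])
  have qle: "q h \<le> p1 g + p2 (h - g) + re (\<mu> (h - g))" for h g
    unfolding q_def by (rule cINF_lower[OF bdd]) simp
  have qadd: "q (h + k) \<le> q h + q k" for h k
  proof -
    have *: "q (h + k) \<le> (p1 a + p2 (h - a) + re (\<mu> (h - a))) + (p1 b + p2 (k - b) + re (\<mu> (k - b)))" for a b
    proof -
      have eq: "h + k - (a + b) = (h - a) + (k - b)" by simp
      show ?thesis
        using qle[of "h + k" "a + b"] p1(1)[of a b] p2(1)[of "h - a" "k - b"]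
        unfolding eq by (simp add: blinfun.add_right re)
    qed
    have "q (h + k) - (p1 b + p2 (k - b) + re (\<mu> (k - b))) \<le> q h" for b
      unfolding q_def[of h] by (rule cINF_greatest) (use *[of _ b] in \<open>auto simp: algebra_simps\<close>)
    then have "q (h + k) - q h \<le> q k"
      unfolding q_def[of k] by (intro cINF_greatest) (auto simp: algebra_simps)
    then show ?thesis by simp
  qed
  have qle': "q (r *\<^sub>R h) \<le> r * q h" if "r > 0" for r h
  proof -
    have "inverse r * q (r *\<^sub>R h) \<le> q h"
      unfolding q_def[of h]
    proof (rule cINF_greatest)
      fix g
      have "q (r *\<^sub>R h) \<le> r * (p1 g + p2 (h - g) + re (\<mu> (h - g)))"
        using qle[of "r *\<^sub>R h" "r *\<^sub>R g"] that
        by (simp add: p1 p2 re blinfun.scaleR_right scaleR_diff_right[symmetric] ring_distribs)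
      then show "inverse r * q (r *\<^sub>R h) \<le> p1 g + p2 (h - g) + re (\<mu> (h - g))"
        using that by (simp add: field_simps)
    qed simp
    then show ?thesis using that by (simp add: field_simps)
  qed
  have q0: "q 0 = 0"
  proof (rule antisym)
    show "q 0 \<le> 0" using qle[of 0 0] by (simp add: p1 p2 re blinfun.zero_right)
    show "0 \<le> q 0" unfolding q_def
      by (rule cINF_greatest) (use low[of 0] in \<open>auto simp: p1 p2 re blinfun.zero_right\<close>)
  qed
  have "q (r *\<^sub>R h) = r * q h" if "r \<ge> 0" for r h
  proof (cases "r = 0")
    case True then show ?thesis using q0 by simp
  next
    case False
    with that have r: "r > 0" by simp
    have "q h \<le> inverse r * q (r *\<^sub>R h)"
      using qle'[of "inverse r" "r *\<^sub>R h"] r by simp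
    then have "r * q h \<le> q (r *\<^sub>R h)" using r by (simp add: field_simps)
    with qle'[OF r, of h] show ?thesis by simp
  qed
  with qadd have "sublinear q" by (simp add: sublinear_def)
  then obtain l where l: "linear l" "\<And>h. l h \<le> q h"
    by (rule sublinear_dominates_linear) blast
  have ck_lin: "linear (\<lambda>c. l (ck_scale c f))" for f
    by (rule linearI)
      (simp_all add: ck_scale_algebra linear_add[OF l(1)] scaleR_conv_of_real linear_scale[OF l(1)])
  define \<psi> where "\<psi> f = (THE z. \<forall>c. l (ck_scale c f) = re (c * z))" for f
  have ex: "\<exists>!z. \<forall>c. l (ck_scale c f) = re (c * z)" for f
    unfolding re_def by (rule field_riesz[OF ck_lin])
  have \<psi>: "l (ck_scale c f) = re (c * \<psi> f)" for c f
    using theI'[OF ex[of f]] unfolding \<psi>_def by blast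
  have \<psi>I: "\<psi> f = z" if "\<And>c. l (ck_scale c f) = re (c * z)" for f z
    using ex[of f] \<psi> that by blast
  have \<psi>_add: "\<psi> (f + g) = \<psi> f + \<psi> g" for f g
    by (rule \<psi>I) (simp add: ck_scale_algebra linear_add[OF l(1)] \<psi> re ring_distribs)
  have \<psi>_scale: "\<psi> (ck_scale d f) = d * \<psi> f" for d f
    by (rule \<psi>I) (simp add: ck_scale_algebra(3)[symmetric] \<psi> mult.assoc)
  have \<psi>_le: "norm (\<psi> f) \<le> p1 f" for f
  proof -
    obtain c where c: "norm c = 1" "c * \<psi> f = of_real (norm (\<psi> f))" by (rule norm_rotation)
    have "norm (\<psi> f) = l (ck_scale c f)" using \<psi>[of c f] c re by simp
    also have "\<dots> \<le> p1 (ck_scale c f)"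
      using l(2)[of "ck_scale c f"] qle[of "ck_scale c f" "ck_scale c f"]
      by (simp add: p2 re blinfun.zero_right)
    finally show ?thesis using c by (simp add: p1)
  qed
  have \<psi>_diff: "norm (\<mu> f - \<psi> f) \<le> p2 f" for f
  proof -
    obtain c where c: "norm c = 1" "c * (\<mu> f - \<psi> f) = of_real (norm (\<mu> f - \<psi> f))" by (rule norm_rotation)
    have \<mu>c: "\<mu> (ck_scale d f) = d * \<mu> f" for d
      using \<mu> by (simp add: klinear_maps_def)
    have "l (ck_scale (- c) f) \<le> p2 (ck_scale (- c) f) + re (\<mu> (ck_scale (- c) f))"
      using l(2)[of "ck_scale (- c) f"] qle[of "ck_scale (- c) f" 0] by (simp add: p1)
    then have "re (c * \<mu> f) - re (c * \<psi> f) \<le> p2 f"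
      using c(1) by (simp add: \<psi> \<mu>c p2 re)
    moreover have "re (c * (\<mu> f - \<psi> f)) = norm (\<mu> f - \<psi> f)" unfolding c(2) re(3) ..
    ultimately show ?thesis by (simp add: right_diff_distrib re)
  qed
  have bl: "bounded_linear \<psi>"
  proof (rule bounded_linear_intro[OF \<psi>_add])
    show "\<psi> (r *\<^sub>R f) = r *\<^sub>R \<psi> f" for r f
      using \<psi>_scale[of "of_real r" f] by (simp add: ck_scale_algebra scaleR_conv_of_real)
    show "norm (\<psi> f) \<le> norm f * L" for f
      using \<psi>_le[of f] L[of f] by (simp add: mult.commute)
  qed
  show ?thesis
    by (rule that[of "Blinfun \<psi>"])
      (simp_all add: klinear_maps_def bounded_linear_Blinfun_apply[OF bl] \<psi>_scale \<psi>_le \<psi>_diff)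
qed

abbreviation ev :: "('a::topological_space, 'k::real_normed_field) ck_dual \<Rightarrow> ('a \<Rightarrow>\<^sub>C 'k) \<Rightarrow> 'k" where
  "ev \<phi> f \<equiv> blinfun_apply (ck_functional \<phi>) f"

lemma ev_simps:
  "ev (\<phi> + \<psi>) f = ev \<phi> f + ev \<psi> f"
  "ev (\<phi> - \<psi>) f = ev \<phi> f - ev \<psi> f"
  "ev (- \<phi>) f = - ev \<phi> f"
  "ev 0 f = 0"
  "ev (r *\<^sub>R \<phi>) f = r *\<^sub>R ev \<phi> f"
  "ev (ck_dual_scale c \<phi>) f = c * ev \<phi> f"
  "ev \<phi> (f + g) = ev \<phi> f + ev \<phi> g"
  "ev \<phi> (f - g) = ev \<phi> f - ev \<phi> g"
  "ev \<phi> (- f) = - ev \<phi> f"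
  "ev \<phi> 0 = 0"
  "ev \<phi> (r *\<^sub>R f) = r *\<^sub>R ev \<phi> f"
  "ev \<phi> (ck_scale c f) = c * ev \<phi> f"
  using ck_functional[of \<phi>]
  by (simp_all add: plus_ck_dual.rep_eq minus_ck_dual.rep_eq uminus_ck_dual.rep_eq zero_ck_dual.rep_eq
      scaleR_ck_dual.rep_eq ck_dual_scale.rep_eq blinfun.bilinear_simps klinear_maps_def)

lemma norm_ev_le: "norm (ev \<phi> f) \<le> norm \<phi> * norm f"
  by (simp add: norm_ck_dual.rep_eq norm_blinfun)

lemma norm_ck_dual_le:
  assumes "\<And>f. norm (ev \<phi> f) \<le> B * norm f" "0 \<le> B"
  shows "norm \<phi> \<le> B"
  unfolding norm_ck_dual.rep_eq by (rule norm_blinfun_bound[OF assms(2,1)])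

lemma ck_dual_construct:
  assumes "\<And>f g. l (f + g) = l f + l g" "\<And>c f. l (ck_scale c f) = c * l f"
    and "\<And>f. norm (l f) \<le> B * norm f"
  obtains \<phi> :: "('a::topological_space, 'k::real_normed_field) ck_dual" where "\<And>f. ev \<phi> f = l f"
proof -
  have bl: "bounded_linear l"
  proof (rule bounded_linear_intro[OF assms(1)])
    show "l (r *\<^sub>R f) = r *\<^sub>R l f" for r f
      using assms(2)[of "of_real r" f] by (simp add: ck_scale_algebra scaleR_conv_of_real)
    show "norm (l f) \<le> norm f * B" for f using assms(3)[of f] by (simp add: mult.commute)
  qed
  have "Blinfun l \<in> functionals ck_scale"
    by (simp add: klinear_maps_def bounded_linear_Blinfun_apply[OF bl] assms(2))
  then show ?thesis
    by (intro that[of "Ck_dual (Blinfun l)"]) (simp add: Ck_dual_inverse bounded_linear_Blinfun_apply[OF bl])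
qed

lemma ck_dual_scale_of_real: "ck_dual_scale (of_real r) \<phi> = r *\<^sub>R \<phi>"
  by (rule ck_dual_eqI) (simp add: ev_simps scaleR_conv_of_real)

text \<open>Operators on the dual are always given below by their bilinear form \<open>(\<phi>, f) \<mapsto> (W \<phi>) f\<close>.\<close>

lemma dual_operator_construct:
  fixes B :: "('a::topological_space, 'k::real_normed_field) ck_dual \<Rightarrow> ('a \<Rightarrow>\<^sub>C 'k) \<Rightarrow> 'k"
  assumes add: "\<And>\<phi> \<psi> f. B (\<phi> + \<psi>) f = B \<phi> f + B \<psi> f" "\<And>\<phi> f g. B \<phi> (f + g) = B \<phi> f + B \<phi> g"
    and scale: "\<And>c \<phi> f. B (ck_dual_scale c \<phi>) f = c * B \<phi> f" "\<And>c \<phi> f. B \<phi> (ck_scale c f) = c * B \<phi> f"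
    and le: "\<And>\<phi> f. norm (B \<phi> f) \<le> L * norm \<phi> * norm f"
  obtains W where "W \<in> operators ck_dual_scale" "\<And>\<phi> f. ev (blinfun_apply W \<phi>) f = B \<phi> f"
proof -
  have "\<exists>\<xi>. \<forall>f. ev \<xi> f = B \<phi> f" for \<phi>
    by (rule ck_dual_construct[of "B \<phi>" "L * norm \<phi>"]) (use assms in auto)
  then obtain w where w: "\<And>\<phi> f. ev (w \<phi>) f = B \<phi> f" by metis
  have wscale: "w (ck_dual_scale c \<phi>) = ck_dual_scale c (w \<phi>)" for c \<phi>
    by (rule ck_dual_eqI) (simp add: w ev_simps scale)
  have bl: "bounded_linear w"
  proof (rule bounded_linear_intro)
    show "w (\<phi> + \<psi>) = w \<phi> + w \<psi>" for \<phi> \<psi>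
      by (rule ck_dual_eqI) (simp add: w ev_simps add)
    show "w (r *\<^sub>R \<phi>) = r *\<^sub>R w \<phi>" for r \<phi>
      using wscale[of "of_real r"] by (simp add: ck_dual_scale_of_real)
    show "norm (w \<phi>) \<le> norm \<phi> * \<bar>L\<bar>" for \<phi>
    proof (rule norm_ck_dual_le)
      fix f
      have "norm (ev (w \<phi>) f) \<le> L * (norm \<phi> * norm f)" using le[of \<phi> f] by (simp add: w mult.assoc)
      also have "\<dots> \<le> \<bar>L\<bar> * (norm \<phi> * norm f)" by (intro mult_right_mono) auto
      finally show "norm (ev (w \<phi>) f) \<le> norm \<phi> * \<bar>L\<bar> * norm f" by (simp add: ac_simps)
    qed simp
  qed
  show ?thesis
    by (rule that[of "Blinfun w"]) (simp_all add: klinear_maps_def bounded_linear_Blinfun_apply[OF bl] w wscale)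
qed

lemma point_functional:
  obtains F where "F \<in> functionals ck_dual_scale" "\<And>\<phi>. blinfun_apply F \<phi> = ev \<phi> f"
proof -
  have bl: "bounded_linear (\<lambda>\<phi>. ev \<phi> f)"
    by (rule bounded_linear_intro[where K="norm f"]) (simp_all add: ev_simps norm_ev_le)
  show ?thesis
    by (rule that[of "Blinfun (\<lambda>\<phi>. ev \<phi> f)"]) (simp_all add: klinear_maps_def bounded_linear_Blinfun_apply[OF bl] ev_simps)
qed

lemma point_mass_exists: "\<exists>\<phi>. \<forall>f. ev \<phi> f = apply_bcontfun f x"
  by (rule ck_dual_construct[of "\<lambda>f. apply_bcontfun f x" 1]) (use norm_bounded in auto)

definition point_mass :: "'a::topological_space \<Rightarrow> ('a, 'k::real_normed_field) ck_dual" where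
  "point_mass x = (SOME \<phi>. \<forall>f. ev \<phi> f = apply_bcontfun f x)"

lemma ev_point_mass: "ev (point_mass x) f = apply_bcontfun f x"
proof -
  have "\<forall>f. ev (point_mass x) f = apply_bcontfun f x"
    unfolding point_mass_def by (rule someI_ex[OF point_mass_exists])
  then show ?thesis by blast
qed

lemma norm_point_mass_le: "norm (point_mass x) \<le> 1"
  by (rule norm_ck_dual_le) (simp_all add: ev_point_mass norm_bounded)

lemma ev_adjoint_op:
  "T \<in> operators ck_scale \<Longrightarrow> ev (blinfun_apply (adjoint_op T) \<phi>) f = ev \<phi> (T f)"
  by (rule ck_functional_adjoint_op)

section \<open>Weak compactness of polars of Hilbertian seminorms\<close>

text \<open>A seminorm that satisfies the parallelogram law is the seminorm of a (possibly degenerate) inner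
  product. Only the inequality is assumed; applied to \<open>f + g\<close> and \<open>f - g\<close> it gives the
  equality.\<close>

locale hilbertian_seminorm =
  fixes p :: "('a::topological_space \<Rightarrow>\<^sub>C 'k::{real_normed_field,euclidean_space}) \<Rightarrow> real"
    and L :: real
  assumes seminorm: "ck_seminorm p"
    and p_le: "\<And>f. p f \<le> L * norm f"
    and parallelogram: "\<And>f g. (p (f + g))\<^sup>2 + (p (f - g))\<^sup>2 \<le> 2 * (p f)\<^sup>2 + 2 * (p g)\<^sup>2"
begin

lemmas p_scale = ck_seminormD(2)[OF seminorm]
  and p_scaleR = ck_seminormD(3)[OF seminorm]
  and p_zero = ck_seminormD(4)[OF seminorm]
  and p_nonneg = ck_seminormD(6)[OF seminorm]

definition unit_polar :: "('a, 'k) ck_dual set" where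
  "unit_polar = {\<xi>. \<forall>f. norm (ev \<xi> f) \<le> p f}"

text \<open>The functionals in the span of the polar, that is, those that extend to the Hilbert space completion
  of \<open>(C(K), p)\<close>.\<close>

definition p_bounded :: "('a, 'k) ck_dual \<Rightarrow> bool" where
  "p_bounded \<xi> \<longleftrightarrow> (\<exists>C\<ge>0. \<forall>f. norm (ev \<xi> f) \<le> C * p f)"

definition dual_norm :: "('a, 'k) ck_dual \<Rightarrow> real" where
  "dual_norm \<xi> = (SUP f\<in>{f. p f \<le> 1}. norm (ev \<xi> f))"

lemma dual_norm_bdd: "p_bounded \<xi> \<Longrightarrow> bdd_above ((\<lambda>f. norm (ev \<xi> f)) ` {f. p f \<le> 1})"
proof (unfold p_bounded_def, elim exE conjE)
  fix C assume C: "0 \<le> C" "\<forall>f. norm (ev \<xi> f) \<le> C * p f"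
  show ?thesis
  proof (rule bdd_aboveI2)
    fix f assume "f \<in> {f. p f \<le> 1}"
    then have "C * p f \<le> C" using C(1) by (simp add: mult_left_le)
    then show "norm (ev \<xi> f) \<le> C" using C(2) order_trans by blast
  qed
qed

lemma dual_norm_ge: "p_bounded \<xi> \<Longrightarrow> p f \<le> 1 \<Longrightarrow> norm (ev \<xi> f) \<le> dual_norm \<xi>"
  unfolding dual_norm_def by (rule cSUP_upper[OF _ dual_norm_bdd]) auto

lemma dual_norm_nonneg: "p_bounded \<xi> \<Longrightarrow> 0 \<le> dual_norm \<xi>"
  using dual_norm_ge[of \<xi> 0] by (simp add: p_zero ev_simps)

lemma dual_norm_le: "(\<And>f. norm (ev \<xi> f) \<le> C * p f) \<Longrightarrow> 0 \<le> C \<Longrightarrow> dual_norm \<xi> \<le> C"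
  unfolding dual_norm_def
  by (rule cSUP_least) (auto simp: p_zero intro!: exI[of _ 0] intro: order_trans mult_left_le)

lemma dual_norm_bound:
  assumes "p_bounded \<xi>"
  shows "norm (ev \<xi> f) \<le> dual_norm \<xi> * p f"
proof (cases "p f = 0")
  case True
  then show ?thesis using assms by (auto simp: p_bounded_def dest: spec[of _ f])
next
  case False
  then have p: "p f > 0" using p_nonneg[of f] by simp
  have "norm (ev \<xi> (inverse (p f) *\<^sub>R f)) \<le> dual_norm \<xi>"
    by (rule dual_norm_ge[OF assms]) (use p in \<open>simp add: p_scaleR\<close>)
  then show ?thesis using p by (simp add: ev_simps field_simps)
qed

lemma dual_norm_approx:
  assumes "p_bounded \<xi>" "a < dual_norm \<xi>"
  obtains f r where "p f \<le> 1" "ev \<xi> f = of_real r" "a < r"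
proof -
  have ne: "{f. p f \<le> 1} \<noteq> {}" using p_zero by (auto intro!: exI[of _ 0])
  obtain f where f: "p f \<le> 1" "a < norm (ev \<xi> f)"
    using assms(2) less_cSUP_iff[OF ne dual_norm_bdd[OF assms(1)]] unfolding dual_norm_def by auto
  obtain c where c: "norm c = 1" "c * ev \<xi> f = of_real (norm (ev \<xi> f))" by (rule norm_rotation)
  show ?thesis
    by (rule that[of "ck_scale c f" "norm (ev \<xi> f)"]) (use f c in \<open>simp_all add: p_scale ev_simps\<close>)
qed

lemma p_bounded_add: "p_bounded \<xi> \<Longrightarrow> p_bounded \<omega> \<Longrightarrow> p_bounded (\<xi> + \<omega>)"
  unfolding p_bounded_def
proof (elim exE conjE)
  fix C D assume C: "C \<ge> 0" "\<forall>f. norm (ev \<xi> f) \<le> C * p f" and D: "D \<ge> 0" "\<forall>f. norm (ev \<omega> f) \<le> D * p f"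
  have "norm (ev (\<xi> + \<omega>) f) \<le> (C + D) * p f" for f
    using norm_triangle_ineq[of "ev \<xi> f" "ev \<omega> f"] C(2)[rule_format, of f] D(2)[rule_format, of f]
    by (simp add: ev_simps algebra_simps)
  with C D show "\<exists>C\<ge>0. \<forall>f. norm (ev (\<xi> + \<omega>) f) \<le> C * p f" by (intro exI[of _ "C + D"]) auto
qed

lemma p_bounded_scaleR: "p_bounded \<xi> \<Longrightarrow> p_bounded (r *\<^sub>R \<xi>)"
  unfolding p_bounded_def
proof (elim exE conjE)
  fix C assume C: "C \<ge> 0" "\<forall>f. norm (ev \<xi> f) \<le> C * p f"
  have "norm (ev (r *\<^sub>R \<xi>) f) \<le> (\<bar>r\<bar> * C) * p f" for f
    using mult_left_mono[OF C(2)[rule_format, of f], of "\<bar>r\<bar>"]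
    by (simp add: ev_simps mult.assoc)
  with C show "\<exists>C\<ge>0. \<forall>f. norm (ev (r *\<^sub>R \<xi>) f) \<le> C * p f" by (intro exI[of _ "\<bar>r\<bar> * C"]) auto
qed

lemma p_bounded_diff: "p_bounded \<xi> \<Longrightarrow> p_bounded \<omega> \<Longrightarrow> p_bounded (\<xi> - \<omega>)"
  using p_bounded_add[of \<xi> "(-1) *\<^sub>R \<omega>"] p_bounded_scaleR[of \<omega> "-1"] by simp

text \<open>The dual of a Hilbert space is a Hilbert space. The direct reason: for \<open>A = dual_norm (\<xi> + \<omega>)\<close> and
  \<open>B = dual_norm (\<xi> - \<omega>)\<close>, test \<open>\<xi> + \<omega>\<close> on \<open>A f\<close> and \<open>\<xi> - \<omega>\<close> on \<open>B g\<close> with nearly norming \<open>f\<close>, \<open>g\<close>, and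
  regroup the sum as \<open>\<xi> (A f + B g) + \<omega> (A f - B g)\<close>.\<close>

lemma dual_norm_parallelogram:
  assumes \<xi>: "p_bounded \<xi>" and \<omega>: "p_bounded \<omega>"
  shows "(dual_norm (\<xi> + \<omega>))\<^sup>2 + (dual_norm (\<xi> - \<omega>))\<^sup>2 \<le> 2 * (dual_norm \<xi>)\<^sup>2 + 2 * (dual_norm \<omega>)\<^sup>2"
proof -
  define A B where "A = dual_norm (\<xi> + \<omega>)" and "B = dual_norm (\<xi> - \<omega>)"
  define D where "D = (dual_norm \<xi>)\<^sup>2 + (dual_norm \<omega>)\<^sup>2"
  have AB: "A \<ge> 0" "B \<ge> 0"
    unfolding A_def B_def by (intro dual_norm_nonneg p_bounded_add p_bounded_diff \<xi> \<omega>)+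
  have main: "A\<^sup>2 + B\<^sup>2 - e * (A + B) \<le> sqrt D * sqrt (2 * (A\<^sup>2 + B\<^sup>2))" if e: "e > 0" for e
  proof -
    obtain f \<alpha> where f: "p f \<le> 1" "ev (\<xi> + \<omega>) f = of_real \<alpha>" "A - e < \<alpha>"
      by (rule dual_norm_approx[OF p_bounded_add[OF \<xi> \<omega>], of "A - e"]) (use e in \<open>auto simp: A_def\<close>)
    obtain g \<beta> where g: "p g \<le> 1" "ev (\<xi> - \<omega>) g = of_real \<beta>" "B - e < \<beta>"
      by (rule dual_norm_approx[OF p_bounded_diff[OF \<xi> \<omega>], of "B - e"]) (use e in \<open>auto simp: B_def\<close>)
    let ?u = "A *\<^sub>R f + B *\<^sub>R g" and ?v = "A *\<^sub>R f - B *\<^sub>R g"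
    have "ev \<xi> ?u + ev \<omega> ?v = A *\<^sub>R ev (\<xi> + \<omega>) f + B *\<^sub>R ev (\<xi> - \<omega>) g"
      by (simp add: ev_simps algebra_simps)
    also have "\<dots> = of_real (A * \<alpha> + B * \<beta>)"
      unfolding f g by (simp add: scaleR_conv_of_real)
    finally have eq: "ev \<xi> ?u + ev \<omega> ?v = of_real (A * \<alpha> + B * \<beta>)" .
    have "A * (A - e) + B * (B - e) \<le> A * \<alpha> + B * \<beta>"
      using AB f(3) g(3) by (intro add_mono mult_left_mono) auto
    also have "\<dots> \<le> norm (ev \<xi> ?u + ev \<omega> ?v)" unfolding eq norm_of_real by (rule abs_ge_self)
    also have "\<dots> \<le> dual_norm \<xi> * p ?u + dual_norm \<omega> * p ?v"
      using norm_triangle_ineq[of "ev \<xi> ?u" "ev \<omega> ?v"] dual_norm_bound[OF \<xi>, of ?u] dual_norm_bound[OF \<omega>, of ?v]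
      by linarith
    also have "\<dots> \<le> sqrt D * sqrt ((p ?u)\<^sup>2 + (p ?v)\<^sup>2)"
    proof -
      have "(dual_norm \<xi> * p ?u + dual_norm \<omega> * p ?v)\<^sup>2 \<le> D * ((p ?u)\<^sup>2 + (p ?v)\<^sup>2)"
        using zero_le_power2[of "dual_norm \<xi> * p ?v - dual_norm \<omega> * p ?u"]
        unfolding D_def by (simp add: power2_eq_square algebra_simps)
      then show ?thesis unfolding real_sqrt_mult[symmetric] by (rule real_le_rsqrt)
    qed
    also have "\<dots> \<le> sqrt D * sqrt (2 * (A\<^sup>2 + B\<^sup>2))"
    proof (intro mult_left_mono real_sqrt_le_mono)
      have "(p (A *\<^sub>R f))\<^sup>2 \<le> A\<^sup>2" "(p (B *\<^sub>R g))\<^sup>2 \<le> B\<^sup>2"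
        using f(1) g(1) AB p_nonneg by (auto simp: p_scaleR intro!: power_mono mult_left_le)
      then show "(p ?u)\<^sup>2 + (p ?v)\<^sup>2 \<le> 2 * (A\<^sup>2 + B\<^sup>2)"
        using parallelogram[of "A *\<^sub>R f" "B *\<^sub>R g"] by argo
    qed (simp add: D_def)
    finally show ?thesis by (simp add: power2_eq_square algebra_simps)
  qed
  have "A\<^sup>2 + B\<^sup>2 \<le> sqrt D * sqrt (2 * (A\<^sup>2 + B\<^sup>2))"
  proof (rule field_le_epsilon)
    fix e :: real assume "e > 0"
    then have "e / (A + B + 1) > 0" using AB by simp
    from main[OF this] have "A\<^sup>2 + B\<^sup>2 \<le> sqrt D * sqrt (2 * (A\<^sup>2 + B\<^sup>2)) + e / (A + B + 1) * (A + B)" by simp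
    also have "e / (A + B + 1) * (A + B) \<le> e"
      using AB \<open>e > 0\<close> by (simp add: divide_simps algebra_simps)
    finally show "A\<^sup>2 + B\<^sup>2 \<le> sqrt D * sqrt (2 * (A\<^sup>2 + B\<^sup>2)) + e" by simp
  qed
  then have "(A\<^sup>2 + B\<^sup>2)\<^sup>2 \<le> (sqrt D * sqrt (2 * (A\<^sup>2 + B\<^sup>2)))\<^sup>2"
    by (intro power_mono) auto
  then have "(A\<^sup>2 + B\<^sup>2)\<^sup>2 \<le> D * (2 * (A\<^sup>2 + B\<^sup>2))"
    by (simp add: power_mult_distrib D_def)
  then have "(A\<^sup>2 + B\<^sup>2) * (A\<^sup>2 + B\<^sup>2) \<le> (2 * D) * (A\<^sup>2 + B\<^sup>2)"
    by (simp add: power2_eq_square ac_simps)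
  then have "A\<^sup>2 + B\<^sup>2 \<le> 2 * D"
    by (cases "A\<^sup>2 + B\<^sup>2 = 0") (auto simp: D_def sum_power2_gt_zero_iff mult_le_cancel_right)
  then show ?thesis by (simp add: A_def B_def D_def)
qed

text \<open>Reflexivity of Hilbert spaces, in the form needed here: on the polar, every element \<open>F\<close> of the bidual
  is a uniform limit of evaluations at elements of \<open>C(K)\<close>. If \<open>s\<close> is the norm of \<open>F\<close> on the polar, choose
  \<open>\<psi>2\<close> in the polar with \<open>F \<psi>2\<close> close to \<open>s\<close>, and \<open>f\<close> with \<open>p f \<le> s\<close> and \<open>\<psi>2 f\<close> close to \<open>s\<close>. Then \<open>F\<close>
  and the evaluation at \<open>f\<close> nearly attain their norm at the same point, and uniform convexity, which is
  the parallelogram law for the dual norm, forces them to be close.\<close>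

lemma polar_approx_evaluation:
  fixes F :: "('a, 'k) ck_dual \<Rightarrow>\<^sub>L 'k"
  assumes F: "F \<in> functionals ck_dual_scale" and "\<epsilon> > 0"
  obtains f where "\<And>\<psi>. \<psi> \<in> unit_polar \<Longrightarrow> norm (blinfun_apply F \<psi> - ev \<psi> f) \<le> \<epsilon>"
proof -
  have Fc: "blinfun_apply F (ck_dual_scale c \<phi>) = c * F \<phi>" for c \<phi>
    using F by (simp add: klinear_maps_def)
  define s where "s = (SUP \<psi>\<in>unit_polar. norm (F \<psi>))"
  have zero: "0 \<in> unit_polar" by (simp add: unit_polar_def ev_simps p_nonneg)
  have polar_norm: "norm \<psi> \<le> \<bar>L\<bar>" if "\<psi> \<in> unit_polar" for \<psi>
  proof (rule norm_ck_dual_le)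
    fix f
    have "norm (ev \<psi> f) \<le> L * norm f" using that p_le[of f] by (force simp: unit_polar_def intro: order_trans)
    also have "\<dots> \<le> \<bar>L\<bar> * norm f" by (intro mult_right_mono) auto
    finally show "norm (ev \<psi> f) \<le> \<bar>L\<bar> * norm f" .
  qed simp
  have bdd: "bdd_above ((\<lambda>\<psi>. norm (F \<psi>)) ` unit_polar)"
  proof (rule bdd_aboveI2)
    fix \<psi> assume "\<psi> \<in> unit_polar"
    then show "norm (F \<psi>) \<le> norm F * \<bar>L\<bar>"
      using norm_blinfun[of F \<psi>] polar_norm[of \<psi>] by (meson mult_left_mono norm_ge_zero order_trans)
  qed
  have Fs: "norm (F \<psi>) \<le> s" if "\<psi> \<in> unit_polar" for \<psi>
    unfolding s_def by (rule cSUP_upper[OF that bdd])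
  have s0: "0 \<le> s" using Fs[OF zero] by (simp add: blinfun.zero_right)
  have polar_rot: "ck_dual_scale c \<psi> \<in> unit_polar" if "\<psi> \<in> unit_polar" "norm c = 1" for c \<psi>
    using that by (simp add: unit_polar_def ev_simps norm_mult)
  have polar_bd: "p_bounded \<psi>" "dual_norm \<psi> \<le> 1" if "\<psi> \<in> unit_polar" for \<psi>
  proof -
    have *: "norm (ev \<psi> f) \<le> 1 * p f" for f using that by (simp add: unit_polar_def)
    then show "p_bounded \<psi>" unfolding p_bounded_def by (intro exI[of _ 1]) simp
    show "dual_norm \<psi> \<le> 1" by (rule dual_norm_le[OF *]) simp
  qed
  have Fd: "norm (F \<xi>) \<le> s * dual_norm \<xi>" if \<xi>: "p_bounded \<xi>" for \<xi>
  proof (cases "dual_norm \<xi> = 0")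
    case True
    then have "ev \<xi> f = 0" for f using dual_norm_bound[OF \<xi>, of f] by simp
    then have "\<xi> = 0" by (intro ck_dual_eqI) (simp add: ev_simps)
    then show ?thesis using True by (simp add: blinfun.zero_right)
  next
    case False
    then have d: "dual_norm \<xi> > 0" using dual_norm_nonneg[OF \<xi>] by simp
    have "inverse (dual_norm \<xi>) *\<^sub>R \<xi> \<in> unit_polar"
      using d dual_norm_bound[OF \<xi>] by (simp add: unit_polar_def ev_simps divide_simps mult.commute)
    from Fs[OF this] show ?thesis using d by (simp add: blinfun.scaleR_right field_simps)
  qed
  show ?thesis
  proof (cases "s = 0")
    case True
    show ?thesis by (rule that[of 0]) (use Fs True \<open>\<epsilon> > 0\<close> in \<open>force simp: ev_simps\<close>)
  next
    case False
    with s0 have s: "s > 0" by simp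
    \<comment> \<open>The final estimate reads \<open>t * d \<le> s * t\<^sup>2 + t\<^sup>2\<close> for the distance \<open>d\<close>; the errors
      of \<open>\<psi>2\<close> and \<open>f\<close> contribute the second square.\<close>
    define t where "t = \<epsilon> / (s + 1)"
    have t: "t > 0" "(s + 1) * t = \<epsilon>" using s \<open>\<epsilon> > 0\<close> by (auto simp: t_def)
    obtain \<psi>0 where \<psi>0: "\<psi>0 \<in> unit_polar" "s - t\<^sup>2 / 2 < norm (F \<psi>0)"
      using less_cSUP_iff[of unit_polar, OF _ bdd, of "s - t\<^sup>2 / 2"] zero t unfolding s_def by auto
    obtain c where c: "norm c = 1" "c * F \<psi>0 = of_real (norm (F \<psi>0))" by (rule norm_rotation)
    define \<psi>2 where "\<psi>2 = ck_dual_scale c \<psi>0"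
    define r where "r = norm (F \<psi>0)"
    have \<psi>2: "\<psi>2 \<in> unit_polar" "F \<psi>2 = of_real r" and r: "s - t\<^sup>2 / 2 < r"
      using polar_rot[OF \<psi>0(1) c(1)] c \<psi>0 by (simp_all add: \<psi>2_def Fc r_def)
    have "r / s \<le> dual_norm \<psi>2"
      using Fd[OF polar_bd(1)[OF \<psi>2(1)]] \<psi>2(2) s by (simp add: r_def field_simps)
    moreover have "(s - t\<^sup>2 / 2) / s < r / s" using s r by (simp add: divide_strict_right_mono)
    ultimately have "(s - t\<^sup>2 / 2) / s < dual_norm \<psi>2" by linarith
    then obtain f0 r0 where f0: "p f0 \<le> 1" "ev \<psi>2 f0 = of_real r0" "(s - t\<^sup>2 / 2) / s < r0"
      by (rule dual_norm_approx[OF polar_bd(1)[OF \<psi>2(1)]])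
    define f where "f = s *\<^sub>R f0"
    have pf: "p f \<le> s" using f0 s by (simp add: f_def p_scaleR)
    have r': "ev \<psi>2 f = of_real (s * r0)" "s - t\<^sup>2 / 2 < s * r0"
      using f0 s by (simp_all add: f_def ev_simps scaleR_conv_of_real field_simps)
    show ?thesis
    proof (rule that[of f])
      fix \<psi> assume \<psi>: "\<psi> \<in> unit_polar"
      define d where "d = norm (F \<psi> - ev \<psi> f)"
      obtain c where c: "norm c = 1" "c * (F \<psi> - ev \<psi> f) = of_real d"
        unfolding d_def by (rule norm_rotation)
      define \<psi>1 where "\<psi>1 = ck_dual_scale c \<psi>"
      have \<psi>1: "\<psi>1 \<in> unit_polar" "F \<psi>1 - ev \<psi>1 f = of_real d"
        using polar_rot[OF \<psi> c(1)] c(2) by (simp_all add: \<psi>1_def Fc ev_simps right_diff_distrib)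
      let ?\<xi> = "\<psi>2 + t *\<^sub>R \<psi>1" and ?\<omega> = "\<psi>2 - t *\<^sub>R \<psi>1"
      have bd: "p_bounded ?\<xi>" "p_bounded ?\<omega>" "p_bounded (t *\<^sub>R \<psi>1)"
        by (intro p_bounded_add p_bounded_diff p_bounded_scaleR polar_bd \<psi>1 \<psi>2)+
      have "F ?\<xi> + ev ?\<omega> f = t *\<^sub>R (F \<psi>1 - ev \<psi>1 f) + (F \<psi>2 + ev \<psi>2 f)"
        by (simp add: blinfun.add_right blinfun.scaleR_right ev_simps algebra_simps)
      also have "\<dots> = of_real (t * d + (r + s * r0))"
        unfolding \<psi>1 \<psi>2 r' by (simp add: scaleR_conv_of_real)
      finally have eq: "F ?\<xi> + ev ?\<omega> f = of_real (t * d + (r + s * r0))" .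
      have "t * d + (r + s * r0) \<le> norm (F ?\<xi> + ev ?\<omega> f)"
        unfolding eq norm_of_real by (rule abs_ge_self)
      also have "\<dots> \<le> s * dual_norm ?\<xi> + dual_norm ?\<omega> * p f"
        using norm_triangle_ineq[of "F ?\<xi>" "ev ?\<omega> f"] Fd[OF bd(1)] dual_norm_bound[OF bd(2), of f] by linarith
      also have "\<dots> \<le> s * (dual_norm ?\<xi> + dual_norm ?\<omega>)"
        using mult_left_mono[OF pf dual_norm_nonneg[OF bd(2)]] by (simp add: algebra_simps)
      also have "\<dots> \<le> s * (2 + t\<^sup>2)"
      proof (rule mult_left_mono[OF _ s0])
        have "dual_norm (t *\<^sub>R \<psi>1) \<le> t"
        proof (rule dual_norm_le)
          show "norm (ev (t *\<^sub>R \<psi>1) f) \<le> t * p f" for f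
            using \<psi>1(1) t by (simp add: ev_simps unit_polar_def mult_left_mono)
        qed (use t in simp)
        then have "(dual_norm (t *\<^sub>R \<psi>1))\<^sup>2 \<le> t\<^sup>2" "(dual_norm \<psi>2)\<^sup>2 \<le> 1\<^sup>2"
          by (intro power_mono dual_norm_nonneg bd polar_bd \<psi>2; simp add: polar_bd \<psi>2)+
        then have "(dual_norm ?\<xi>)\<^sup>2 + (dual_norm ?\<omega>)\<^sup>2 \<le> 2 + 2 * t\<^sup>2"
          using dual_norm_parallelogram[OF polar_bd(1)[OF \<psi>2(1)] bd(3)] by simp
        moreover have "(dual_norm ?\<xi> + dual_norm ?\<omega>)\<^sup>2 \<le> 2 * ((dual_norm ?\<xi>)\<^sup>2 + (dual_norm ?\<omega>)\<^sup>2)"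
          using zero_le_power2[of "dual_norm ?\<xi> - dual_norm ?\<omega>"] by (simp add: power2_eq_square algebra_simps)
        moreover have "4 + 4 * t\<^sup>2 \<le> (2 + t\<^sup>2)\<^sup>2"
          using t by (simp add: power2_eq_square algebra_simps)
        ultimately have "(dual_norm ?\<xi> + dual_norm ?\<omega>)\<^sup>2 \<le> (2 + t\<^sup>2)\<^sup>2" by argo
        then show "dual_norm ?\<xi> + dual_norm ?\<omega> \<le> 2 + t\<^sup>2"
          by (rule power2_le_imp_le) simp
      qed
      finally have "t * d \<le> t * ((s + 1) * t)"
        using r r' by (simp add: power2_eq_square algebra_simps)
      then have "d \<le> \<epsilon>" using t by simp
      then show "norm (F \<psi> - ev \<psi> f) \<le> \<epsilon>" by (simp add: d_def)
    qed
  qed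
qed

text \<open>By Tychonoff's theorem the polar is compact for pointwise convergence on \<open>C(K)\<close>. There the
  functionals on the dual are uniform limits of evaluations, hence continuous, so the weak topology is
  not finer on the polar.\<close>

lemma compactin_unit_polar: "compactin (weak_topology ck_dual_scale) unit_polar"
proof -
  define G :: "(('a \<Rightarrow>\<^sub>C 'k) \<Rightarrow> 'k) set" where
    "G = PiE UNIV (\<lambda>f. cball 0 (p f)) \<inter>
      ({g. \<forall>f h. g (f + h) = g f + g h} \<inter> {g. \<forall>c f. g (ck_scale c f) = c * g f})"
  have "closed {g :: ('a \<Rightarrow>\<^sub>C 'k) \<Rightarrow> 'k. \<forall>f h. g (f + h) = g f + g h}"
    by (intro closed_Collect_all closed_Collect_eq continuous_intros continuous_on_product_coordinates)
  moreover have "closed {g :: ('a \<Rightarrow>\<^sub>C 'k) \<Rightarrow> 'k. \<forall>c f. g (ck_scale c f) = c * g f}"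
    by (intro closed_Collect_all closed_Collect_eq continuous_intros continuous_on_product_coordinates)
  moreover have "compact (PiE UNIV (\<lambda>f :: 'a \<Rightarrow>\<^sub>C 'k. cball (0::'k) (p f)))"
    unfolding compactin_euclidean_iff[symmetric] euclidean_product_topology[symmetric] compactin_PiE
    by (auto simp: compactin_euclidean_iff)
  ultimately have G: "compact G"
    unfolding G_def by (intro compact_Int_closed closed_Int)
  have "\<exists>\<psi>. \<forall>f. ev \<psi> f = g f" if "g \<in> G" for g
  proof (rule ck_dual_construct[of g L])
    show "norm (g f) \<le> L * norm f" for f
      using that p_le[of f] by (force simp: G_def PiE_iff intro: order_trans)
  qed (use that in \<open>auto simp: G_def\<close>)
  then obtain \<Phi> where \<Phi>: "\<And>g f. g \<in> G \<Longrightarrow> ev (\<Phi> g) f = g f" by metis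
  have \<Phi>_polar: "\<Phi> g \<in> unit_polar" if "g \<in> G" for g
    using that \<Phi>[OF that] by (auto simp: unit_polar_def G_def PiE_iff)
  have "\<psi> \<in> \<Phi> ` G" if "\<psi> \<in> unit_polar" for \<psi>
  proof
    show in_G: "ev \<psi> \<in> G" using that by (auto simp: G_def unit_polar_def PiE_iff ev_simps)
    show "\<psi> = \<Phi> (ev \<psi>)" by (rule ck_dual_eqI) (simp add: \<Phi>[OF in_G])
  qed
  then have img: "\<Phi> ` G = unit_polar" using \<Phi>_polar by blast
  have cont: "continuous_on G (\<lambda>g. blinfun_apply F (\<Phi> g))" if F: "F \<in> functionals ck_dual_scale" for F
  proof -
    have "\<exists>f. \<forall>\<psi>\<in>unit_polar. norm (blinfun_apply F \<psi> - ev \<psi> f) \<le> inverse (real (Suc n))" for n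
      by (rule polar_approx_evaluation[OF F, of "inverse (real (Suc n))"]) auto
    then obtain f where f: "\<And>n \<psi>. \<psi> \<in> unit_polar \<Longrightarrow> norm (blinfun_apply F \<psi> - ev \<psi> (f n)) \<le> inverse (real (Suc n))"
      by metis
    have "uniform_limit G (\<lambda>n g. g (f n)) (\<lambda>g. blinfun_apply F (\<Phi> g)) sequentially"
    proof (rule uniform_limitI)
      fix e :: real assume "e > 0"
      then obtain N where N: "inverse (real (Suc N)) < e" using reals_Archimedean by blast
      show "\<forall>\<^sub>F n in sequentially. \<forall>g\<in>G. dist (g (f n)) (blinfun_apply F (\<Phi> g)) < e"
      proof (rule eventually_sequentiallyI[of N], intro ballI)
        fix n g assume n: "N \<le> n" and g: "g \<in> G"
        have "dist (g (f n)) (blinfun_apply F (\<Phi> g)) \<le> inverse (real (Suc n))"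
          using f[OF \<Phi>_polar[OF g], of n] by (simp add: \<Phi>[OF g] dist_norm norm_minus_commute)
        also have "\<dots> \<le> inverse (real (Suc N))" using n by (simp add: field_simps)
        finally show "dist (g (f n)) (blinfun_apply F (\<Phi> g)) < e" using N by simp
      qed
    qed
    then show ?thesis
      by (rule uniform_limit_theorem[rotated])
        (auto intro!: always_eventually continuous_on_subset[OF continuous_on_product_coordinates])
  qed
  have "continuous_map (top_of_set G) (weak_topology ck_dual_scale) \<Phi>"
    unfolding weak_topology_def
  proof (rule continuous_on_generated_topo)
    fix V :: "('a, 'k) ck_dual set"
    assume "V \<in> {blinfun_apply F -` U |F U. F \<in> functionals ck_dual_scale \<and> open U}"
    then obtain F :: "('a, 'k) ck_dual \<Rightarrow>\<^sub>L 'k" and U where V: "V = blinfun_apply F -` U" "F \<in> functionals ck_dual_scale" "open U"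
      by blast
    have "openin (top_of_set G) (G \<inter> (\<lambda>g. blinfun_apply F (\<Phi> g)) -` U)"
      by (rule continuous_openin_preimage_gen[OF cont[OF V(2)] V(3)])
    then show "openin (top_of_set G) (\<Phi> -` V \<inter> topspace (top_of_set G))"
      unfolding V by (simp add: vimage_def Int_commute Int_def conj_commute)
  next
    show "\<Phi> ` topspace (top_of_set G)
        \<subseteq> \<Union> {blinfun_apply F -` U | (F :: ('a, 'k) ck_dual \<Rightarrow>\<^sub>L 'k) U. F \<in> functionals ck_dual_scale \<and> open U}"
      unfolding topology_generated_by_topspace[symmetric] weak_topology_def[symmetric] by simp
  qed
  moreover have "compactin (top_of_set G) G"
    using G by (simp add: compactin_subtopology)
  ultimately show ?thesis using image_compactin img by metis
qed

lemma closedin_unit_polar: "closedin (weak_topology ck_dual_scale) unit_polar"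
proof -
  have "closedin (weak_topology ck_dual_scale) {\<psi>. norm (ev \<psi> f) \<le> p f}" for f
  proof -
    obtain F :: "('a, 'k) ck_dual \<Rightarrow>\<^sub>L 'k" where F: "F \<in> functionals ck_dual_scale" "\<And>\<phi>. blinfun_apply F \<phi> = ev \<phi> f"
      using point_functional[of f] by blast
    have "openin (weak_topology ck_dual_scale) (blinfun_apply F -` (- cball 0 (p f)))"
      unfolding weak_topology_def by (rule topology_generated_by_Basis) (use F(1) in blast)
    moreover have "UNIV - {\<psi>. norm (ev \<psi> f) \<le> p f} = blinfun_apply F -` (- cball 0 (p f))"
      using F(2) by auto
    ultimately show ?thesis by (simp add: closedin_def)
  qed
  then have "closedin (weak_topology ck_dual_scale) (\<Inter>f. {\<psi>. norm (ev \<psi> f) \<le> p f})"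
    by (intro closedin_Inter) auto
  moreover have "(\<Inter>f. {\<psi>. norm (ev \<psi> f) \<le> p f}) = unit_polar" by (auto simp: unit_polar_def)
  ultimately show ?thesis by simp
qed

lemma dominated_weakly_compact:
  assumes W: "W \<in> operators ck_dual_scale"
    and dom: "\<And>\<phi> f. norm (ev (blinfun_apply W \<phi>) f) \<le> norm \<phi> * p f"
  shows "W \<in> weakly_compact_operators ck_dual_scale"
proof -
  have "blinfun_apply W ` cball 0 1 \<subseteq> unit_polar"
  proof (clarsimp simp: unit_polar_def)
    fix \<phi> :: "('a, 'k) ck_dual" and f assume "norm \<phi> \<le> 1"
    then have "norm \<phi> * p f \<le> p f" using p_nonneg[of f] by (simp add: mult_left_le_one_le)
    then show "norm (ev (blinfun_apply W \<phi>) f) \<le> p f" using dom[of \<phi> f] by linarith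
  qed
  then have "weak_topology ck_dual_scale closure_of (blinfun_apply W ` cball 0 1) \<subseteq> unit_polar"
    by (rule closure_of_minimal[OF _ closedin_unit_polar])
  then have "compactin (weak_topology ck_dual_scale) (weak_topology ck_dual_scale closure_of (blinfun_apply W ` cball 0 1))"
    by (rule closed_compactin[OF compactin_unit_polar _ closedin_closure_of])
  with W show ?thesis by (simp add: weakly_compact_operators_def)
qed

end

section \<open>Bounding the dual weak essential norm from above\<close>

text \<open>Partitions of unity subordinate to the cover of \<open>K\<close> by sets on which the functions of \<open>A\<close> differ
  by less than \<open>e\<close> from their values at a point. They are built from the functions of \<open>A\<close> themselves: the bump at \<open>y\<close> is the product of the
  functions \<open>max 0 (e - \<bar>f - f y\<bar>)\<close>.\<close>

lemma adapted_partition_of_unity: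
  fixes A :: "('a::topological_space \<Rightarrow>\<^sub>C 'k::real_normed_vector) set"
  assumes K: "compact (UNIV :: 'a set)" and A: "finite A" and e: "e > 0"
  obtains Y :: "'a set" and w :: "'a \<Rightarrow> 'a \<Rightarrow> real"
  where "finite Y" "\<And>y. continuous_on UNIV (w y)" "\<And>y z. 0 \<le> w y z"
    "\<And>z. (\<Sum>y\<in>Y. w y z) = 1"
    "\<And>f y z. f \<in> A \<Longrightarrow> w y z \<noteq> 0 \<Longrightarrow> norm (apply_bcontfun f z - apply_bcontfun f y) < e"
proof -
  define b where "b y z = (\<Prod>f\<in>A. max 0 (e - norm (apply_bcontfun f z - apply_bcontfun f y)))" for y z
  have b_cont: "continuous_on UNIV (b y)" for y
    unfolding b_def by (intro continuous_intros continuous_on_apply_bcontfun)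
  have b_nonneg: "0 \<le> b y z" for y z
    unfolding b_def by (intro prod_nonneg) auto
  have b_nz: "norm (apply_bcontfun f z - apply_bcontfun f y) < e" if "f \<in> A" "b y z \<noteq> 0" for f y z
    using that A by (auto simp: b_def max_def split: if_splits)
  have b_self: "b y y > 0" for y
    unfolding b_def using e by (intro prod_pos) auto
  have op: "open {z. 0 < b y z}" for y
    by (intro open_Collect_less continuous_intros b_cont)
  obtain Y where Y: "finite Y" "UNIV \<subseteq> (\<Union>y\<in>Y. {z. 0 < b y z})"
  proof (rule compactE_image[OF K, of UNIV "\<lambda>y. {z. 0 < b y z}"])
    show "UNIV \<subseteq> (\<Union>y\<in>UNIV. {z. 0 < b y z})" using b_self by auto
  qed (use op in auto)
  have s_pos: "0 < (\<Sum>y\<in>Y. b y z)" for z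
  proof -
    obtain y where "y \<in> Y" "0 < b y z" using Y(2) by blast
    then show ?thesis using Y(1) b_nonneg by (intro sum_pos2[of Y y]) auto
  qed
  show ?thesis
  proof (rule that[of Y "\<lambda>y z. b y z / (\<Sum>y\<in>Y. b y z)"])
    show "continuous_on UNIV (\<lambda>z. b y z / (\<Sum>y\<in>Y. b y z))" for y
      using s_pos by (intro continuous_intros b_cont) (auto simp: less_imp_neq[symmetric])
    show "0 \<le> b y z / (\<Sum>y\<in>Y. b y z)" for y z
      using s_pos[of z] b_nonneg[of y z] by (simp add: divide_nonneg_pos)
    show "(\<Sum>y\<in>Y. b y z / (\<Sum>y\<in>Y. b y z)) = 1" for z
      using s_pos[of z] by (simp add: sum_divide_distrib[symmetric])
  qed (use b_nz Y in auto)
qed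

context
  fixes Y :: "'a::topological_space set" and w :: "'a \<Rightarrow> 'a \<Rightarrow> real"
  assumes w: "\<And>y. continuous_on UNIV (w y)" "\<And>y z. 0 \<le> w y z" "\<And>z. (\<Sum>y\<in>Y. w y z) = 1"
begin

text \<open>The operators \<open>v \<mapsto> \<Sum>y\<in>Y. v y w\<^sub>y\<close> send bounded functions on \<open>K\<close>, continuous or not, to \<open>C(K)\<close> without
  increasing the norm. Along finer and finer partitions they converge to the identity on \<open>C(K)\<close>.\<close>

definition interpolate :: "('a \<Rightarrow> 'k::real_normed_field) \<Rightarrow> ('a \<Rightarrow>\<^sub>C 'k)" where
  "interpolate v = Bcontfun (\<lambda>z. \<Sum>y\<in>Y. of_real (w y z) * v y)"

lemma interpolate_bound:
  fixes v :: "'a \<Rightarrow> 'k::real_normed_field"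
  assumes "\<And>y. y \<in> Y \<Longrightarrow> w y z \<noteq> 0 \<Longrightarrow> norm (v y) \<le> B"
  shows "norm (\<Sum>y\<in>Y. of_real (w y z) * v y) \<le> B"
proof -
  have "norm (\<Sum>y\<in>Y. of_real (w y z) * v y) \<le> (\<Sum>y\<in>Y. w y z * B)"
  proof (rule sum_norm_le)
    fix y assume "y \<in> Y"
    then show "norm (of_real (w y z) * v y) \<le> w y z * B"
      using assms[of y] w(2)[of y z] by (cases "w y z = 0") (auto simp: norm_mult mult_left_mono)
  qed
  also have "\<dots> = B" by (simp add: sum_distrib_right[symmetric] w(3))
  finally show ?thesis .
qed

lemma interpolate_apply:
  fixes v :: "'a \<Rightarrow> 'k::real_normed_field"
  shows "apply_bcontfun (interpolate v) z = (\<Sum>y\<in>Y. of_real (w y z) * v y)"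
proof -
  have fin: "finite Y" using w(3) by (metis sum.infinite zero_neq_one)
  have "(\<lambda>z. \<Sum>y\<in>Y. of_real (w y z) * v y) \<in> bcontfun"
  proof (rule bcontfun_normI)
    show "continuous_on UNIV (\<lambda>z. \<Sum>y\<in>Y. of_real (w y z) * v y)" by (intro continuous_intros w)
    show "norm (\<Sum>y\<in>Y. of_real (w y z) * v y) \<le> Max (insert 0 ((norm \<circ> v) ` Y))" for z
      by (rule interpolate_bound) (use fin in auto)
  qed
  then show ?thesis by (simp add: interpolate_def Bcontfun_inverse)
qed

end

lemma dual_weak_essential_norm_le:
  assumes T: "T \<in> operators ck_scale" and W: "W \<in> weakly_compact_operators ck_dual_scale"
    and le: "\<And>\<phi> f. norm (ev \<phi> (T f) - ev (blinfun_apply W \<phi>) f) \<le> norm \<phi> * (c * norm f)"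
    and c: "0 \<le> c"
  shows "dual_weak_essential_norm T \<le> c"
proof -
  have "dual_weak_essential_norm T \<le> dist (adjoint_op T) W"
    unfolding dual_weak_essential_norm_def weak_essential_norm_def by (rule infdist_le[OF W])
  also have "\<dots> \<le> c"
    unfolding dist_norm
  proof (rule norm_blinfun_bound[OF c])
    fix \<phi>
    show "norm (blinfun_apply (adjoint_op T - W) \<phi>) \<le> c * norm \<phi>"
      by (rule norm_ck_dual_le)
        (use le[of \<phi>] c in \<open>auto simp: blinfun.diff_left ev_simps ev_adjoint_op[OF T] ac_simps\<close>)
  qed
  finally show ?thesis .
qed

text \<open>For each point \<open>x\<close> the hypothesis splits \<open>f \<mapsto> (T f) x\<close> into \<open>\<psi>\<^sub>x\<close>, bounded by \<open>p\<close>, and a rest of norm at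
  most \<open>c\<close>. The operator \<open>W\<close> should be \<open>(W \<phi>) f = \<phi> (x \<mapsto> \<psi>\<^sub>x f)\<close>, but \<open>x \<mapsto> \<psi>\<^sub>x f\<close> need not be continuous. So
  it is replaced by its interpolations, and \<open>W\<close> is a cluster point of the resulting bilinear forms in
  a product of discs. Bilinearity and the bound by \<open>p\<close> hold for every approximant; the bound on the
  distance to \<open>T\<^sup>*\<close> at \<open>f\<close> holds as soon as the partition is fine enough for \<open>T f\<close>.\<close>

lemma (in hilbertian_seminorm) dual_weak_essential_norm_le_of_domination:
  fixes T :: "('a \<Rightarrow>\<^sub>C 'k) \<Rightarrow>\<^sub>L ('a \<Rightarrow>\<^sub>C 'k)"
  assumes K: "compact (UNIV :: 'a set)" and T: "T \<in> operators ck_scale" and c: "0 \<le> c"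
    and dom: "\<And>x f. norm (apply_bcontfun (T f) x) \<le> c * norm f + p f"
  shows "dual_weak_essential_norm T \<le> c"
proof -
  have c_norm: "ck_seminorm (\<lambda>f :: 'a \<Rightarrow>\<^sub>C 'k. c * norm f)"
    using c by (auto simp: ck_seminorm_def norm_ck_scale ring_distribs[symmetric] intro!: mult_left_mono norm_triangle_ineq)
  have "\<exists>\<psi>. \<psi> \<in> functionals ck_scale \<and> (\<forall>f. norm (blinfun_apply \<psi> f) \<le> p f) \<and>
      (\<forall>f. norm (apply_bcontfun (T f) x - blinfun_apply \<psi> f) \<le> c * norm f)" for x
  proof -
    define \<mu> where "\<mu> = ck_functional (blinfun_apply (adjoint_op T) (point_mass x) :: ('a, 'k) ck_dual)"
    have \<mu>: "\<mu> \<in> functionals ck_scale" "\<And>f. blinfun_apply \<mu> f = apply_bcontfun (T f) x"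
      unfolding \<mu>_def by (rule ck_functional) (simp add: ev_adjoint_op[OF T] ev_point_mass)
    have "norm (blinfun_apply \<mu> f) \<le> p f + c * norm f" for f
      using dom[of f x] by (simp add: \<mu>(2))
    from functional_decomposition[OF \<mu>(1) seminorm c_norm p_le this] show ?thesis
      unfolding \<mu>(2) by metis
  qed
  then obtain \<psi> where \<psi>: "\<And>x. \<psi> x \<in> functionals ck_scale" "\<And>x f. norm (blinfun_apply (\<psi> x) f) \<le> p f"
    "\<And>x f. norm (apply_bcontfun (T f) x - blinfun_apply (\<psi> x) f) \<le> c * norm f"
    by metis
  define S :: "(('a, 'k) ck_dual \<times> ('a \<Rightarrow>\<^sub>C 'k) \<Rightarrow> 'k) set" where
    "S = PiE UNIV (\<lambda>(\<phi>, f). cball 0 (norm \<phi> * p f)) \<inter>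
      ({B. \<forall>\<phi> \<psi> f. B (\<phi> + \<psi>, f) = B (\<phi>, f) + B (\<psi>, f)} \<inter> {B. \<forall>\<phi> f g. B (\<phi>, f + g) = B (\<phi>, f) + B (\<phi>, g)} \<inter>
       ({B. \<forall>d \<phi> f. B (ck_dual_scale d \<phi>, f) = d * B (\<phi>, f)} \<inter> {B. \<forall>d \<phi> f. B (\<phi>, ck_scale d f) = d * B (\<phi>, f)}))"
  have S: "compact S"
    unfolding S_def
  proof (rule compact_Int_closed)
    show "compact (PiE UNIV (\<lambda>(\<phi> :: ('a, 'k) ck_dual, f :: 'a \<Rightarrow>\<^sub>C 'k). cball (0::'k) (norm \<phi> * p f)))"
      unfolding compactin_euclidean_iff[symmetric] euclidean_product_topology[symmetric] compactin_PiE
      by (auto simp: compactin_euclidean_iff)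
  qed (intro closed_Int closed_Collect_all closed_Collect_eq continuous_intros continuous_on_product_coordinates)
  define N where "N i = {B. \<forall>\<phi>. norm (ev \<phi> (T (fst i)) - B (\<phi>, fst i)) \<le> norm \<phi> * (c * norm (fst i) + snd i)}"
    for i :: "('a \<Rightarrow>\<^sub>C 'k) \<times> real"
  have "S \<inter> (\<Inter>i\<in>UNIV \<times> {0<..}. N i) \<noteq> {}"
  proof (rule compact_imp_fip_image[OF S])
    show "closed (N i)" for i
      unfolding N_def
      by (intro closed_Collect_all closed_Collect_le continuous_intros continuous_on_product_coordinates)
    fix I assume I: "finite I" "I \<subseteq> (UNIV :: ('a \<Rightarrow>\<^sub>C 'k) set) \<times> {0::real<..}"
    \<comment> \<open>Finitely many conditions: one partition of unity that is fine enough for all of them.\<close>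
    define e where "e = Min (insert 1 (snd ` I))"
    have e: "e > 0" "\<And>i. i \<in> I \<Longrightarrow> e \<le> snd i"
      using I by (auto simp: e_def)
    obtain Y and w :: "'a \<Rightarrow> 'a \<Rightarrow> real" where Y: "finite Y" and w: "\<And>y. continuous_on UNIV (w y)" "\<And>y z. 0 \<le> w y z"
      "\<And>z. (\<Sum>y\<in>Y. w y z) = 1"
      and near: "\<And>f y z. f \<in> (\<lambda>i. T (fst i)) ` I \<Longrightarrow> w y z \<noteq> 0 \<Longrightarrow> norm (apply_bcontfun f z - apply_bcontfun f y) < e"
      by (rule adapted_partition_of_unity[OF K _ e(1), of "(\<lambda>i. T (fst i)) ` I"]) (use I in auto)
    let ?R = "interpolate Y w"
    note R = interpolate_apply[of w Y, OF w] and R_bound = interpolate_bound[of w Y, OF w]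
    define B where "B = (\<lambda>(\<phi>, f). ev \<phi> (?R (\<lambda>y. blinfun_apply (\<psi> y) f)))"
    have R_add: "?R (\<lambda>y. u y + v y) = ?R u + ?R v" for u v :: "'a \<Rightarrow> 'k"
      by (rule bcontfun_eqI) (simp add: R ring_distribs sum.distrib)
    have R_scale: "?R (\<lambda>y. d * v y) = ck_scale d (?R v)" for d and v :: "'a \<Rightarrow> 'k"
      by (rule bcontfun_eqI) (simp add: R sum_distrib_left ac_simps)
    have "norm (?R (\<lambda>y. blinfun_apply (\<psi> y) f)) \<le> p f" for f
      by (rule norm_bound) (simp only: R, rule R_bound, rule \<psi>(2))
    then have "norm (ev \<phi> (?R (\<lambda>y. blinfun_apply (\<psi> y) f))) \<le> norm \<phi> * p f" for \<phi> f
      using norm_ev_le[of \<phi> "?R (\<lambda>y. blinfun_apply (\<psi> y) f)"] by (meson mult_left_mono norm_ge_zero order_trans)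
    moreover have "blinfun_apply (\<psi> y) (ck_scale d f) = d * blinfun_apply (\<psi> y) f" for y d f
      using \<psi>(1)[of y] by (simp add: klinear_maps_def)
    ultimately have "B \<in> S"
      unfolding S_def B_def
      by (intro IntI CollectI allI) (simp_all add: PiE_iff ev_simps blinfun.add_right R_add R_scale)
    moreover have "B \<in> N i" if i: "i \<in> I" for i
    proof -
      obtain f r where ifr: "i = (f, r)" by (cases i)
      have "norm (T f - ?R (\<lambda>y. blinfun_apply (\<psi> y) f)) \<le> c * norm f + e"
      proof (rule norm_bound)
        fix z
        have "T f z - ?R (\<lambda>y. blinfun_apply (\<psi> y) f) z
            = (\<Sum>y\<in>Y. of_real (w y z) * (T f z - blinfun_apply (\<psi> y) f))"
        proof -
          have "(\<Sum>y\<in>Y. of_real (w y z) * T f z) = of_real (\<Sum>y\<in>Y. w y z) * T f z"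
            by (simp add: sum_distrib_right)
          then show ?thesis by (simp add: R right_diff_distrib sum_subtractf w)
        qed
        also have "norm \<dots> \<le> c * norm f + e"
        proof (rule R_bound)
          fix y assume "w y z \<noteq> 0"
          then have "norm (T f z - T f y) < e"
            using near[of "T f" y z] i ifr by force
          then show "norm (T f z - blinfun_apply (\<psi> y) f) \<le> c * norm f + e"
            using norm_triangle_ineq[of "T f z - T f y" "T f y - blinfun_apply (\<psi> y) f"] \<psi>(3)[of f y]
            by simp
        qed
        finally show "norm (apply_bcontfun (T f - ?R (\<lambda>y. blinfun_apply (\<psi> y) f)) z) \<le> c * norm f + e"
          by simp
      qed
      then have "norm (T f - ?R (\<lambda>y. blinfun_apply (\<psi> y) f)) \<le> c * norm f + r"
        using e(2)[OF i] ifr by simp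
      then have "norm (ev \<phi> (T f) - B (\<phi>, f)) \<le> norm \<phi> * (c * norm f + r)" for \<phi>
        using norm_ev_le[of \<phi> "T f - ?R (\<lambda>y. blinfun_apply (\<psi> y) f)"]
        by (simp add: B_def ev_simps) (meson mult_left_mono norm_ge_zero order_trans)
      then show ?thesis by (simp add: N_def ifr)
    qed
    ultimately show "S \<inter> (\<Inter>i\<in>I. N i) \<noteq> {}" by blast
  qed
  then obtain B where BS: "B \<in> S" and BN': "\<And>f r. 0 < r \<Longrightarrow> B \<in> N (f, r)" by auto
  have BN: "norm (ev \<phi> (T f) - B (\<phi>, f)) \<le> norm \<phi> * (c * norm f + r)" if "0 < r" for \<phi> f r
    using BN'[OF that, of f] by (simp add: N_def)
  have B_le: "norm (B (\<phi>, f)) \<le> norm \<phi> * p f" for \<phi> f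
    using BS by (auto simp: S_def PiE_iff split: prod.splits)
  have B_le': "norm (B (\<phi>, f)) \<le> L * norm \<phi> * norm f" for \<phi> f
    using B_le[of \<phi> f] mult_left_mono[OF p_le[of f] norm_ge_zero[of \<phi>]] by (simp add: ac_simps)
  have B_lin: "B (\<phi> + \<psi>, f) = B (\<phi>, f) + B (\<psi>, f)" "B (\<phi>, f + g) = B (\<phi>, f) + B (\<phi>, g)"
    "B (ck_dual_scale d \<phi>, f) = d * B (\<phi>, f)" "B (\<phi>, ck_scale d f) = d * B (\<phi>, f)" for \<phi> \<psi> f g d
    using BS unfolding S_def by blast+
  obtain W where W: "W \<in> operators ck_dual_scale" "\<And>\<phi> f. ev (blinfun_apply W \<phi>) f = B (\<phi>, f)"
    by (rule dual_operator_construct[of "\<lambda>\<phi> f. B (\<phi>, f)" L]) (rule B_lin B_le' | blast)+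
  have "W \<in> weakly_compact_operators ck_dual_scale"
    by (rule dominated_weakly_compact[OF W(1)]) (simp add: W(2) B_le)
  then show ?thesis
  proof (rule dual_weak_essential_norm_le[OF T _ _ c])
    fix \<phi> f
    show "norm (ev \<phi> (T f) - ev (blinfun_apply W \<phi>) f) \<le> norm \<phi> * (c * norm f)"
    proof (rule field_le_epsilon)
      fix r :: real assume "r > 0"
      define k where "k = norm \<phi>"
      have k: "k \<ge> 0" by (simp add: k_def)
      have "k * (r / (k + 1)) \<le> r" using k \<open>r > 0\<close> by (simp add: pos_divide_le_eq algebra_simps)
      moreover have "norm (ev \<phi> (T f) - B (\<phi>, f)) \<le> k * (c * norm f + r / (k + 1))"
        unfolding k_def by (rule BN) (use k \<open>r > 0\<close> in \<open>simp add: k_def add_nonneg_pos\<close>)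
      ultimately show "norm (ev \<phi> (T f) - ev (blinfun_apply W \<phi>) f) \<le> norm \<phi> * (c * norm f) + r"
        unfolding W(2) k_def[symmetric] distrib_left by linarith
    qed
  qed
qed

section \<open>The total variation of a functional\<close>

text \<open>For \<open>h \<ge> 0\<close> continuous this is \<open>\<bar>\<phi>\<bar> h\<close>, where \<open>\<bar>\<phi>\<bar>\<close> is the total variation of the measure that
  represents \<open>\<phi>\<close>.\<close>

definition variation :: "('a::topological_space, 'k::real_normed_field) ck_dual \<Rightarrow> ('a \<Rightarrow> real) \<Rightarrow> real" where
  "variation \<phi> h = (SUP g\<in>{g. \<forall>x. norm (apply_bcontfun g x) \<le> h x}. norm (ev \<phi> g))"

lemma variation_bdd:
  fixes \<phi> :: "('a::topological_space, 'k::real_normed_field) ck_dual"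
  assumes "\<And>x. h x \<le> B"
  shows "bdd_above ((\<lambda>g. norm (ev \<phi> g)) ` {g. \<forall>x. norm (apply_bcontfun g x) \<le> h x})"
proof (rule bdd_aboveI2)
  fix g :: "'a \<Rightarrow>\<^sub>C 'k" assume "g \<in> {g. \<forall>x. norm (apply_bcontfun g x) \<le> h x}"
  then have "norm g \<le> B" using assms by (intro norm_bound) (auto intro: order_trans)
  then show "norm (ev \<phi> g) \<le> norm \<phi> * B"
    using norm_ev_le[of \<phi> g] by (meson mult_left_mono norm_ge_zero order_trans)
qed

lemma variation_upper:
  assumes "\<And>x. h x \<le> B" "\<And>x. norm (apply_bcontfun g x) \<le> h x"
  shows "norm (ev \<phi> g) \<le> variation \<phi> h"
  unfolding variation_def by (rule cSUP_upper[OF _ variation_bdd[OF assms(1)]]) (use assms(2) in auto)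

lemma variation_least:
  assumes "\<And>x. 0 \<le> h x" "\<And>g. (\<And>x. norm (apply_bcontfun g x) \<le> h x) \<Longrightarrow> norm (ev \<phi> g) \<le> c"
  shows "variation \<phi> h \<le> c"
  unfolding variation_def by (rule cSUP_least) (use assms in \<open>auto intro: exI[of _ 0]\<close>)

lemma variation_nonneg: "(\<And>x. 0 \<le> h x) \<Longrightarrow> (\<And>x. h x \<le> B) \<Longrightarrow> 0 \<le> variation \<phi> h"
  using variation_upper[of h B 0 \<phi>] by (simp add: ev_simps)

lemma variation_mono:
  "(\<And>x. 0 \<le> h x) \<Longrightarrow> (\<And>x. h x \<le> h' x) \<Longrightarrow> (\<And>x. h' x \<le> B) \<Longrightarrow> variation \<phi> h \<le> variation \<phi> h'"
  by (rule variation_least, simp) (rule variation_upper, blast, meson order_trans)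

lemma variation_le:
  fixes \<phi> :: "('a::topological_space, 'k::real_normed_field) ck_dual"
  assumes "\<And>x. 0 \<le> h x" "\<And>x. h x \<le> B"
  shows "variation \<phi> h \<le> norm \<phi> * B"
proof (rule variation_least[OF assms(1)])
  fix g :: "'a \<Rightarrow>\<^sub>C 'k" assume "\<And>x. norm (apply_bcontfun g x) \<le> h x"
  then have "norm g \<le> B" using assms(2) by (intro norm_bound) (auto intro: order_trans)
  then show "norm (ev \<phi> g) \<le> norm \<phi> * B"
    using norm_ev_le[of \<phi> g] by (meson mult_left_mono norm_ge_zero order_trans)
qed

lemma variation_scale:
  fixes \<phi> :: "('a::topological_space, 'k::real_normed_field) ck_dual"
  assumes h: "\<And>x. 0 \<le> h x" "\<And>x. h x \<le> B" and c: "0 \<le> c"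
  shows "variation \<phi> (\<lambda>x. c * h x) = c * variation \<phi> h"
proof -
  have le: "variation \<phi> (\<lambda>x. c * h x) \<le> c * variation \<phi> h"
    if h: "\<And>x. 0 \<le> h x" "\<And>x. h x \<le> B" and c: "0 < c" for c h B
  proof (rule variation_least)
    fix g :: "'a \<Rightarrow>\<^sub>C 'k" assume g: "\<And>x. norm (apply_bcontfun g x) \<le> c * h x"
    have "norm (ev \<phi> (inverse c *\<^sub>R g)) \<le> variation \<phi> h"
      by (rule variation_upper[OF h(2)]) (use g c in \<open>simp add: field_simps\<close>)
    then show "norm (ev \<phi> g) \<le> c * variation \<phi> h" using c by (simp add: ev_simps field_simps)
  qed (use h c in simp)
  show ?thesis
  proof (cases "c = 0")
    case True
    have "variation \<phi> (\<lambda>x. 0) \<le> 0" by (rule order_trans[OF variation_le[of _ 0]]) auto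
    then show ?thesis using True variation_nonneg[of "\<lambda>x. 0" 0 \<phi>] by simp
  next
    case False
    with c have c: "c > 0" by simp
    have "variation \<phi> (\<lambda>x. inverse c * (c * h x)) \<le> inverse c * variation \<phi> (\<lambda>x. c * h x)"
      by (rule le[of _ "c * B"]) (use h c in auto)
    then have "c * variation \<phi> h \<le> variation \<phi> (\<lambda>x. c * h x)" using c by (simp add: field_simps)
    with le[OF h c] show ?thesis by (simp add: antisym)
  qed
qed

definition pointwise_scale :: "('a \<Rightarrow> real) \<Rightarrow> ('a::topological_space \<Rightarrow>\<^sub>C 'k::real_normed_vector) \<Rightarrow> ('a \<Rightarrow>\<^sub>C 'k)" where
  "pointwise_scale u f = Bcontfun (\<lambda>x. u x *\<^sub>R apply_bcontfun f x)"

lemma pointwise_scale_apply: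
  assumes "continuous_on UNIV u" "\<And>x. 0 \<le> u x" "\<And>x. u x \<le> 1"
  shows "apply_bcontfun (pointwise_scale u f) x = u x *\<^sub>R apply_bcontfun f x"
proof -
  have "norm (u x *\<^sub>R apply_bcontfun f x) \<le> norm f" for x
    using mult_mono[OF assms(3)[of x] norm_bounded[of f x]] assms(2)[of x] by simp
  then have "(\<lambda>x. u x *\<^sub>R apply_bcontfun f x) \<in> bcontfun"
    by (intro bcontfun_normI continuous_intros assms continuous_on_apply_bcontfun)
  then show ?thesis by (simp add: pointwise_scale_def Bcontfun_inverse)
qed

text \<open>The inequality \<open>\<le>\<close> splits a function \<open>g\<close> with \<open>\<bar>g\<bar> \<le> h + k\<close> in the ratio of \<open>h\<close> to \<open>k\<close>; the summand \<open>d > 0\<close> in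
  the denominator keeps the quotients continuous at the zeros of \<open>h + k\<close> and costs at most \<open>d\<close> in norm. For
  \<open>\<ge>\<close>, rotate two functions so that the values of \<open>\<phi>\<close> add up.\<close>

lemma variation_add:
  fixes \<phi> :: "('a::topological_space, 'k::real_normed_field) ck_dual"
  assumes h: "continuous_on UNIV h" "\<And>x. 0 \<le> h x" "\<And>x. h x \<le> B"
    and k: "continuous_on UNIV k" "\<And>x. 0 \<le> k x" "\<And>x. k x \<le> C"
  shows "variation \<phi> (\<lambda>x. h x + k x) = variation \<phi> h + variation \<phi> k"
proof (rule antisym)
  have hk: "h x + k x \<le> B + C" for x using h(3)[of x] k(3)[of x] by simp
  show "variation \<phi> (\<lambda>x. h x + k x) \<le> variation \<phi> h + variation \<phi> k"
  proof (rule variation_least)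
    fix g :: "'a \<Rightarrow>\<^sub>C 'k" assume g: "\<And>x. norm (apply_bcontfun g x) \<le> h x + k x"
    show "norm (ev \<phi> g) \<le> variation \<phi> h + variation \<phi> k"
    proof (rule field_le_epsilon)
      fix e :: real assume "e > 0"
      \<comment> \<open>The summand \<open>1\<close> in the denominators here and below only avoids division by zero.\<close>
      define d where "d = e / (norm \<phi> + 1)"
      have d: "d > 0" using \<open>e > 0\<close> by (simp add: d_def add_nonneg_pos)
      have s: "h x + k x + d > 0" for x using h(2)[of x] k(2)[of x] d by simp
      have s': "h x + k x + d \<noteq> 0" for x using s[of x] by linarith
      define u v where "u x = h x / (h x + k x + d)" and "v x = k x / (h x + k x + d)" for x
      have cont: "continuous_on UNIV u" "continuous_on UNIV v"
        unfolding u_def v_def by (intro continuous_intros h k; use s' in auto)+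
      have u: "0 \<le> u x" "u x \<le> 1" and v: "0 \<le> v x" "v x \<le> 1" for x
        using h(2)[of x] k(2)[of x] d s[of x] by (auto simp: u_def v_def pos_divide_le_eq)
      note ap = pointwise_scale_apply[of u, OF cont(1) u] pointwise_scale_apply[of v, OF cont(2) v]
      have "norm (apply_bcontfun (pointwise_scale u g) x) \<le> h x" for x
      proof -
        have "h x * norm (apply_bcontfun g x) \<le> h x * (h x + k x + d)"
          using g[of x] h(2)[of x] d by (intro mult_left_mono) auto
        then show ?thesis unfolding ap using u[of x] s[of x]
          by (simp add: u_def pos_divide_le_eq h(2))
      qed
      then have 1: "norm (ev \<phi> (pointwise_scale u g)) \<le> variation \<phi> h" by (rule variation_upper[OF h(3)])
      have "norm (apply_bcontfun (pointwise_scale v g) x) \<le> k x" for x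
      proof -
        have "k x * norm (apply_bcontfun g x) \<le> k x * (h x + k x + d)"
          using g[of x] k(2)[of x] d by (intro mult_left_mono) auto
        then show ?thesis unfolding ap using v[of x] s[of x]
          by (simp add: v_def pos_divide_le_eq k(2))
      qed
      then have 2: "norm (ev \<phi> (pointwise_scale v g)) \<le> variation \<phi> k" by (rule variation_upper[OF k(3)])
      have "norm (g - pointwise_scale u g - pointwise_scale v g) \<le> d"
      proof (rule norm_bound)
        fix x
        have "u x + v x + d / (h x + k x + d) = 1"
          using s'[of x] by (simp add: u_def v_def add_divide_distrib[symmetric])
        then have "d / (h x + k x + d) = 1 - u x - v x" by simp
        then have "apply_bcontfun (g - pointwise_scale u g - pointwise_scale v g) x = (d / (h x + k x + d)) *\<^sub>R apply_bcontfun g x"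
          by (simp add: ap scaleR_left_diff_distrib)
        moreover have "d * norm (apply_bcontfun g x) \<le> d * (h x + k x + d)"
          using g[of x] d by (intro mult_left_mono) auto
        ultimately show "norm (apply_bcontfun (g - pointwise_scale u g - pointwise_scale v g) x) \<le> d"
          using s[of x] d by (simp add: pos_divide_le_eq)
      qed
      then have "norm (ev \<phi> (g - pointwise_scale u g - pointwise_scale v g)) \<le> norm \<phi> * d"
        using norm_ev_le[of \<phi> "g - pointwise_scale u g - pointwise_scale v g"] by (meson mult_left_mono norm_ge_zero order_trans)
      also have "norm \<phi> * d \<le> (norm \<phi> + 1) * d" using d by simp
      also have "\<dots> = e"
      proof -
        have "norm \<phi> + 1 \<noteq> 0" using norm_ge_zero[of \<phi>] by linarith
        then show ?thesis by (simp add: d_def)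
      qed
      finally have 3: "norm (ev \<phi> (g - pointwise_scale u g - pointwise_scale v g)) \<le> e" .
      have "ev \<phi> g = ev \<phi> (pointwise_scale u g) + ev \<phi> (pointwise_scale v g) + ev \<phi> (g - pointwise_scale u g - pointwise_scale v g)"
        by (simp add: ev_simps)
      then show "norm (ev \<phi> g) \<le> variation \<phi> h + variation \<phi> k + e"
        using 1 2 3 norm_triangle_ineq[of "ev \<phi> (pointwise_scale u g) + ev \<phi> (pointwise_scale v g)" "ev \<phi> (g - pointwise_scale u g - pointwise_scale v g)"]
          norm_triangle_ineq[of "ev \<phi> (pointwise_scale u g)" "ev \<phi> (pointwise_scale v g)"] by simp
    qed
  qed (use h k in simp)
  have *: "norm (ev \<phi> f) + norm (ev \<phi> g) \<le> variation \<phi> (\<lambda>x. h x + k x)"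
    if f: "\<And>x. norm (apply_bcontfun f x) \<le> h x" and g: "\<And>x. norm (apply_bcontfun g x) \<le> k x" for f g
  proof -
    obtain a where a: "norm a = 1" "a * ev \<phi> f = of_real (norm (ev \<phi> f))" by (rule norm_rotation)
    obtain b where b: "norm b = 1" "b * ev \<phi> g = of_real (norm (ev \<phi> g))" by (rule norm_rotation)
    have eq: "ev \<phi> (ck_scale a f + ck_scale b g) = of_real (norm (ev \<phi> f) + norm (ev \<phi> g))"
      by (simp add: ev_simps a b)
    have "norm (ev \<phi> f) + norm (ev \<phi> g) \<le> norm (ev \<phi> (ck_scale a f + ck_scale b g))"
      unfolding eq norm_of_real by (rule abs_ge_self)
    also have "\<dots> \<le> variation \<phi> (\<lambda>x. h x + k x)"
    proof (rule variation_upper[OF hk])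
      fix x
      show "norm (apply_bcontfun (ck_scale a f + ck_scale b g) x) \<le> h x + k x"
        using norm_triangle_ineq[of "a * apply_bcontfun f x" "b * apply_bcontfun g x"] f[of x] g[of x] a(1) b(1)
        by (simp add: norm_mult)
    qed
    finally show ?thesis .
  qed
  have "variation \<phi> k \<le> variation \<phi> (\<lambda>x. h x + k x) - norm (ev \<phi> f)"
    if "\<And>x. norm (apply_bcontfun f x) \<le> h x" for f
    by (rule variation_least[OF k(2)]) (use *[OF that] in \<open>simp add: algebra_simps\<close>)
  then have "variation \<phi> h \<le> variation \<phi> (\<lambda>x. h x + k x) - variation \<phi> k"
    by (intro variation_least[OF h(2)]) (simp add: algebra_simps)
  then show "variation \<phi> h + variation \<phi> k \<le> variation \<phi> (\<lambda>x. h x + k x)" by simp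
qed

lemma variation_sum:
  assumes "finite I" "\<And>i. i \<in> I \<Longrightarrow> continuous_on UNIV (h i)" "\<And>i x. i \<in> I \<Longrightarrow> 0 \<le> h i x"
    "\<And>i x. i \<in> I \<Longrightarrow> h i x \<le> B"
  shows "variation \<phi> (\<lambda>x. \<Sum>i\<in>I. h i x) = (\<Sum>i\<in>I. variation \<phi> (h i))"
  using assms
proof (induction I rule: finite_induct)
  case empty
  have "variation \<phi> (\<lambda>x. 0 * 0) = 0 * variation \<phi> (\<lambda>x. 0)" by (rule variation_scale[of _ 0]) auto
  then show ?case by simp
next
  case (insert i I)
  have "(\<Sum>i\<in>I. h i x) \<le> real (card I) * B" for x
    by (rule sum_bounded_above) (use insert in auto)
  then have "variation \<phi> (\<lambda>x. h i x + (\<Sum>i\<in>I. h i x)) = variation \<phi> (h i) + variation \<phi> (\<lambda>x. \<Sum>i\<in>I. h i x)"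
    by (intro variation_add[where B=B and C="real (card I) * B"] continuous_intros sum_nonneg) (use insert in auto)
  then show ?case using insert by simp
qed

definition sq_variation :: "('a::topological_space, 'k::real_normed_field) ck_dual \<Rightarrow> ('a \<Rightarrow>\<^sub>C 'k) \<Rightarrow> real" where
  "sq_variation \<phi> f = variation \<phi> (\<lambda>x. (norm (apply_bcontfun f x))\<^sup>2)"

lemma norm_sq_le: "(norm (apply_bcontfun f x))\<^sup>2 \<le> (norm f)\<^sup>2"
  by (intro power_mono norm_bounded) simp

lemma cont_norm_sq: "continuous_on UNIV (\<lambda>x. (norm (apply_bcontfun f x))\<^sup>2)"
  by (intro continuous_intros continuous_on_apply_bcontfun)

lemma sq_variation_nonneg: "0 \<le> sq_variation \<phi> f"
  unfolding sq_variation_def by (rule variation_nonneg[OF _ norm_sq_le]) simp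

lemma sq_variation_le: "sq_variation \<phi> f \<le> norm \<phi> * (norm f)\<^sup>2"
  unfolding sq_variation_def by (rule variation_le[OF _ norm_sq_le]) simp

lemma sq_variation_mono:
  "(\<And>x. norm (apply_bcontfun f x) \<le> norm (apply_bcontfun g x)) \<Longrightarrow> sq_variation \<phi> f \<le> sq_variation \<phi> g"
  unfolding sq_variation_def by (rule variation_mono[OF _ _ norm_sq_le]) (auto intro: power_mono)

lemma sq_variation_scale: "sq_variation \<phi> (ck_scale c f) = (norm c)\<^sup>2 * sq_variation \<phi> f"
  unfolding sq_variation_def
  by (simp add: norm_mult power_mult_distrib) (rule variation_scale[OF _ norm_sq_le]; simp)

lemma variation_norm_sq_combination:
  assumes "0 \<le> a" "0 \<le> b"
  shows "variation \<phi> (\<lambda>x. a * (norm (apply_bcontfun f x))\<^sup>2 + b * (norm (apply_bcontfun g x))\<^sup>2)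
    = a * sq_variation \<phi> f + b * sq_variation \<phi> g"
proof -
  have "variation \<phi> (\<lambda>x. a * (norm (apply_bcontfun f x))\<^sup>2 + b * (norm (apply_bcontfun g x))\<^sup>2)
    = variation \<phi> (\<lambda>x. a * (norm (apply_bcontfun f x))\<^sup>2) + variation \<phi> (\<lambda>x. b * (norm (apply_bcontfun g x))\<^sup>2)"
    by (rule variation_add[where B="a * (norm f)\<^sup>2" and C="b * (norm g)\<^sup>2"])
      (use assms in \<open>auto intro!: continuous_intros cont_norm_sq mult_left_mono norm_sq_le\<close>)
  also have "variation \<phi> (\<lambda>x. a * (norm (apply_bcontfun f x))\<^sup>2) = a * sq_variation \<phi> f"
    unfolding sq_variation_def by (rule variation_scale[OF _ norm_sq_le assms(1)]) simp
  also have "variation \<phi> (\<lambda>x. b * (norm (apply_bcontfun g x))\<^sup>2) = b * sq_variation \<phi> g"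
    unfolding sq_variation_def by (rule variation_scale[OF _ norm_sq_le assms(2)]) simp
  finally show ?thesis .
qed

lemma norm_sq_combination_le:
  assumes "0 \<le> a" "0 \<le> b"
  shows "a * (norm (apply_bcontfun f x))\<^sup>2 + b * (norm (apply_bcontfun g x))\<^sup>2 \<le> a * (norm f)\<^sup>2 + b * (norm g)\<^sup>2"
  by (intro add_mono mult_left_mono norm_sq_le assms)

text \<open>Integrating \<open>\<bar>f + g\<bar>\<^sup>2 \<le> (1 + t) \<bar>f\<bar>\<^sup>2 + (1 + 1 / t) \<bar>g\<bar>\<^sup>2\<close>; optimising over \<open>t\<close> yields the triangle inequality
  for the square root.\<close>

lemma sq_variation_add:
  fixes f g :: "'a::topological_space \<Rightarrow>\<^sub>C 'k::real_normed_field"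
  assumes t: "t > 0"
  shows "sq_variation \<phi> (f + g) \<le> (1 + t) * sq_variation \<phi> f + (1 + inverse t) * sq_variation \<phi> g"
proof -
  have "(norm (apply_bcontfun (f + g) x))\<^sup>2 \<le> (1 + t) * (norm (apply_bcontfun f x))\<^sup>2 + (1 + inverse t) * (norm (apply_bcontfun g x))\<^sup>2" for x
  proof -
    define a b where "a = norm (apply_bcontfun f x)" and "b = norm (apply_bcontfun g x)"
    have "(norm (apply_bcontfun (f + g) x))\<^sup>2 \<le> (a + b)\<^sup>2"
      by (intro power_mono) (simp_all add: a_def b_def norm_triangle_ineq)
    also have "(1 + t) * a\<^sup>2 + (1 + inverse t) * b\<^sup>2 - (a + b)\<^sup>2 = inverse t * (t * a - b)\<^sup>2"
      using t by (simp add: power2_eq_square field_simps)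
    then have "(a + b)\<^sup>2 \<le> (1 + t) * a\<^sup>2 + (1 + inverse t) * b\<^sup>2"
      using t by (smt (verit, best) inverse_nonnegative_iff_nonnegative mult_nonneg_nonneg zero_le_power2)
    finally show ?thesis by (simp add: a_def b_def)
  qed
  then have "sq_variation \<phi> (f + g) \<le> variation \<phi> (\<lambda>x. (1 + t) * (norm (apply_bcontfun f x))\<^sup>2 + (1 + inverse t) * (norm (apply_bcontfun g x))\<^sup>2)"
    unfolding sq_variation_def
    by (intro variation_mono[where B="(1 + t) * (norm f)\<^sup>2 + (1 + inverse t) * (norm g)\<^sup>2"] norm_sq_combination_le) (use t in auto)
  also have "\<dots> = (1 + t) * sq_variation \<phi> f + (1 + inverse t) * sq_variation \<phi> g"
    by (rule variation_norm_sq_combination) (use t in auto)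
  finally show ?thesis .
qed

lemma sq_variation_parallelogram:
  fixes f g :: "'a::topological_space \<Rightarrow>\<^sub>C 'k::{real_normed_field,real_inner}"
  shows "sq_variation \<phi> (f + g) + sq_variation \<phi> (f - g) \<le> 2 * sq_variation \<phi> f + 2 * sq_variation \<phi> g"
proof -
  have "sq_variation \<phi> (f + g) + sq_variation \<phi> (f - g)
    = variation \<phi> (\<lambda>x. 1 * (norm (apply_bcontfun (f + g) x))\<^sup>2 + 1 * (norm (apply_bcontfun (f - g) x))\<^sup>2)"
    by (subst variation_norm_sq_combination) auto
  also have "\<dots> = variation \<phi> (\<lambda>x. 2 * (norm (apply_bcontfun f x))\<^sup>2 + 2 * (norm (apply_bcontfun g x))\<^sup>2)"
    by (simp add: power2_norm_eq_inner inner_add_left inner_add_right inner_diff_left inner_diff_right algebra_simps)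
  also have "\<dots> = 2 * sq_variation \<phi> f + 2 * sq_variation \<phi> g"
    by (rule variation_norm_sq_combination) auto
  finally show ?thesis by simp
qed

lemma sqrt_sum_sq_variation_hilbertian:
  fixes \<mu> :: "'i \<Rightarrow> ('a::topological_space, 'k::{real_normed_field,euclidean_space}) ck_dual"
  assumes C: "0 \<le> C"
  shows "hilbertian_seminorm (\<lambda>f. sqrt (C * (\<Sum>y\<in>S. sq_variation (\<mu> y) f))) (sqrt (C * (\<Sum>y\<in>S. norm (\<mu> y))))"
proof -
  define Q where "Q f = C * (\<Sum>y\<in>S. sq_variation (\<mu> y) f)" for f
  have Q0: "0 \<le> Q f" for f using C by (auto simp: Q_def intro!: mult_nonneg_nonneg sum_nonneg sq_variation_nonneg)
  have Q_add: "Q (f + g) \<le> (1 + t) * Q f + (1 + inverse t) * Q g" if "t > 0" for f g t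
  proof -
    have "(\<Sum>y\<in>S. sq_variation (\<mu> y) (f + g)) \<le> (\<Sum>y\<in>S. (1 + t) * sq_variation (\<mu> y) f + (1 + inverse t) * sq_variation (\<mu> y) g)"
      by (intro sum_mono sq_variation_add that)
    from mult_left_mono[OF this C] show ?thesis
      by (simp add: Q_def sum.distrib sum_distrib_left[symmetric] algebra_simps)
  qed
  have "sqrt (Q (f + g)) \<le> sqrt (Q f) + sqrt (Q g)" for f g
  proof (rule field_le_epsilon)
    fix e :: real assume e: "e > 0"
    \<comment> \<open>The optimal \<open>t\<close> is \<open>sqrt (Q g) / sqrt (Q f)\<close>; adding \<open>e / 2\<close> keeps it positive and finite.\<close>
    define a b where "a = sqrt (Q f) + e / 2" and "b = sqrt (Q g) + e / 2"
    have ab: "a > 0" "b > 0" using e Q0 by (auto simp: a_def b_def add_nonneg_pos)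
    have "(sqrt (Q f))\<^sup>2 \<le> a\<^sup>2" "(sqrt (Q g))\<^sup>2 \<le> b\<^sup>2"
      using e Q0 by (auto simp only: a_def b_def intro!: power_mono) auto
    then have le: "Q f \<le> a\<^sup>2" "Q g \<le> b\<^sup>2" using Q0 by auto
    have "Q (f + g) \<le> (1 + b / a) * Q f + (1 + inverse (b / a)) * Q g"
      by (rule Q_add) (use ab in simp)
    also have "\<dots> \<le> (1 + b / a) * a\<^sup>2 + (1 + inverse (b / a)) * b\<^sup>2"
      using ab le by (intro add_mono mult_left_mono) auto
    also have "\<dots> = (a + b)\<^sup>2" using ab by (simp add: power2_eq_square field_simps)
    finally have "sqrt (Q (f + g)) \<le> a + b" using ab by (intro real_le_lsqrt) auto
    then show "sqrt (Q (f + g)) \<le> sqrt (Q f) + sqrt (Q g) + e" by (simp add: a_def b_def)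
  qed
  moreover have "Q (ck_scale c f) = (norm c)\<^sup>2 * Q f" for c f
    by (simp add: Q_def sq_variation_scale sum_distrib_left[symmetric])
  then have "sqrt (Q (ck_scale c f)) = norm c * sqrt (Q f)" for c f
    by (simp add: real_sqrt_mult)
  moreover have "sqrt (Q f) \<le> sqrt (C * (\<Sum>y\<in>S. norm (\<mu> y))) * norm f" for f
  proof -
    have "Q f \<le> C * (\<Sum>y\<in>S. norm (\<mu> y) * (norm f)\<^sup>2)"
      unfolding Q_def by (intro mult_left_mono sum_mono sq_variation_le C)
    also have "\<dots> = (C * (\<Sum>y\<in>S. norm (\<mu> y))) * (norm f)\<^sup>2" by (simp add: sum_distrib_right)
    finally have "sqrt (Q f) \<le> sqrt \<dots>" by (rule real_sqrt_le_mono)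
    then show ?thesis by (simp add: real_sqrt_mult)
  qed
  moreover have "Q (f + g) + Q (f - g) \<le> 2 * Q f + 2 * Q g" for f g
  proof -
    have "(\<Sum>y\<in>S. sq_variation (\<mu> y) (f + g) + sq_variation (\<mu> y) (f - g))
        \<le> (\<Sum>y\<in>S. 2 * sq_variation (\<mu> y) f + 2 * sq_variation (\<mu> y) g)"
      by (intro sum_mono sq_variation_parallelogram)
    from mult_left_mono[OF this C] show ?thesis
      by (simp add: Q_def sum.distrib sum_distrib_left[symmetric] algebra_simps)
  qed
  then have "(sqrt (Q (f + g)))\<^sup>2 + (sqrt (Q (f - g)))\<^sup>2 \<le> 2 * (sqrt (Q f))\<^sup>2 + 2 * (sqrt (Q g))\<^sup>2" for f g
    using Q0 by simp
  ultimately show ?thesis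
    unfolding Q_def[symmetric] by unfold_locales (auto simp: ck_seminorm_def)
qed

text \<open>No finite part of the family \<open>\<mu>\<close> controls the rest up to an error \<open>c\<close>: whatever finitely many
  \<open>\<mu> y\<close> and constant \<open>C\<close> are given, some \<open>\<mu> x\<close> takes a value larger than \<open>c\<close> at a function \<open>f\<close> in the unit ball
  on which these \<open>\<mu> y\<close> have little quadratic mass. The set \<open>Z\<close> collects the places that are already
  occupied by the functions chosen earlier. Since the condition is monotone in \<open>S\<close> and \<open>C\<close>, finitely many
  instances of it can be combined into one, which is what makes the pigeonhole argument below work.\<close>

definition escapes :: "('i \<Rightarrow> ('a::topological_space, 'k::real_normed_field) ck_dual) \<Rightarrow> 'a set \<Rightarrow> real \<Rightarrow> bool" where
  "escapes \<mu> Z c \<longleftrightarrow> (\<forall>S C. finite S \<longrightarrow> 0 \<le> C \<longrightarrow> (\<exists>x f. (\<forall>z\<in>Z. apply_bcontfun f z = 0) \<and> norm f \<le> 1 \<and>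
     c + C * (\<Sum>y\<in>S. sq_variation (\<mu> y) f) < norm (ev (\<mu> x) f)))"

text \<open>If it failed for \<open>S\<close> and \<open>C\<close>, the Hilbertian seminorm that belongs to a multiple of \<open>\<Sum>y\<in>S. \<bar>\<mu> y\<bar>\<close> would dominate
  all \<open>\<mu> x\<close> up to \<open>c\<close>, and the dual weak essential norm would be at most \<open>c\<close>.\<close>

lemma point_images_escape:
  fixes T :: "('a::topological_space \<Rightarrow>\<^sub>C 'k::{real_normed_field,euclidean_space}) \<Rightarrow>\<^sub>L ('a \<Rightarrow>\<^sub>C 'k)"
  assumes K: "compact (UNIV :: 'a set)" and T: "T \<in> operators ck_scale"
    and c: "0 \<le> c" "c < dual_weak_essential_norm T"
  shows "escapes (\<lambda>x. blinfun_apply (adjoint_op T) (point_mass x)) {} c"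
  unfolding escapes_def
proof (intro allI impI)
  fix S :: "'a set" and C :: real
  assume S: "finite S" and C: "0 \<le> C"
  let ?\<mu> = "\<lambda>x. blinfun_apply (adjoint_op T) (point_mass x) :: ('a, 'k) ck_dual"
  define M where "M = norm T + 1"
  have M: "M > 0" by (simp add: M_def add_nonneg_pos)
  \<comment> \<open>With \<open>p u \<le> M\<close>, the factor \<open>M\<close> turns the bound by \<open>p u\<close> into one by its square.\<close>
  define p where "p f = sqrt (C * M * (\<Sum>y\<in>S. sq_variation (?\<mu> y) f))" for f
  have CM: "0 \<le> C * M" using C M by simp
  interpret hilbertian_seminorm p "sqrt (C * M * (\<Sum>y\<in>S. norm (?\<mu> y)))"
    unfolding p_def by (rule sqrt_sum_sq_variation_hilbertian[OF CM])
  obtain x f where f: "c * norm f + p f < norm (apply_bcontfun (T f) x)"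
    using dual_weak_essential_norm_le_of_domination[OF K T c(1)] c(2) by (meson not_le)
  then have "f \<noteq> 0" using c(1) p_nonneg[of f] by (auto simp: blinfun.zero_right p_zero)
  define u where "u = inverse (norm f) *\<^sub>R f"
  have u: "norm u = 1" using \<open>f \<noteq> 0\<close> by (simp add: u_def)
  have fu: "f = norm f *\<^sub>R u" using \<open>f \<noteq> 0\<close> by (simp add: u_def)
  have "norm f * (c + p u) < norm f * norm (apply_bcontfun (T u) x)"
    using f by (subst (asm) (1 2 3) fu) (simp add: u p_scaleR blinfun.scaleR_right algebra_simps)
  then have pu: "c + p u < norm (apply_bcontfun (T u) x)"
    using \<open>f \<noteq> 0\<close> by simp
  also have "\<dots> \<le> norm T" using norm_bounded[of "T u" x] norm_blinfun[of T u] u by simp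
  finally have "p u \<le> M" using c by (simp add: M_def)
  have "M * (C * (\<Sum>y\<in>S. sq_variation (?\<mu> y) u)) = (p u)\<^sup>2"
    using CM by (simp add: p_def sum_nonneg sq_variation_nonneg)
  also have "\<dots> \<le> M * p u"
    using mult_right_mono[OF \<open>p u \<le> M\<close> p_nonneg[of u]] by (simp add: power2_eq_square)
  finally have "C * (\<Sum>y\<in>S. sq_variation (?\<mu> y) u) \<le> p u" using M by simp
  then have "c + C * (\<Sum>y\<in>S. sq_variation (?\<mu> y) u) < norm (ev (?\<mu> x) u)"
    using pu by (simp add: ev_adjoint_op[OF T] ev_point_mass)
  then show "\<exists>x f. (\<forall>z\<in>{}. apply_bcontfun f z = 0) \<and> norm f \<le> 1 \<and>
      c + C * (\<Sum>y\<in>S. sq_variation (?\<mu> y) f) < norm (ev (?\<mu> x) f)"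
    using u by (intro exI[of _ x] exI[of _ u]) simp
qed

section \<open>Disjoint bumps carrying the dual weak essential norm\<close>

lemma apply_bcontfun_sum:
  "apply_bcontfun (\<Sum>i\<in>I. f i) x = (\<Sum>i\<in>I. apply_bcontfun (f i :: _ \<Rightarrow>\<^sub>C _ :: real_normed_vector) x)"
  by (induction I rule: infinite_finite_induct) auto

definition disjointly_supported :: "'i set \<Rightarrow> ('i \<Rightarrow> 'a::topological_space \<Rightarrow>\<^sub>C 'k::real_normed_field) \<Rightarrow> bool" where
  "disjointly_supported I g \<longleftrightarrow>
    (\<forall>i\<in>I. \<forall>j\<in>I. i \<noteq> j \<longrightarrow> (\<forall>x. apply_bcontfun (g i) x = 0 \<or> apply_bcontfun (g j) x = 0))"

lemma disjoint_combination_apply: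
  assumes I: "finite I" "disjointly_supported I g" and i: "i \<in> I" "apply_bcontfun (g i) x \<noteq> 0"
  shows "apply_bcontfun (\<Sum>j\<in>I. ck_scale (a j) (g j)) x = a i * apply_bcontfun (g i) x"
proof -
  have "(\<Sum>j\<in>I. a j * apply_bcontfun (g j) x) = (\<Sum>j\<in>{i}. a j * apply_bcontfun (g j) x)"
    by (rule sum.mono_neutral_right) (use I i in \<open>auto simp: disjointly_supported_def\<close>)
  then show ?thesis by (simp add: apply_bcontfun_sum)
qed

lemma disjoint_combination_norm:
  assumes I: "finite I" "disjointly_supported I g"
    and a: "\<And>i. i \<in> I \<Longrightarrow> norm (a i) \<le> B" and B: "0 \<le> B" and g: "\<And>i. i \<in> I \<Longrightarrow> norm (g i) \<le> 1"
  shows "norm (\<Sum>i\<in>I. ck_scale (a i) (g i)) \<le> B"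
proof (rule norm_bound)
  fix x
  show "norm (apply_bcontfun (\<Sum>i\<in>I. ck_scale (a i) (g i)) x) \<le> B"
  proof (cases "\<exists>i\<in>I. apply_bcontfun (g i) x \<noteq> 0")
    case True
    then obtain i where i: "i \<in> I" "apply_bcontfun (g i) x \<noteq> 0" by blast
    have "norm (a i) * norm (apply_bcontfun (g i) x) \<le> B * 1"
      using i a g[OF i(1)] B norm_bounded[of "g i" x] by (intro mult_mono) auto
    then show ?thesis by (simp add: disjoint_combination_apply[OF I i] norm_mult)
  next
    case False
    then show ?thesis using B by (simp add: apply_bcontfun_sum)
  qed
qed

lemma disjoint_evaluation_sum:
  assumes I: "finite I" "disjointly_supported I g" and g: "\<And>i. i \<in> I \<Longrightarrow> norm (g i) \<le> 1"
  shows "(\<Sum>i\<in>I. norm (ev \<phi> (g i))) \<le> norm \<phi>"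
proof -
  have "\<exists>a. norm a = 1 \<and> a * ev \<phi> (g i) = of_real (norm (ev \<phi> (g i)))" for i
    using norm_rotation by metis
  then obtain a where a: "\<And>i. norm (a i) = 1" "\<And>i. a i * ev \<phi> (g i) = of_real (norm (ev \<phi> (g i)))" by metis
  have "ev \<phi> (\<Sum>i\<in>I. ck_scale (a i) (g i)) = of_real (\<Sum>i\<in>I. norm (ev \<phi> (g i)))"
    by (simp add: blinfun.sum_right ev_simps a)
  then have "(\<Sum>i\<in>I. norm (ev \<phi> (g i))) = norm (ev \<phi> (\<Sum>i\<in>I. ck_scale (a i) (g i)))"
    by (simp add: sum_nonneg del: of_real_sum)
  also have "\<dots> \<le> norm \<phi> * norm (\<Sum>i\<in>I. ck_scale (a i) (g i))" by (rule norm_ev_le)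
  also have "\<dots> \<le> norm \<phi> * 1"
    by (intro mult_left_mono disjoint_combination_norm I g) (auto simp: a)
  finally show ?thesis by simp
qed

text \<open>Soft thresholding: values of modulus at most \<open>\<delta>\<close> become zero, the others move towards zero by \<open>\<delta>\<close>.\<close>

definition shrink :: "real \<Rightarrow> ('a::topological_space \<Rightarrow>\<^sub>C 'k::real_normed_vector) \<Rightarrow> ('a \<Rightarrow>\<^sub>C 'k)" where
  "shrink \<delta> f = pointwise_scale (\<lambda>x. max 0 (1 - \<delta> / max (norm (apply_bcontfun f x)) \<delta>)) f"

definition plateau :: "real \<Rightarrow> ('a::topological_space \<Rightarrow>\<^sub>C 'k::real_normed_vector) \<Rightarrow> 'a \<Rightarrow> real" where
  "plateau \<delta> f x = min 1 ((norm (apply_bcontfun f x) / \<delta>)\<^sup>2)"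

lemma shrink_apply:
  assumes \<delta>: "\<delta> > 0"
  shows "apply_bcontfun (shrink \<delta> f) x = max 0 (1 - \<delta> / max (norm (apply_bcontfun f x)) \<delta>) *\<^sub>R apply_bcontfun f x"
  unfolding shrink_def
proof (rule pointwise_scale_apply)
  have "max (norm (apply_bcontfun f x)) \<delta> \<noteq> 0" for x using \<delta> by (auto simp: max_def)
  then show "continuous_on UNIV (\<lambda>x. max 0 (1 - \<delta> / max (norm (apply_bcontfun f x)) \<delta>))"
    by (intro continuous_intros continuous_on_apply_bcontfun) auto
  fix x
  have "0 \<le> \<delta> / max (norm (apply_bcontfun f x)) \<delta>" using \<delta> by (intro divide_nonneg_nonneg) auto
  then show "max 0 (1 - \<delta> / max (norm (apply_bcontfun f x)) \<delta>) \<le> 1" by simp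
qed simp

lemma shrink_eq_0: "\<delta> > 0 \<Longrightarrow> norm (apply_bcontfun f x) \<le> \<delta> \<Longrightarrow> apply_bcontfun (shrink \<delta> f) x = 0"
  by (simp add: shrink_apply max_def)

lemma norm_shrink_apply_le:
  assumes \<delta>: "\<delta> > 0"
  shows "norm (apply_bcontfun (shrink \<delta> f) x) \<le> norm (apply_bcontfun f x)"
proof -
  have "0 \<le> \<delta> / max (norm (apply_bcontfun f x)) \<delta>" using \<delta> by (intro divide_nonneg_nonneg) auto
  then have "max 0 (1 - \<delta> / max (norm (apply_bcontfun f x)) \<delta>) \<le> 1" by simp
  then show ?thesis unfolding shrink_apply[OF \<delta>] by (simp add: mult_left_le_one_le)
qed

lemma norm_shrink_le: "\<delta> > 0 \<Longrightarrow> norm (shrink \<delta> f) \<le> norm f"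
  by (rule norm_bound) (meson norm_bounded norm_shrink_apply_le order_trans)

lemma norm_diff_shrink_le:
  assumes \<delta>: "\<delta> > 0"
  shows "norm (f - shrink \<delta> f) \<le> \<delta>"
proof (rule norm_bound)
  fix x
  show "norm (apply_bcontfun (f - shrink \<delta> f) x) \<le> \<delta>"
  proof (cases "norm (apply_bcontfun f x) \<le> \<delta>")
    case True
    then show ?thesis by (simp add: shrink_eq_0[OF \<delta>])
  next
    case False
    let ?r = "norm (apply_bcontfun f x)"
    have r: "?r > 0" "\<delta> < ?r" using False \<delta> by linarith+
    then have "max 0 (1 - \<delta> / max ?r \<delta>) = 1 - \<delta> / ?r" using \<delta> by (simp add: max_def)
    then have "apply_bcontfun (f - shrink \<delta> f) x = (\<delta> / ?r) *\<^sub>R apply_bcontfun f x"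
      by (simp add: shrink_apply[OF \<delta>] scaleR_left_diff_distrib)
    then show ?thesis using r \<delta> by simp
  qed
qed

lemma plateau_props:
  assumes "\<delta> > 0"
  shows "continuous_on UNIV (plateau \<delta> f)" "0 \<le> plateau \<delta> f x" "plateau \<delta> f x \<le> 1"
    "\<delta> \<le> norm (apply_bcontfun f x) \<Longrightarrow> plateau \<delta> f x = 1"
    "plateau \<delta> f x \<le> inverse (\<delta>\<^sup>2) * (norm (apply_bcontfun f x))\<^sup>2"
    "apply_bcontfun f x = 0 \<Longrightarrow> plateau \<delta> f x = 0"
proof -
  show "continuous_on UNIV (plateau \<delta> f)"
    unfolding plateau_def by (intro continuous_intros continuous_on_apply_bcontfun) (use assms in auto)
  show "plateau \<delta> f x = 1" if "\<delta> \<le> norm (apply_bcontfun f x)"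
    using that assms by (simp add: plateau_def)
qed (use assms in \<open>simp_all add: plateau_def power_divide field_simps\<close>)

lemma one_minus_prod_le_sum:
  fixes t :: "'i \<Rightarrow> real"
  assumes "finite I" "\<And>i. i \<in> I \<Longrightarrow> 0 \<le> t i" "\<And>i. i \<in> I \<Longrightarrow> t i \<le> 1"
  shows "1 - (\<Prod>i\<in>I. 1 - t i) \<le> (\<Sum>i\<in>I. t i)"
  using assms
proof (induction I rule: finite_induct)
  case (insert i I)
  have P: "0 \<le> (\<Prod>i\<in>I. 1 - t i)" "(\<Prod>i\<in>I. 1 - t i) \<le> 1"
    using insert by (auto intro!: prod_nonneg prod_le_1)
  have "1 - (\<Prod>i\<in>insert i I. 1 - t i) = (1 - (\<Prod>i\<in>I. 1 - t i)) + t i * (\<Prod>i\<in>I. 1 - t i)"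
    using insert by (simp add: algebra_simps)
  also have "\<dots> \<le> (\<Sum>i\<in>I. t i) + t i * 1"
    using insert P by (intro add_mono mult_left_mono) auto
  finally show ?case using insert by simp
qed simp

lemma escaping_sequence:
  fixes \<mu> :: "'i \<Rightarrow> ('a::topological_space, 'k::real_normed_field) ck_dual"
  assumes esc: "escapes \<mu> Z c" and M: "\<And>x. norm (\<mu> x) \<le> M" and c: "0 \<le> c" and \<eta>: "\<eta> > 0"
  obtains x :: "nat \<Rightarrow> 'i" and f :: "nat \<Rightarrow> 'a \<Rightarrow>\<^sub>C 'k" where "\<And>n z. z \<in> Z \<Longrightarrow> apply_bcontfun (f n) z = 0" "\<And>n. norm (f n) \<le> 1"
    "\<And>n. c < norm (ev (\<mu> (x n)) (f n))" "\<And>n i. i < n \<Longrightarrow> sq_variation (\<mu> (x i)) (f n) \<le> \<eta>"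
proof -
  define P where "P h n r \<longleftrightarrow> (\<forall>z\<in>Z. apply_bcontfun (snd r) z = 0) \<and> norm (snd r) \<le> 1 \<and>
      c < norm (ev (\<mu> (fst r)) (snd r)) \<and> (\<forall>i<n. sq_variation (\<mu> (fst (h i))) (snd r) \<le> \<eta>)"
    for h :: "nat \<Rightarrow> 'i \<times> ('a \<Rightarrow>\<^sub>C 'k)" and n :: nat and r :: "'i \<times> ('a \<Rightarrow>\<^sub>C 'k)"
  have "\<exists>h. \<forall>n. P h n (h n)"
  proof (rule dependent_wellorder_choice)
    show "P h n r = P h' n r" if "\<And>y. y < n \<Longrightarrow> h y = h' y" for r h h' n
      using that by (simp add: P_def)
    fix n and h :: "nat \<Rightarrow> 'i \<times> ('a \<Rightarrow>\<^sub>C 'k)"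
    have M0: "0 \<le> M" using M[of undefined] norm_ge_zero order_trans by blast
    let ?S = "(\<lambda>i. fst (h i)) ` {..<n}"
    have C: "0 \<le> (M + 1) / \<eta>" using M0 \<eta> by simp
    obtain x and f :: "'a \<Rightarrow>\<^sub>C 'k" where xf: "\<forall>z\<in>Z. apply_bcontfun f z = 0" "norm f \<le> 1"
      "c + (M + 1) / \<eta> * (\<Sum>y\<in>?S. sq_variation (\<mu> y) f) < norm (ev (\<mu> x) f)"
      using esc[unfolded escapes_def, rule_format, of ?S, OF _ C] by auto
    have nonneg: "0 \<le> (\<Sum>y\<in>?S. sq_variation (\<mu> y) f)" by (intro sum_nonneg sq_variation_nonneg)
    have "norm (ev (\<mu> x) f) \<le> M * 1"
      using norm_ev_le[of "\<mu> x" f] mult_mono[OF M[of x] xf(2) M0] by simp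
    with xf(3) c have "(M + 1) / \<eta> * (\<Sum>y\<in>?S. sq_variation (\<mu> y) f) \<le> M + 1" by simp
    then have "(M + 1) * (\<Sum>y\<in>?S. sq_variation (\<mu> y) f) \<le> (M + 1) * \<eta>"
      using \<eta> by (simp add: field_simps)
    then have sum_le: "(\<Sum>y\<in>?S. sq_variation (\<mu> y) f) \<le> \<eta>" using M0 by simp
    have "sq_variation (\<mu> (fst (h i))) f \<le> \<eta>" if "i < n" for i
    proof -
      have "sq_variation (\<mu> (fst (h i))) f \<le> (\<Sum>y\<in>?S. sq_variation (\<mu> y) f)"
        by (rule member_le_sum) (use that sq_variation_nonneg in auto)
      with sum_le show ?thesis by simp
    qed
    moreover have "c < norm (ev (\<mu> x) f)" using xf(3) nonneg mult_nonneg_nonneg[OF C nonneg] by linarith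
    ultimately have "P h n (x, f)" using xf by (simp add: P_def)
    then show "\<exists>r. P h n r" ..
  qed
  then obtain h where h: "\<And>n. P h n (h n)" by blast
  show ?thesis
    by (rule that[of "\<lambda>n. snd (h n)" "\<lambda>n. fst (h n)"]) (use h in \<open>auto simp: P_def\<close>)
qed

text \<open>Take a sequence \<open>f\<close> in which the earlier functionals have little mass on the later functions. Cutting the
  later plateaus out of the (shrunk) earlier functions makes the first \<open>N\<close> of them disjoint. It changes
  \<open>\<mu> (x i) (f i)\<close> little, since \<open>\<mu> (x i)\<close> has little variation on the plateaus of \<open>f j\<close> for \<open>j > i\<close>.\<close>

lemma escaping_disjoint_bumps:
  fixes \<mu> :: "'i \<Rightarrow> ('a::topological_space, 'k::real_normed_field) ck_dual"
  assumes esc: "escapes \<mu> Z c" and M: "\<And>x. norm (\<mu> x) \<le> M" and c: "0 \<le> c" and \<epsilon>: "\<epsilon> > 0"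
  obtains x :: "nat \<Rightarrow> 'i" and u :: "nat \<Rightarrow> 'a \<Rightarrow>\<^sub>C 'k" where "\<And>n z. z \<in> Z \<Longrightarrow> apply_bcontfun (u n) z = 0" "\<And>n. norm (u n) \<le> 1"
    "\<And>n. n < N \<Longrightarrow> c - \<epsilon> < norm (ev (\<mu> (x n)) (u n))" "disjointly_supported {..<N} u"
proof -
  have M0: "0 \<le> M" using M[of undefined] norm_ge_zero order_trans by blast
  define \<delta> where "\<delta> = \<epsilon> / (2 * (M + 1))"
  have \<delta>: "\<delta> > 0" "M * \<delta> \<le> \<epsilon> / 2" using \<epsilon> M0 by (auto simp: \<delta>_def field_simps)
  define \<eta> where "\<eta> = \<delta>\<^sup>2 * \<epsilon> / (2 * (real N + 1))"
  have \<eta>: "\<eta> > 0" using \<delta> \<epsilon> by (simp add: \<eta>_def)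
  obtain x and f :: "nat \<Rightarrow> 'a \<Rightarrow>\<^sub>C 'k" where f: "\<And>n z. z \<in> Z \<Longrightarrow> apply_bcontfun (f n) z = 0" "\<And>n. norm (f n) \<le> 1"
    "\<And>n. c < norm (ev (\<mu> (x n)) (f n))" "\<And>n i. i < n \<Longrightarrow> sq_variation (\<mu> (x i)) (f n) \<le> \<eta>"
    by (rule escaping_sequence[OF esc M c \<eta>]) blast
  let ?\<theta> = "\<lambda>j. plateau \<delta> (f j)"
  note \<theta> = plateau_props[OF \<delta>(1)]
  define P where "P i z = (\<Prod>j\<in>{i<..<N}. 1 - ?\<theta> j z)" for i z
  have P_cont: "continuous_on UNIV (P i)" for i
    unfolding P_def by (intro continuous_intros \<theta>)
  have P: "0 \<le> P i z" "P i z \<le> 1" for i z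
    unfolding P_def using \<theta> by (auto intro!: prod_nonneg prod_le_1)
  define u where "u i = pointwise_scale (P i) (shrink \<delta> (f i))" for i
  have u: "apply_bcontfun (u i) z = P i z *\<^sub>R apply_bcontfun (shrink \<delta> (f i)) z" for i z
    unfolding u_def by (rule pointwise_scale_apply[OF P_cont P])
  have u_le: "norm (apply_bcontfun (u i) z) \<le> norm (apply_bcontfun (f i) z)" for i z
    using norm_shrink_apply_le[OF \<delta>(1), of "f i" z] P[of i z]
    by (simp add: u) (meson mult_left_le_one_le norm_ge_zero order_trans)
  have zero: "apply_bcontfun (u i) z = 0 \<or> apply_bcontfun (u j) z = 0" if ij: "i < j" "j < N" for i j z
  proof (cases "norm (apply_bcontfun (f j) z) \<le> \<delta>")
    case True
    then show ?thesis by (simp add: u shrink_eq_0[OF \<delta>(1)])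
  next
    case False
    then have "?\<theta> j z = 1" by (intro \<theta>) simp
    then have "P i z = 0" unfolding P_def using ij by (intro prod_zero) auto
    then show ?thesis by (simp add: u)
  qed
  have near: "norm (ev (\<mu> (x i)) (shrink \<delta> (f i) - u i)) < \<epsilon> / 2" for i
  proof -
    let ?h = "\<lambda>z. \<Sum>j\<in>{i<..<N}. inverse (\<delta>\<^sup>2) * (norm (apply_bcontfun (f j) z))\<^sup>2"
    have sq1: "inverse (\<delta>\<^sup>2) * (norm (apply_bcontfun (f j) z))\<^sup>2 \<le> inverse (\<delta>\<^sup>2)" for j z
    proof (rule mult_left_le)
      have "norm (apply_bcontfun (f j) z) \<le> 1" using norm_bounded[of "f j" z] f(2)[of j] by linarith
      then show "(norm (apply_bcontfun (f j) z))\<^sup>2 \<le> 1" by (simp add: power_le_one)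
    qed simp
    have "norm (ev (\<mu> (x i)) (shrink \<delta> (f i) - u i)) \<le> variation (\<mu> (x i)) ?h"
    proof (rule variation_upper)
      show "?h z \<le> real (card {i<..<N}) * inverse (\<delta>\<^sup>2)" for z
        by (rule sum_bounded_above) (rule sq1)
      fix z
      have "norm (apply_bcontfun (shrink \<delta> (f i)) z) \<le> 1"
        using norm_bounded[of "shrink \<delta> (f i)" z] norm_shrink_le[OF \<delta>(1), of "f i"] f(2)[of i] by linarith
      then have "(1 - P i z) * norm (apply_bcontfun (shrink \<delta> (f i)) z) \<le> (1 - P i z) * 1"
        using P[of i z] by (intro mult_left_mono) auto
      moreover have "apply_bcontfun (shrink \<delta> (f i) - u i) z = (1 - P i z) *\<^sub>R apply_bcontfun (shrink \<delta> (f i)) z"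
        by (simp add: u scaleR_left_diff_distrib)
      ultimately have "norm (apply_bcontfun (shrink \<delta> (f i) - u i) z) \<le> 1 - P i z"
        using P[of i z] by simp
      also have "\<dots> \<le> (\<Sum>j\<in>{i<..<N}. ?\<theta> j z)"
        unfolding P_def by (rule one_minus_prod_le_sum) (auto simp: \<theta>)
      also have "\<dots> \<le> ?h z" by (intro sum_mono \<theta>)
      finally show "norm (apply_bcontfun (shrink \<delta> (f i) - u i) z) \<le> ?h z" .
    qed
    also have "\<dots> = (\<Sum>j\<in>{i<..<N}. variation (\<mu> (x i)) (\<lambda>z. inverse (\<delta>\<^sup>2) * (norm (apply_bcontfun (f j) z))\<^sup>2))"
      by (rule variation_sum[OF _ _ _ sq1]) (auto intro!: continuous_intros cont_norm_sq)
    also have "\<dots> = (\<Sum>j\<in>{i<..<N}. inverse (\<delta>\<^sup>2) * sq_variation (\<mu> (x i)) (f j))"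
      unfolding sq_variation_def by (intro sum.cong refl variation_scale[OF _ norm_sq_le]) auto
    also have "\<dots> \<le> (\<Sum>j\<in>{i<..<N}. inverse (\<delta>\<^sup>2) * \<eta>)"
      by (intro sum_mono mult_left_mono f) auto
    also have "\<dots> \<le> real N * (inverse (\<delta>\<^sup>2) * \<eta>)"
      using \<eta> by (simp add: mult_right_mono)
    also have "\<dots> < (real N + 1) * (inverse (\<delta>\<^sup>2) * \<eta>)" using \<eta> \<delta> by simp
    also have "inverse (\<delta>\<^sup>2) * \<eta> = \<epsilon> / 2 / (real N + 1)" using \<delta> by (simp add: \<eta>_def)
    also have "(real N + 1) * (\<epsilon> / 2 / (real N + 1)) = \<epsilon> / 2"
    proof -
      have "real N + 1 \<noteq> 0" by linarith
      then show ?thesis by (rule nonzero_mult_div_cancel_left[of _ "\<epsilon> / 2", unfolded times_divide_eq_right[symmetric]])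
    qed
    finally show ?thesis .
  qed
  show ?thesis
  proof (rule that[of u x])
    show "apply_bcontfun (u n) z = 0" if "z \<in> Z" for n z
      using u_le[of n z] f(1)[OF that] by simp
    show "norm (u n) \<le> 1" for n
      by (rule norm_bound) (use u_le f(2) norm_bounded in \<open>meson order_trans\<close>)
    show "disjointly_supported {..<N} u"
      unfolding disjointly_supported_def using zero by (metis lessThan_iff nat_neq_iff)
    show "c - \<epsilon> < norm (ev (\<mu> (x n)) (u n))" for n
    proof -
      have "norm (ev (\<mu> (x n)) (f n - shrink \<delta> (f n))) \<le> M * \<delta>"
        using norm_ev_le[of "\<mu> (x n)" "f n - shrink \<delta> (f n)"]
          mult_mono[OF M[of "x n"] norm_diff_shrink_le[OF \<delta>(1), of "f n"] M0] by simp
      moreover have "norm (ev (\<mu> (x n)) (f n)) \<le> norm (ev (\<mu> (x n)) (u n)) +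
          norm (ev (\<mu> (x n)) (f n - shrink \<delta> (f n))) + norm (ev (\<mu> (x n)) (shrink \<delta> (f n) - u n))"
        using norm_triangle_ineq[of "ev (\<mu> (x n)) (u n) + ev (\<mu> (x n)) (f n - shrink \<delta> (f n))" "ev (\<mu> (x n)) (shrink \<delta> (f n) - u n)"]
          norm_triangle_ineq[of "ev (\<mu> (x n)) (u n)" "ev (\<mu> (x n)) (f n - shrink \<delta> (f n))"]
        by (simp add: ev_simps)
      ultimately show ?thesis
        using near[of n] \<delta>(2) f(3)[of n] by linarith
    qed
  qed
qed

text \<open>One of \<open>N\<close> disjoint bumps can be set aside for good. Let \<open>v i\<close> be the part of \<open>f\<close> near the \<open>i\<close>-th
  bump. If removing it would destroy the escape property for every \<open>i\<close>, then some single \<open>\<mu> y\<close> would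
  satisfy \<open>\<bar>\<mu> y (v i)\<bar> > \<epsilon>\<close> for all \<open>i < N\<close>. As the \<open>v i\<close> are disjoint, this gives \<open>N \<epsilon> \<le> \<parallel>\<mu> y\<parallel>\<close>, which is false for
  large \<open>N\<close>.\<close>

lemma escapes_step:
  fixes \<mu> :: "'i \<Rightarrow> ('a::topological_space, 'k::real_normed_field) ck_dual"
  assumes esc: "escapes \<mu> Z c" and M: "\<And>x. norm (\<mu> x) \<le> M" and c: "0 \<le> c" and \<epsilon>: "\<epsilon> > 0"
  obtains x and g :: "'a \<Rightarrow>\<^sub>C 'k" and Z' where "Z \<subseteq> Z'" "\<And>z. z \<in> Z \<Longrightarrow> apply_bcontfun g z = 0" "norm g \<le> 1"
    "\<And>z. z \<notin> Z' \<Longrightarrow> apply_bcontfun g z = 0" "c - \<epsilon> < norm (ev (\<mu> x) g)" "escapes \<mu> Z' (c - \<epsilon>)"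
proof -
  have M0: "0 \<le> M" using M[of undefined] norm_ge_zero order_trans by blast
  obtain N :: nat where N: "M / \<epsilon> < real N" using reals_Archimedean2 by blast
  have \<epsilon>2: "\<epsilon> / 2 > 0" using \<epsilon> by simp
  obtain x and u :: "nat \<Rightarrow> 'a \<Rightarrow>\<^sub>C 'k" where u: "\<And>n z. z \<in> Z \<Longrightarrow> apply_bcontfun (u n) z = 0" "\<And>n. norm (u n) \<le> 1"
    "\<And>n. n < N \<Longrightarrow> c - \<epsilon> / 2 < norm (ev (\<mu> (x n)) (u n))" and disj: "disjointly_supported {..<N} u"
    by (rule escaping_disjoint_bumps[OF esc M c \<epsilon>2, where N=N]) blast
  define \<delta> where "\<delta> = \<epsilon> / (2 * (M + 1))"
  have \<delta>: "\<delta> > 0" "M * \<delta> \<le> \<epsilon> / 2" using \<epsilon> M0 by (auto simp: \<delta>_def field_simps)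
  note \<theta> = plateau_props[OF \<delta>(1)]
  let ?g = "\<lambda>i. shrink \<delta> (u i)"
  let ?Z = "\<lambda>i. Z \<union> {z. apply_bcontfun (?g i) z \<noteq> 0}"
  have "\<exists>i<N. escapes \<mu> (?Z i) (c - \<epsilon>)"
  proof (rule ccontr)
    assume "\<not> ?thesis"
    then have no: "\<not> escapes \<mu> (?Z i) (c - \<epsilon>)" if "i < N" for i using that by blast
    have "\<exists>S C. i < N \<longrightarrow> finite S \<and> 0 \<le> C \<and> \<not> (\<exists>x f. (\<forall>z\<in>?Z i. apply_bcontfun f z = 0) \<and> norm f \<le> 1 \<and>
        c - \<epsilon> + C * (\<Sum>y\<in>S. sq_variation (\<mu> y) f) < norm (ev (\<mu> x) f))" for i
      using no[of i] unfolding escapes_def by meson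
    then obtain S C where SC': "\<And>i. i < N \<longrightarrow> finite (S i) \<and> 0 \<le> C i \<and> \<not> (\<exists>x f. (\<forall>z\<in>?Z i. apply_bcontfun f z = 0) \<and> norm f \<le> 1 \<and>
        c - \<epsilon> + C i * (\<Sum>y\<in>S i. sq_variation (\<mu> y) f) < norm (ev (\<mu> x) f))"
      by metis
    have SC: "finite (S i)" "0 \<le> C i" if "i < N" for i
      using SC'[of i] that by auto
    have SC3: "norm (ev (\<mu> x) f) \<le> c - \<epsilon> + C i * (\<Sum>y\<in>S i. sq_variation (\<mu> y) f)"
      if "i < N" "\<And>z. z \<in> ?Z i \<Longrightarrow> apply_bcontfun f z = 0" "norm f \<le> 1" for i x f
      using SC'[of i] that by (meson not_less)
    define S0 C0 where "S0 = (\<Union>i<N. S i)" and "C0 = (\<Sum>i<N. C i)"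
    have "finite S0" using SC by (auto simp: S0_def)
    have "0 \<le> C0" unfolding C0_def by (intro sum_nonneg) (use SC in auto)
    obtain y and f :: "'a \<Rightarrow>\<^sub>C 'k" where f: "\<forall>z\<in>Z. apply_bcontfun f z = 0" "norm f \<le> 1"
      "c + C0 * (\<Sum>y\<in>S0. sq_variation (\<mu> y) f) < norm (ev (\<mu> y) f)"
      using esc[unfolded escapes_def, rule_format, OF \<open>finite S0\<close> \<open>0 \<le> C0\<close>] by blast
    define v where "v i = pointwise_scale (plateau \<delta> (u i)) f" for i
    have v: "apply_bcontfun (v i) z = plateau \<delta> (u i) z *\<^sub>R apply_bcontfun f z" for i z
      unfolding v_def by (rule pointwise_scale_apply) (rule \<theta>)+
    have v_le: "norm (apply_bcontfun (v i) z) \<le> norm (apply_bcontfun f z)" for i z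
      using \<theta>(2,3)[of "u i" z] by (simp add: v mult_left_le_one_le)
    have fv: "apply_bcontfun (f - v i) z = (1 - plateau \<delta> (u i) z) *\<^sub>R apply_bcontfun f z" for i z
      by (simp add: v scaleR_left_diff_distrib)
    have fv_le: "norm (apply_bcontfun (f - v i) z) \<le> norm (apply_bcontfun f z)" for i z
      unfolding fv using \<theta>(2,3)[of "u i" z] by (simp add: mult_left_le_one_le)
    have v1: "norm (v i) \<le> 1" for i
      by (rule norm_bound) (use v_le f(2) norm_bounded in \<open>meson order_trans\<close>)
    have fv1: "norm (f - v i) \<le> 1" for i
      by (rule norm_bound) (use fv_le f(2) norm_bounded in \<open>meson order_trans\<close>)
    have big: "\<epsilon> < norm (ev (\<mu> y) (v i))" if i: "i < N" for i
    proof -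
      have "norm (ev (\<mu> y) (f - v i)) \<le> c - \<epsilon> + C i * (\<Sum>y\<in>S i. sq_variation (\<mu> y) (f - v i))"
      proof (rule SC3[OF i _ fv1])
        fix z assume "z \<in> ?Z i"
        then consider "z \<in> Z" | "apply_bcontfun (?g i) z \<noteq> 0" by blast
        then show "apply_bcontfun (f - v i) z = 0"
        proof cases
          case 1 then show ?thesis using f(1) unfolding fv by simp
        next
          case 2
          then have "\<delta> \<le> norm (apply_bcontfun (u i) z)" using shrink_eq_0[OF \<delta>(1)] by (meson linear)
          then show ?thesis unfolding fv by (simp add: \<theta>)
        qed
      qed
      also have "C i * (\<Sum>y\<in>S i. sq_variation (\<mu> y) (f - v i)) \<le> C0 * (\<Sum>y\<in>S0. sq_variation (\<mu> y) f)"
      proof (rule mult_mono)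
        show "C i \<le> C0" unfolding C0_def by (rule member_le_sum) (use i SC in auto)
        have "(\<Sum>y\<in>S i. sq_variation (\<mu> y) (f - v i)) \<le> (\<Sum>y\<in>S i. sq_variation (\<mu> y) f)"
          by (intro sum_mono sq_variation_mono fv_le)
        also have "\<dots> \<le> (\<Sum>y\<in>S0. sq_variation (\<mu> y) f)"
          by (rule sum_mono2) (use i \<open>finite S0\<close> sq_variation_nonneg in \<open>auto simp: S0_def\<close>)
        finally show "(\<Sum>y\<in>S i. sq_variation (\<mu> y) (f - v i)) \<le> (\<Sum>y\<in>S0. sq_variation (\<mu> y) f)" .
      qed (use \<open>0 \<le> C0\<close> in \<open>auto intro!: sum_nonneg sq_variation_nonneg\<close>)
      finally have "norm (ev (\<mu> y) (f - v i)) \<le> c - \<epsilon> + C0 * (\<Sum>y\<in>S0. sq_variation (\<mu> y) f)" by simp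
      moreover have "norm (ev (\<mu> y) f) \<le> norm (ev (\<mu> y) (f - v i)) + norm (ev (\<mu> y) (v i))"
        using norm_triangle_ineq[of "ev (\<mu> y) (f - v i)" "ev (\<mu> y) (v i)"] by (simp add: ev_simps)
      ultimately show ?thesis using f(3) by linarith
    qed
    have "disjointly_supported {..<N} v"
      using disj \<theta>(6) unfolding disjointly_supported_def v by (metis scaleR_zero_left)
    then have "(\<Sum>i<N. norm (ev (\<mu> y) (v i))) \<le> norm (\<mu> y)"
      by (intro disjoint_evaluation_sum v1) auto
    moreover have "real N * \<epsilon> \<le> (\<Sum>i<N. norm (ev (\<mu> y) (v i)))"
      using sum_bounded_below[of "{..<N}" \<epsilon> "\<lambda>i. norm (ev (\<mu> y) (v i))"] big by (simp add: less_imp_le)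
    ultimately have "real N * \<epsilon> \<le> M" using M[of y] by linarith
    then show False using N \<epsilon> by (simp add: field_simps)
  qed
  then obtain i where i: "i < N" "escapes \<mu> (?Z i) (c - \<epsilon>)" by blast
  show ?thesis
  proof (rule that[of "?Z i" "?g i" "x i"])
    show "apply_bcontfun (?g i) z = 0" if "z \<in> Z" for z
      using norm_shrink_apply_le[OF \<delta>(1), of "u i" z] u(1)[OF that] by simp
    show "norm (?g i) \<le> 1" using norm_shrink_le[OF \<delta>(1), of "u i"] u(2)[of i] by linarith
    have "norm (ev (\<mu> (x i)) (u i - ?g i)) \<le> M * \<delta>"
      using norm_ev_le[of "\<mu> (x i)" "u i - ?g i"]
        mult_mono[OF M[of "x i"] norm_diff_shrink_le[OF \<delta>(1), of "u i"] M0] by simp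
    moreover have "norm (ev (\<mu> (x i)) (u i)) \<le> norm (ev (\<mu> (x i)) (u i - ?g i)) + norm (ev (\<mu> (x i)) (?g i))"
      using norm_triangle_ineq[of "ev (\<mu> (x i)) (u i - ?g i)" "ev (\<mu> (x i)) (?g i)"] by (simp add: ev_simps)
    ultimately show "c - \<epsilon> < norm (ev (\<mu> (x i)) (?g i))" using u(3)[OF i(1)] \<delta>(2) by linarith
  qed (use i in auto)
qed

text \<open>Iterating the previous step with losses that add up to less than \<open>c - c'\<close>.\<close>

lemma escapes_disjoint_sequence:
  fixes \<mu> :: "'i \<Rightarrow> ('a::topological_space, 'k::real_normed_field) ck_dual"
  assumes esc: "escapes \<mu> {} c" and M: "\<And>x. norm (\<mu> x) \<le> M" and c: "0 \<le> c'" "c' < c"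
  obtains x :: "nat \<Rightarrow> 'i" and g :: "nat \<Rightarrow> 'a \<Rightarrow>\<^sub>C 'k" where "\<And>n. norm (g n) \<le> 1" "disjointly_supported UNIV g"
    "\<And>n. c' < norm (ev (\<mu> (x n)) (g n))"
proof -
  define e where "e n = (c - c') * (1 / 2) ^ Suc n" for n :: nat
  have e: "e n > 0" "e n = 2 * e (Suc n)" for n using c by (simp_all add: e_def)
  define P where "P n s \<longleftrightarrow> (case s of (x, g, Z) \<Rightarrow> norm g \<le> 1 \<and> (\<forall>z. z \<notin> Z \<longrightarrow> apply_bcontfun g z = 0) \<and>
      c' < norm (ev (\<mu> x) g) \<and> escapes \<mu> Z (c' + e n))" for n and s :: "'i \<times> ('a \<Rightarrow>\<^sub>C 'k) \<times> 'a set"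
  define Q where "Q s s' \<longleftrightarrow> (case s of (x, g, Z) \<Rightarrow> case s' of (x', g', Z') \<Rightarrow> Z \<subseteq> Z' \<and> (\<forall>z\<in>Z. apply_bcontfun g' z = 0))"
    for s s' :: "'i \<times> ('a \<Rightarrow>\<^sub>C 'k) \<times> 'a set"
  have "\<exists>s. \<forall>n. P n (s n) \<and> Q (s n) (s (Suc n))"
  proof (rule dependent_nat_choice)
    have c0: "0 \<le> c" using c by simp
    obtain x and g :: "'a \<Rightarrow>\<^sub>C 'k" and Z' where "norm g \<le> 1" "\<And>z. z \<notin> Z' \<Longrightarrow> apply_bcontfun g z = 0"
      "c - e 0 < norm (ev (\<mu> x) g)" "escapes \<mu> Z' (c - e 0)"
      by (rule escapes_step[OF esc M c0 e(1)[of 0]]) blast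
    moreover have "c - e 0 = c' + e 0" by (simp add: e_def field_simps)
    ultimately show "\<exists>s. P 0 s"
      using e(1)[of 0] by (intro exI[of _ "(x, g, Z')"]) (auto simp: P_def)
  next
    fix s n assume "P n s"
    then obtain x g Z where s: "s = (x, g, Z)" "escapes \<mu> Z (c' + e n)" by (cases s) (auto simp: P_def)
    have nonneg: "0 \<le> c' + e n" using c e(1)[of n] by simp
    obtain x' and g' :: "'a \<Rightarrow>\<^sub>C 'k" and Z' where "Z \<subseteq> Z'" "\<And>z. z \<in> Z \<Longrightarrow> apply_bcontfun g' z = 0" "norm g' \<le> 1"
      "\<And>z. z \<notin> Z' \<Longrightarrow> apply_bcontfun g' z = 0" "c' + e n - e (Suc n) < norm (ev (\<mu> x') g')"
      "escapes \<mu> Z' (c' + e n - e (Suc n))"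
      by (rule escapes_step[OF s(2) M nonneg e(1)[of "Suc n"]]) blast
    moreover have "c' + e n - e (Suc n) = c' + e (Suc n)" using e(2)[of n] by simp
    ultimately show "\<exists>s'. P (Suc n) s' \<and> Q s s'"
      using e(1)[of "Suc n"] s by (intro exI[of _ "(x', g', Z')"]) (auto simp: P_def Q_def)
  qed
  then obtain s where s: "\<And>n. P n (s n)" "\<And>n. Q (s n) (s (Suc n))" by blast
  define x g Z where "x n = fst (s n)" and "g n = fst (snd (s n))" and "Z n = snd (snd (s n))" for n
  have s_eq: "s n = (x n, g n, Z n)" for n by (simp add: x_def g_def Z_def)
  have P: "norm (g n) \<le> 1" "z \<notin> Z n \<Longrightarrow> apply_bcontfun (g n) z = 0" "c' < norm (ev (\<mu> (x n)) (g n))" for n z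
    using s(1)[of n] by (auto simp: P_def s_eq)
  have Q: "Z n \<subseteq> Z (Suc n)" "z \<in> Z n \<Longrightarrow> apply_bcontfun (g (Suc n)) z = 0" for n z
    using s(2)[of n] by (auto simp: Q_def s_eq)
  have zero: "apply_bcontfun (g m) z = 0 \<or> apply_bcontfun (g n) z = 0" if mn: "m < n" for m n z
  proof -
    obtain k where k: "n = Suc k" "m \<le> k" using mn by (cases n) auto
    have ZZ: "Z m \<subseteq> Z k" by (rule lift_Suc_mono_le[of Z, OF Q(1) k(2)])
    show ?thesis
    proof (cases "z \<in> Z m")
      case True
      then show ?thesis using Q(2)[of z k] ZZ k(1) by auto
    next
      case False
      then show ?thesis using P(2) by auto
    qed
  qed
  show ?thesis
    by (rule that[of g x]) (use P in \<open>auto simp: disjointly_supported_def\<close>, metis nat_neq_iff zero)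
qed

section \<open>Operators that factor through \<open>c\<^sub>0\<close>\<close>

lemma bounded_linear_ev: "bounded_linear (ev \<phi>)"
  by (rule blinfun.bounded_linear_right)

text \<open>Completeness of \<open>C(K)\<close> in the form of a Cauchy criterion, for an arbitrary topological space \<open>K\<close>.\<close>

lemma bcontfun_summable_Cauchy:
  fixes f :: "nat \<Rightarrow> 'a::topological_space \<Rightarrow>\<^sub>C 'b::{real_normed_vector,complete_space}"
  assumes cau: "\<And>e. e > 0 \<Longrightarrow> \<exists>N. \<forall>m\<ge>N. \<forall>n. norm (\<Sum>k\<in>{m..<n}. f k) < e"
  shows "summable f"
proof -
  define S where "S n = (\<Sum>k<n. f k)" for n
  have S_diff: "S n - S m = (\<Sum>k\<in>{m..<n}. f k)" if "m \<le> n" for m n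
    using that by (simp add: S_def sum_diff[symmetric] lessThan_minus_lessThan)
  have "\<exists>N. \<forall>m n x. N \<le> m \<and> N \<le> n \<and> True \<longrightarrow> dist (apply_bcontfun (S m) x) (apply_bcontfun (S n) x) < e" if e: "e > 0" for e
  proof -
    obtain N where N: "\<And>m n. m \<ge> N \<Longrightarrow> norm (\<Sum>k\<in>{m..<n}. f k) < e" using cau[OF e] by blast
    have "dist (S m) (S n) < e" if "N \<le> m" "N \<le> n" for m n
    proof (cases "m \<le> n")
      case True
      then show ?thesis using N[OF that(1), of n] unfolding dist_norm norm_minus_commute[of "S m"] by (simp add: S_diff)
    next
      case False
      then show ?thesis using N[OF that(2), of m] by (simp add: dist_norm S_diff)
    qed
    then show ?thesis using dist_fun_lt_imp_dist_val_lt by blast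
  qed
  then obtain g where "\<forall>e>0. \<exists>N. \<forall>n x. N \<le> n \<and> True \<longrightarrow> dist (apply_bcontfun (S n) x) (g x) < e"
    using uniformly_convergent_eq_cauchy[of "\<lambda>_. True" "\<lambda>n. apply_bcontfun (S n)"] by auto
  then have "uniform_limit UNIV (\<lambda>n. apply_bcontfun (S n)) g sequentially"
    unfolding uniform_limit_sequentially_iff by simp
  from uniform_limit_bcontfunE[OF this sequentially_bot]
  obtain l where "S \<longlonglongrightarrow> l" by metis
  then show ?thesis unfolding summable_iff_convergent S_def by (rule convergentI)
qed

lemma point_seminorm_hilbertian:
  fixes B :: real
  assumes B: "0 \<le> B"
  shows "hilbertian_seminorm (\<lambda>f :: 'a::topological_space \<Rightarrow>\<^sub>C 'k::{real_normed_field,euclidean_space}. B * norm (apply_bcontfun f y)) B"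
proof
  show "ck_seminorm (\<lambda>f :: 'a \<Rightarrow>\<^sub>C 'k. B * norm (apply_bcontfun f y))"
    using B by (auto simp: ck_seminorm_def norm_mult ring_distribs[symmetric] intro!: mult_left_mono norm_triangle_ineq)
  show "B * norm (apply_bcontfun f y) \<le> B * norm f" for f :: "'a \<Rightarrow>\<^sub>C 'k"
    by (intro mult_left_mono norm_bounded B)
  fix f g :: "'a \<Rightarrow>\<^sub>C 'k"
  let ?f = "apply_bcontfun f y" and ?g = "apply_bcontfun g y"
  have "(norm (?f + ?g))\<^sup>2 + (norm (?f - ?g))\<^sup>2 = 2 * (norm ?f)\<^sup>2 + 2 * (norm ?g)\<^sup>2"
    by (simp add: power2_norm_eq_inner inner_add_left inner_add_right inner_diff_left inner_diff_right algebra_simps)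
  then have "B\<^sup>2 * ((norm (?f + ?g))\<^sup>2 + (norm (?f - ?g))\<^sup>2) = B\<^sup>2 * (2 * (norm ?f)\<^sup>2 + 2 * (norm ?g)\<^sup>2)" by simp
  then show "(B * norm (apply_bcontfun (f + g) y))\<^sup>2 + (B * norm (apply_bcontfun (f - g) y))\<^sup>2
      \<le> 2 * (B * norm ?f)\<^sup>2 + 2 * (B * norm ?g)\<^sup>2"
    by (simp add: power_mult_distrib algebra_simps)
qed

text \<open>The hypothesis \<open>bound\<close> says that \<open>(a\<^sub>k) \<mapsto> \<Sum>k. a\<^sub>k q\<^sub>k\<close> is an operator of norm at most \<open>B\<close> from \<open>c\<^sub>0\<close> to \<open>C(K)\<close>. It
  is composed below with the operator \<open>g \<mapsto> (g x\<^sub>k - g x\<^sub>\<infinity>)\<^sub>k\<close> from \<open>C(K)\<close> to \<open>c\<^sub>0\<close>, which may have norm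
  \<open>2\<close>.\<close>

locale difference_series =
  fixes x :: "nat \<Rightarrow> 'a::topological_space" and x0 :: 'a
    and q :: "nat \<Rightarrow> 'a \<Rightarrow>\<^sub>C 'k::{real_normed_field,euclidean_space}" and B :: real
  assumes conv: "x \<longlonglongrightarrow> x0"
    and B: "0 \<le> B"
    and bound: "\<And>F a r. finite F \<Longrightarrow> 0 \<le> r \<Longrightarrow> (\<And>k. k \<in> F \<Longrightarrow> norm (a k) \<le> r) \<Longrightarrow>
      norm (\<Sum>k\<in>F. ck_scale (a k) (q k)) \<le> B * r"
begin

lemma null_summable:
  assumes a: "a \<longlonglongrightarrow> 0"
  shows "summable (\<lambda>k. ck_scale (a k) (q k))"
proof (rule bcontfun_summable_Cauchy)
  fix e :: real assume e: "e > 0"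
  define r where "r = e / (B + 1)"
  have r: "r > 0" "B * r < e" using e B by (auto simp: r_def field_simps)
  obtain N where N: "\<And>n. n \<ge> N \<Longrightarrow> norm (a n) < r"
    using LIMSEQ_D[OF a r(1)] by auto
  show "\<exists>N. \<forall>m\<ge>N. \<forall>n. norm (\<Sum>k\<in>{m..<n}. ck_scale (a k) (q k)) < e"
  proof (intro exI allI impI)
    fix m n assume "N \<le> m"
    then have "norm (\<Sum>k\<in>{m..<n}. ck_scale (a k) (q k)) \<le> B * r"
      using N r by (intro bound) (auto intro!: less_imp_le)
    then show "norm (\<Sum>k\<in>{m..<n}. ck_scale (a k) (q k)) < e" using r by simp
  qed
qed

lemma norm_null_series_le:
  assumes a: "a \<longlonglongrightarrow> 0" and r: "\<And>k. norm (a k) \<le> r" "0 \<le> r"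
  shows "norm (\<Sum>k. ck_scale (a k) (q k)) \<le> B * r"
proof (rule LIMSEQ_le_const2)
  show "(\<lambda>n. norm (\<Sum>k<n. ck_scale (a k) (q k))) \<longlonglongrightarrow> norm (\<Sum>k. ck_scale (a k) (q k))"
    by (intro tendsto_norm summable_LIMSEQ null_summable a)
  show "\<exists>N. \<forall>n\<ge>N. norm (\<Sum>k<n. ck_scale (a k) (q k)) \<le> B * r"
    using bound r by blast
qed

definition differences :: "('a \<Rightarrow>\<^sub>C 'k) \<Rightarrow> nat \<Rightarrow> 'k" where
  "differences g k = apply_bcontfun g (x k) - apply_bcontfun g x0"

lemma differences_null: "differences g \<longlonglongrightarrow> 0"
proof -
  have "(\<lambda>k. apply_bcontfun g (x k)) \<longlonglongrightarrow> apply_bcontfun g x0"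
    by (rule continuous_on_tendsto_compose[OF continuous_on_apply_bcontfun[of UNIV g] conv]) auto
  then show ?thesis unfolding differences_def by (rule LIM_zero)
qed

lemma norm_differences_le: "norm (differences g k) \<le> 2 * norm g"
  using norm_triangle_ineq4[of "apply_bcontfun g (x k)" "apply_bcontfun g x0"] norm_bounded[of g "x k"] norm_bounded[of g x0]
  by (simp add: differences_def)

definition series_operator :: "('a \<Rightarrow>\<^sub>C 'k) \<Rightarrow>\<^sub>L ('a \<Rightarrow>\<^sub>C 'k)" where
  "series_operator = Blinfun (\<lambda>g. \<Sum>k. ck_scale (differences g k) (q k))"

lemma series_operator_apply: "blinfun_apply series_operator g = (\<Sum>k. ck_scale (differences g k) (q k))"
proof -
  have bl: "bounded_linear (\<lambda>g. \<Sum>k. ck_scale (differences g k) (q k))"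
  proof (rule bounded_linear_intro)
    fix f g :: "'a \<Rightarrow>\<^sub>C 'k" and r :: real
    have "(\<Sum>k. ck_scale (differences f k) (q k)) + (\<Sum>k. ck_scale (differences g k) (q k)) =
        (\<Sum>k. ck_scale (differences f k) (q k) + ck_scale (differences g k) (q k))"
      by (intro suminf_add null_summable differences_null)
    also have "\<dots> = (\<Sum>k. ck_scale (differences (f + g) k) (q k))"
      by (simp add: ck_scale_algebra(2)[symmetric] differences_def algebra_simps)
    finally show "(\<Sum>k. ck_scale (differences (f + g) k) (q k)) =
        (\<Sum>k. ck_scale (differences f k) (q k)) + (\<Sum>k. ck_scale (differences g k) (q k))" ..
    have "r *\<^sub>R (\<Sum>k. ck_scale (differences f k) (q k)) = (\<Sum>k. r *\<^sub>R ck_scale (differences f k) (q k))"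
      by (intro bounded_linear.suminf[OF bounded_linear_scaleR_right] null_summable differences_null)
    also have "\<dots> = (\<Sum>k. ck_scale (differences (r *\<^sub>R f) k) (q k))"
      by (intro arg_cong[of _ _ suminf] ext)
        (simp add: ck_scale_algebra(3,6)[symmetric] differences_def right_diff_distrib scaleR_conv_of_real)
    finally show "(\<Sum>k. ck_scale (differences (r *\<^sub>R f) k) (q k)) = r *\<^sub>R (\<Sum>k. ck_scale (differences f k) (q k))" ..
    have "norm (\<Sum>k. ck_scale (differences f k) (q k)) \<le> B * (2 * norm f)"
      by (intro norm_null_series_le differences_null norm_differences_le) simp
    then show "norm (\<Sum>k. ck_scale (differences f k) (q k)) \<le> norm f * (B * 2)" by (simp add: ac_simps)
  qed
  show ?thesis by (simp add: series_operator_def bounded_linear_Blinfun_apply[OF bl])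
qed

lemma series_operator_sums: "(\<lambda>k. ck_scale (differences g k) (q k)) sums blinfun_apply series_operator g"
  unfolding series_operator_apply by (intro summable_sums null_summable differences_null)

lemma bounded_linear_ck_scale: "bounded_linear (ck_scale c)"
  by (rule bounded_linear_intro[where K="norm c"])
    (auto simp: ck_scale_algebra norm_ck_scale mult.commute intro!: bcontfun_eqI)

lemma series_operator_in_operators: "series_operator \<in> operators ck_scale"
  unfolding klinear_maps_def
proof (intro CollectI allI)
  fix c and g :: "'a \<Rightarrow>\<^sub>C 'k"
  have "(\<lambda>k. ck_scale c (ck_scale (differences g k) (q k))) sums ck_scale c (blinfun_apply series_operator g)"
    by (rule bounded_linear.sums[OF bounded_linear_ck_scale series_operator_sums])
  moreover have "ck_scale c (ck_scale (differences g k) (q k)) = ck_scale (differences (ck_scale c g) k) (q k)" for k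
    by (simp add: ck_scale_algebra(3)[symmetric] differences_def right_diff_distrib)
  ultimately have "(\<lambda>k. ck_scale (differences (ck_scale c g) k) (q k)) sums ck_scale c (blinfun_apply series_operator g)"
    by simp
  then show "blinfun_apply series_operator (ck_scale c g) = ck_scale c (blinfun_apply series_operator g)"
    using series_operator_sums sums_unique2 by blast
qed

lemma evaluation_sum_le:
  assumes "finite F"
  shows "(\<Sum>k\<in>F. norm (ev \<phi> (q k))) \<le> B * norm \<phi>"
proof -
  have "\<exists>a. norm a = 1 \<and> a * ev \<phi> (q k) = of_real (norm (ev \<phi> (q k)))" for k
    using norm_rotation by metis
  then obtain a where a: "\<And>k. norm (a k) = 1" "\<And>k. a k * ev \<phi> (q k) = of_real (norm (ev \<phi> (q k)))" by metis
  have "ev \<phi> (\<Sum>k\<in>F. ck_scale (a k) (q k)) = of_real (\<Sum>k\<in>F. norm (ev \<phi> (q k)))"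
    by (simp add: blinfun.sum_right ev_simps a)
  then have "(\<Sum>k\<in>F. norm (ev \<phi> (q k))) = norm (ev \<phi> (\<Sum>k\<in>F. ck_scale (a k) (q k)))"
    by (simp add: sum_nonneg del: of_real_sum)
  also have "\<dots> \<le> norm \<phi> * norm (\<Sum>k\<in>F. ck_scale (a k) (q k))" by (rule norm_ev_le)
  also have "\<dots> \<le> norm \<phi> * (B * 1)"
    by (intro mult_left_mono bound assms) (auto simp: a)
  finally show ?thesis by (simp add: mult.commute)
qed

lemma evaluation_summable: "summable (\<lambda>k. norm (ev \<phi> (q k)))"
  by (rule summableI_nonneg_bounded[where x="B * norm \<phi>"]) (simp_all add: evaluation_sum_le)

lemma evaluation_suminf_le: "(\<Sum>k. norm (ev \<phi> (q k))) \<le> B * norm \<phi>"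
  by (rule suminf_le_const[OF evaluation_summable]) (simp add: evaluation_sum_le)

text \<open>Subtracting the rank one operator \<open>\<phi> \<mapsto> - (\<Sum>k. \<phi> q\<^sub>k) \<delta>(x\<^sub>\<infinity>)\<close> from the adjoint leaves \<open>\<phi> \<mapsto> \<Sum>k. \<phi> q\<^sub>k \<delta>(x\<^sub>k)\<close>, of
  norm at most \<open>B\<close>. The rank one operator is in general not the adjoint of an operator on \<open>C(K)\<close>.\<close>

lemma dual_weak_essential_norm_series_operator: "dual_weak_essential_norm series_operator \<le> B"
proof -
  interpret hilbertian_seminorm "\<lambda>f :: 'a \<Rightarrow>\<^sub>C 'k. B * norm (apply_bcontfun f x0)" B
    by (rule point_seminorm_hilbertian[OF B])
  have summ: "summable (\<lambda>k. ev \<phi> (q k))" for \<phi> by (rule summable_norm_cancel[OF evaluation_summable])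
  have suml: "norm (\<Sum>k. ev \<phi> (q k)) \<le> B * norm \<phi>" for \<phi>
    using summable_norm[OF evaluation_summable[of \<phi>]] evaluation_suminf_le[of \<phi>] by linarith
  define b where "b \<phi> f = - ((\<Sum>k. ev \<phi> (q k)) * apply_bcontfun f x0)" for \<phi> f
  have b_le: "norm (b \<phi> f) \<le> norm \<phi> * (B * norm (apply_bcontfun f x0))" for \<phi> f
    using mult_right_mono[OF suml[of \<phi>] norm_ge_zero[of "apply_bcontfun f x0"]]
    by (simp add: b_def norm_mult ac_simps)
  obtain W where W: "W \<in> operators ck_dual_scale" "\<And>\<phi> f. ev (blinfun_apply W \<phi>) f = b \<phi> f"
  proof (rule dual_operator_construct[of b B])
    show "b (\<phi> + \<psi>) f = b \<phi> f + b \<psi> f" for \<phi> \<psi> f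
      by (simp add: b_def ev_simps suminf_add[OF summ summ, symmetric] algebra_simps)
    show "b (ck_dual_scale c \<phi>) f = c * b \<phi> f" for c \<phi> f
      by (simp add: b_def ev_simps suminf_mult[OF summ] algebra_simps)
    show "norm (b \<phi> f) \<le> B * norm \<phi> * norm f" for \<phi> f
    proof -
      have "norm \<phi> * (B * norm (apply_bcontfun f x0)) \<le> norm \<phi> * (B * norm f)"
        by (intro mult_left_mono norm_bounded B) simp
      then show ?thesis using b_le[of \<phi> f] by (simp add: ac_simps)
    qed
  qed (auto simp: b_def algebra_simps)
  have "W \<in> weakly_compact_operators ck_dual_scale"
    by (rule dominated_weakly_compact[OF W(1)]) (simp add: W(2) b_le)
  then show ?thesis
  proof (rule dual_weak_essential_norm_le[OF series_operator_in_operators _ _ B])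
    fix \<phi> :: "('a, 'k) ck_dual" and f
    have le: "norm (apply_bcontfun f (x k) * ev \<phi> (q k)) \<le> norm f * norm (ev \<phi> (q k))" for k
      by (simp add: norm_mult mult_right_mono norm_bounded)
    have s2: "summable (\<lambda>k. norm f * norm (ev \<phi> (q k)))" by (intro summable_mult evaluation_summable)
    have "(\<lambda>k. ev \<phi> (ck_scale (differences f k) (q k))) sums ev \<phi> (blinfun_apply series_operator f)"
      by (rule bounded_linear.sums[OF bounded_linear_ev series_operator_sums])
    moreover have "(\<lambda>k. ev \<phi> (q k) * apply_bcontfun f x0) sums ((\<Sum>k. ev \<phi> (q k)) * apply_bcontfun f x0)"
      by (intro sums_mult2 summable_sums summ)
    ultimately have "(\<lambda>k. ev \<phi> (ck_scale (differences f k) (q k)) + ev \<phi> (q k) * apply_bcontfun f x0)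
        sums (ev \<phi> (blinfun_apply series_operator f) + (\<Sum>k. ev \<phi> (q k)) * apply_bcontfun f x0)"
      by (rule sums_add)
    then have s: "(\<lambda>k. apply_bcontfun f (x k) * ev \<phi> (q k)) sums (ev \<phi> (blinfun_apply series_operator f) - ev (blinfun_apply W \<phi>) f)"
      by (simp add: ev_simps differences_def W(2) b_def algebra_simps)
    have "norm (ev \<phi> (blinfun_apply series_operator f) - ev (blinfun_apply W \<phi>) f) \<le> (\<Sum>k. norm f * norm (ev \<phi> (q k)))"
      unfolding sums_unique[OF s] by (rule norm_suminf_le[OF le s2])
    also have "\<dots> = norm f * (\<Sum>k. norm (ev \<phi> (q k)))" by (rule suminf_mult[OF evaluation_summable])
    also have "\<dots> \<le> norm f * (B * norm \<phi>)" by (intro mult_left_mono evaluation_suminf_le) simp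
    finally show "norm (ev \<phi> (blinfun_apply series_operator f) - ev (blinfun_apply W \<phi>) f) \<le> norm \<phi> * (B * norm f)"
      by (simp add: ac_simps)
  qed
qed

end

lemma klinear_compose: "S \<in> operators s \<Longrightarrow> T \<in> operators s \<Longrightarrow> S o\<^sub>L T \<in> operators s"
  by (simp add: klinear_maps_def)

text \<open>Under these conditions \<open>g \<mapsto> \<Sum>k. (g x\<^sub>k - g x\<^sub>\<infinity>) h\<^sub>k\<close> is a projection onto a copy of \<open>c\<^sub>0\<close>.\<close>

locale biorthogonal_bumps =
  fixes x :: "nat \<Rightarrow> 'a::topological_space" and x0 :: 'a
    and h :: "nat \<Rightarrow> 'a \<Rightarrow>\<^sub>C 'k::{real_normed_field,euclidean_space}"
  assumes x_conv: "x \<longlonglongrightarrow> x0"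
    and h_disjoint: "disjointly_supported UNIV h" and h_norm: "\<And>k. norm (h k) \<le> 1"
    and h_x: "\<And>k j. apply_bcontfun (h k) (x j) = (if k = j then 1 else 0)"
    and h_x0: "\<And>k. apply_bcontfun (h k) x0 = 0"
begin

lemma disjoint_difference_series:
  fixes f :: "nat \<Rightarrow> 'a \<Rightarrow>\<^sub>C 'k"
  assumes f: "disjointly_supported UNIV f" "\<And>k. norm (f k) \<le> 1"
  shows "difference_series x x0 f 1"
proof
  fix F :: "nat set" and a :: "nat \<Rightarrow> 'k" and r :: real
  assume "finite F" "0 \<le> r" "\<And>k. k \<in> F \<Longrightarrow> norm (a k) \<le> r"
  moreover have "disjointly_supported F f" using f by (auto simp: disjointly_supported_def)
  ultimately show "norm (\<Sum>k\<in>F. ck_scale (a k) (f k)) \<le> 1 * r"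
    using f disjoint_combination_norm[of F f a r] by simp
qed (simp_all add: x_conv)

sublocale H: difference_series x x0 h 1
  by (rule disjoint_difference_series[OF h_disjoint h_norm])

abbreviation projection where "projection \<equiv> H.series_operator"

lemma differences_h: "H.differences (h k) j = (if k = j then 1 else 0)"
  by (simp add: H.differences_def h_x h_x0)

lemma projection_h: "projection (h k) = h k"
proof -
  have "(\<lambda>j. ck_scale (H.differences (h k) j) (h j)) = (\<lambda>j. if j = k then h j else 0)"
    by (auto simp: differences_h ck_scale_algebra intro!: bcontfun_eqI)
  then have "(\<lambda>j. ck_scale (H.differences (h k) j) (h j)) sums h k"
    by (simp add: sums_single)
  then show ?thesis using H.series_operator_sums sums_unique2 by blast
qed

lemma projection_idempotent: "projection o\<^sub>L projection = projection"
proof (rule blinfun_eqI)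
  fix g
  have "(\<lambda>k. projection (ck_scale (H.differences g k) (h k))) sums projection (blinfun_apply projection g)"
    by (rule bounded_linear.sums[OF blinfun.bounded_linear_right H.series_operator_sums])
  moreover have "projection (ck_scale c (h k)) = ck_scale c (h k)" for c k
    using H.series_operator_in_operators by (simp add: klinear_maps_def projection_h)
  ultimately have "projection (blinfun_apply projection g) = blinfun_apply projection g"
    using H.series_operator_sums[of g] sums_unique2 by auto
  then show "blinfun_apply (projection o\<^sub>L projection) g = blinfun_apply projection g" by simp
qed

text \<open>The partial sums of \<open>\<Sum>k. h\<^sub>k\<close> are fixed by the projection. A weak cluster point of them would be a continuous
  function with value \<open>1\<close> at every \<open>x\<^sub>k\<close> and value \<open>0\<close> at the limit point.\<close>

lemma projection_not_weakly_compact: "projection \<notin> weakly_compact_operators ck_scale"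
proof
  assume "projection \<in> weakly_compact_operators ck_scale"
  let ?W = "weak_topology ck_scale :: ('a \<Rightarrow>\<^sub>C 'k) topology"
  define C where "C = ?W closure_of (blinfun_apply projection ` cball 0 1)"
  have C: "compactin ?W C"
    using \<open>projection \<in> weakly_compact_operators ck_scale\<close> by (simp add: weakly_compact_operators_def C_def)
  have op: "openin ?W {g. apply_bcontfun g y \<in> U}" if "open U" for y U
  proof -
    have "openin ?W (blinfun_apply (ck_functional (point_mass y)) -` U)"
      unfolding weak_topology_def by (rule topology_generated_by_Basis) (use that ck_functional in blast)
    then show ?thesis by (simp add: vimage_def ev_point_mass)
  qed
  \<comment> \<open>A continuous function cannot be \<open>0\<close> at the limit point and close to \<open>1\<close> at all \<open>x k\<close>,
    so these open sets cover; finitely many of them miss a long partial sum.\<close>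
  define cov :: "nat \<Rightarrow> ('a \<Rightarrow>\<^sub>C 'k) set" where "cov n = (case n of 0 \<Rightarrow> {g. apply_bcontfun g x0 \<in> - {0}} | Suc k \<Rightarrow> {g. apply_bcontfun g (x k) \<in> - cball 1 (1/2)})"
    for n :: nat
  have cov_open: "openin ?W (cov n)" for n
    unfolding cov_def by (cases n) (auto intro!: op simp del: Compl_iff)
  have cover: "C \<subseteq> \<Union>(range cov)"
  proof
    fix g :: "'a \<Rightarrow>\<^sub>C 'k"
    show "g \<in> \<Union>(range cov)"
    proof (cases "apply_bcontfun g x0 = 0")
      case True
      then have "(\<lambda>k. apply_bcontfun g (x k)) \<longlonglongrightarrow> 0"
        using H.differences_null[of g] by (simp add: H.differences_def[abs_def])
      then obtain k where "norm (apply_bcontfun g (x k)) < 1/2"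
        using LIMSEQ_D[of _ 0 "1/2"] by force
      then have "1/2 < dist 1 (apply_bcontfun g (x k))"
        using norm_triangle_ineq2[of 1 "apply_bcontfun g (x k)"] by (simp add: dist_norm)
      then have "g \<in> cov (Suc k)" by (simp add: cov_def)
      then show ?thesis by blast
    next
      case False
      then have "g \<in> cov 0" by (simp add: cov_def)
      then show ?thesis by blast
    qed
  qed
  obtain \<F> where \<F>: "finite \<F>" "\<F> \<subseteq> range cov" "C \<subseteq> \<Union>\<F>"
    using compactinD[OF C _ cover] cov_open by blast
  then obtain I where I: "finite I" "\<F> = cov ` I" by (meson finite_subset_image)
  define n where "n = Max (insert 0 I)"
  have n: "i \<le> n" if "i \<in> I" for i using that I by (simp add: n_def)
  define u where "u = (\<Sum>k<Suc n. h k)"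
  have u_eq: "u = (\<Sum>k<Suc n. ck_scale 1 (h k))" by (simp add: u_def ck_scale_algebra)
  have "disjointly_supported {..<Suc n} h" using h_disjoint by (auto simp: disjointly_supported_def)
  then have "norm u \<le> 1" unfolding u_eq by (intro disjoint_combination_norm h_norm) auto
  moreover have "blinfun_apply projection u = u" by (simp add: u_def blinfun.sum_right blinfun.add_right projection_h)
  ultimately have "u \<in> blinfun_apply projection ` cball 0 1" by (intro image_eqI[of _ _ u]) auto
  then have "u \<in> C" unfolding C_def by (rule subsetD[OF closure_of_subset, rotated]) simp
  then obtain i where i: "i \<in> I" "u \<in> cov i" using \<F> I by blast
  have ux0: "apply_bcontfun u x0 = 0" unfolding u_def by (simp add: apply_bcontfun_sum h_x0)
  have uxk: "apply_bcontfun u (x k) = 1" if "k \<le> n" for k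
    using that unfolding u_def apply_bcontfun_sum h_x by (simp add: less_Suc_eq_le)
  show False
  proof (cases i)
    case 0
    then show ?thesis using i ux0 by (simp add: cov_def)
  next
    case (Suc k)
    then show ?thesis using i uxk[of k] n[OF i(1)] by (simp add: cov_def)
  qed
qed

text \<open>Here \<open>approx\<close> says that, through the two copies of \<open>c\<^sub>0\<close>, the operator \<open>T\<close> is within \<open>\<eta>\<close> of \<open>c\<close> times the
  identity. So \<open>c\<close> times the projection is \<open>T\<close> composed with two operators of dual weak essential norm at
  most \<open>1\<close>, plus a series operator whose dual weak essential norm is at most \<open>\<eta>\<close>.\<close>

lemma algebra_norm_ge:
  assumes N: "weak_calkin_algebra_norm N"
    and N_le: "\<And>T. T \<in> operators ck_scale \<Longrightarrow> N (weak_coset T) \<le> dual_weak_essential_norm T"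
    and T: "T \<in> operators ck_scale"
    and f: "disjointly_supported UNIV f" "\<And>k. norm (f k) \<le> 1"
    and c: "0 \<le> c" and \<eta>: "0 \<le> \<eta>"
    and approx: "\<And>F (a :: nat \<Rightarrow> 'k) r k. finite F \<Longrightarrow> 0 \<le> r \<Longrightarrow> (\<And>j. j \<in> F \<Longrightarrow> norm (a j) \<le> r) \<Longrightarrow>
      norm ((if k \<in> F then of_real c * a k else 0) - H.differences (T (\<Sum>j\<in>F. ck_scale (a j) (f j))) k) \<le> \<eta> * r"
  shows "c - \<eta> \<le> N (weak_coset T)"
proof -
  interpret F: difference_series x x0 f 1
    by (rule disjoint_difference_series[OF f])
  define q where "q k = ck_scale (of_real c) (h k) - projection (T (f k))" for k
  have P_lin: "projection (ck_scale d g) = ck_scale d (blinfun_apply projection g)"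
    and T_lin: "T (ck_scale d g) = ck_scale d (blinfun_apply T g)" for d g
    using H.series_operator_in_operators T by (simp_all add: klinear_maps_def)
  interpret Q: difference_series x x0 q \<eta>
  proof
    fix G :: "nat set" and a :: "nat \<Rightarrow> 'k" and r :: real assume G: "finite G" "0 \<le> r" "\<And>k. k \<in> G \<Longrightarrow> norm (a k) \<le> r"
    define u where "u = (\<Sum>j\<in>G. ck_scale (a j) (f j))"
    define b where "b k = (if k \<in> G then of_real c * a k else 0) - H.differences (T u) k" for k
    have fin: "(\<lambda>k. ck_scale (if k \<in> G then of_real c * a k else 0) (h k)) sums (\<Sum>k\<in>G. ck_scale (of_real c * a k) (h k))"
      using sums_If_finite_set[OF G(1), of "\<lambda>k. ck_scale (of_real c * a k) (h k)"]
      by (rule sums_cong[THEN iffD1, rotated]) (auto intro!: bcontfun_eqI)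
    have "(\<lambda>k. ck_scale (b k) (h k)) sums ((\<Sum>k\<in>G. ck_scale (of_real c * a k) (h k)) - projection (T u))"
      using sums_diff[OF fin H.series_operator_sums[of "T u"]]
      by (rule sums_cong[THEN iffD1, rotated]) (auto simp: b_def left_diff_distrib intro!: bcontfun_eqI)
    moreover have "(\<Sum>k\<in>G. ck_scale (of_real c * a k) (h k)) - projection (T u) = (\<Sum>k\<in>G. ck_scale (a k) (q k))"
      by (simp add: u_def q_def blinfun.sum_right T_lin P_lin ck_scale_algebra(4) sum_subtractf ck_scale_algebra(3)[symmetric] mult.commute)
    ultimately have eq: "(\<Sum>k. ck_scale (b k) (h k)) = (\<Sum>k\<in>G. ck_scale (a k) (q k))"
      by (simp add: sums_iff)
    have "(\<lambda>k. if k \<in> G then of_real c * a k else 0) \<longlonglongrightarrow> 0"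
    proof (rule tendsto_eventually)
      obtain m where m: "\<And>k. k \<in> G \<Longrightarrow> k < m" using G(1) finite_nat_set_iff_bounded[of G] by blast
      show "\<forall>\<^sub>F k in sequentially. (if k \<in> G then of_real c * a k else 0) = 0"
        by (rule eventually_sequentiallyI[of m]) (use m in force)
    qed
    then have b0: "b \<longlonglongrightarrow> 0"
      using tendsto_diff[OF _ H.differences_null[of "T u"]] unfolding b_def by fastforce
    have "norm (\<Sum>k. ck_scale (b k) (h k)) \<le> 1 * (\<eta> * r)"
    proof (rule H.norm_null_series_le[OF b0])
      show "norm (b k) \<le> \<eta> * r" for k unfolding b_def u_def by (rule approx) (use G in auto)
    qed (use \<eta> G(2) in simp)
    then show "norm (\<Sum>k\<in>G. ck_scale (a k) (q k)) \<le> \<eta> * r" by (simp add: eq)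
  qed (simp_all add: x_conv \<eta>)
  let ?P = projection and ?F = F.series_operator and ?Q = Q.series_operator
  have ops: "?P \<in> operators ck_scale" "?F \<in> operators ck_scale" "?Q \<in> operators ck_scale"
    by (rule H.series_operator_in_operators F.series_operator_in_operators Q.series_operator_in_operators)+
  have ident: "op_scale (of_real c) ?P = (?P o\<^sub>L (T o\<^sub>L ?F)) + ?Q"
  proof (rule blinfun_eqI)
    fix g
    have "(\<lambda>k. blinfun_apply (?P o\<^sub>L T) (ck_scale (H.differences g k) (f k))) sums blinfun_apply (?P o\<^sub>L T) (blinfun_apply ?F g)"
      using F.series_operator_sums[of g] by (rule bounded_linear.sums[OF blinfun.bounded_linear_right])
    then have "(\<lambda>k. blinfun_apply (?P o\<^sub>L T) (ck_scale (H.differences g k) (f k)) + ck_scale (H.differences g k) (q k)) sums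
        (blinfun_apply (?P o\<^sub>L T) (blinfun_apply ?F g) + blinfun_apply ?Q g)"
      using Q.series_operator_sums[of g] by (rule sums_add)
    moreover have "blinfun_apply (?P o\<^sub>L T) (ck_scale d (f k)) + ck_scale d (q k) = ck_scale (of_real c) (ck_scale d (h k))" for d k
      by (rule bcontfun_eqI) (simp add: P_lin T_lin q_def algebra_simps)
    ultimately have "(\<lambda>k. ck_scale (of_real c) (ck_scale (H.differences g k) (h k))) sums
        (blinfun_apply (?P o\<^sub>L T) (blinfun_apply ?F g) + blinfun_apply ?Q g)"
      by simp
    moreover have "(\<lambda>k. ck_scale (of_real c) (ck_scale (H.differences g k) (h k))) sums ck_scale (of_real c) (blinfun_apply ?P g)"
      by (rule bounded_linear.sums[OF H.bounded_linear_ck_scale H.series_operator_sums])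
    ultimately have "blinfun_apply (?P o\<^sub>L T) (blinfun_apply ?F g) + blinfun_apply ?Q g = ck_scale (of_real c) (blinfun_apply ?P g)"
      by (rule sums_unique2)
    then show "blinfun_apply (op_scale (of_real c) ?P) g = blinfun_apply ((?P o\<^sub>L (T o\<^sub>L ?F)) + ?Q) g"
      by (simp add: blinfun.add_left)
  qed
  have N0: "N (weak_coset S) \<ge> 0" and Nz: "N (weak_coset S) = 0 \<longleftrightarrow> weak_coset S = weak_coset 0"
    and Ns: "N (weak_coset (op_scale d S)) = norm d * N (weak_coset S)" if "S \<in> operators ck_scale" for S d
    using N that unfolding weak_calkin_algebra_norm_def by blast+
  have Nadd: "N (weak_coset (R + S)) \<le> N (weak_coset R) + N (weak_coset S)"
    and Nmul: "N (weak_coset (R o\<^sub>L S)) \<le> N (weak_coset R) * N (weak_coset S)"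
    if "R \<in> operators ck_scale" "S \<in> operators ck_scale" for R S
    using N that unfolding weak_calkin_algebra_norm_def by blast+
  have NP1: "1 \<le> N (weak_coset ?P)"
  proof -
    have zero: "(0 :: ('a \<Rightarrow>\<^sub>C 'k) \<Rightarrow>\<^sub>L ('a \<Rightarrow>\<^sub>C 'k)) \<in> weakly_compact_operators ck_scale"
      by (rule zero_weakly_compact) (simp add: ck_scale_algebra)
    have "weak_coset ?P \<noteq> weak_coset 0"
    proof
      assume eq: "weak_coset ?P = weak_coset 0"
      have "?P \<in> weak_coset ?P" using zero by (auto simp: weak_coset_def intro!: image_eqI[of _ _ 0])
      then have "?P \<in> weakly_compact_operators ck_scale" unfolding eq by (simp add: weak_coset_def)
      then show False using projection_not_weakly_compact by blast
    qed
    then have "N (weak_coset ?P) > 0" using N0[OF ops(1)] Nz[OF ops(1)] by linarith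
    moreover have "N (weak_coset ?P) \<le> N (weak_coset ?P) * N (weak_coset ?P)"
      using Nmul[OF ops(1) ops(1)] by (simp add: projection_idempotent)
    ultimately show ?thesis by simp
  qed
  have TF: "T o\<^sub>L ?F \<in> operators ck_scale" by (rule klinear_compose[OF T ops(2)])
  have "c * 1 \<le> c * N (weak_coset ?P)" by (rule mult_left_mono[OF NP1 c])
  also have "\<dots> = N (weak_coset (op_scale (of_real c) ?P))" using Ns[OF ops(1), of "of_real c"] c by simp
  also have "\<dots> \<le> N (weak_coset (?P o\<^sub>L (T o\<^sub>L ?F))) + N (weak_coset ?Q)"
    unfolding ident by (rule Nadd[OF klinear_compose[OF ops(1) TF] ops(3)])
  also have "\<dots> \<le> 1 * (N (weak_coset T) * 1) + \<eta>"
  proof (rule add_mono)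
    have P1: "N (weak_coset ?P) \<le> 1" "N (weak_coset ?F) \<le> 1"
      using N_le[OF ops(1)] H.dual_weak_essential_norm_series_operator N_le[OF ops(2)] F.dual_weak_essential_norm_series_operator
      by linarith+
    have "N (weak_coset (?P o\<^sub>L (T o\<^sub>L ?F))) \<le> N (weak_coset ?P) * N (weak_coset (T o\<^sub>L ?F))"
      by (rule Nmul[OF ops(1) TF])
    also have "\<dots> \<le> 1 * N (weak_coset (T o\<^sub>L ?F))" by (rule mult_right_mono[OF P1(1) N0[OF TF]])
    also have "\<dots> \<le> 1 * (N (weak_coset T) * N (weak_coset ?F))" using Nmul[OF T ops(2)] by simp
    also have "\<dots> \<le> 1 * (N (weak_coset T) * 1)" using mult_left_mono[OF P1(2) N0[OF T]] by simp
    finally show "N (weak_coset (?P o\<^sub>L (T o\<^sub>L ?F))) \<le> 1 * (N (weak_coset T) * 1)" .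
    show "N (weak_coset ?Q) \<le> \<eta>" using N_le[OF ops(3)] Q.dual_weak_essential_norm_series_operator by linarith
  qed
  finally show ?thesis by simp
qed

end

section \<open>Minimality\<close>

text \<open>Since rows and columns tend to zero, each index can be chosen so large that all entries that combine
  it with earlier indices are small. The bound for an entry with larger index \<open>n\<close> is of order \<open>2\<^sup>-\<^sup>n\<close>, so it holds
  in terms of the column index too, and the rows are summable.\<close>

lemma double_sequence_diagonalization:
  fixes a :: "nat \<Rightarrow> nat \<Rightarrow> 'k::real_normed_vector" and d :: "nat \<Rightarrow> 'l::real_normed_vector"
  assumes col: "\<And>j. (\<lambda>k. a k j) \<longlonglongrightarrow> 0" and row: "\<And>k. (\<lambda>j. a k j) \<longlonglongrightarrow> 0" and d: "d \<longlonglongrightarrow> 0"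
    and \<eta>: "\<eta> > 0"
  obtains r where "strict_mono r" "\<And>k. norm (d (r k)) \<le> \<eta>"
    "\<And>k j. k \<noteq> j \<Longrightarrow> norm (a (r k) (r j)) \<le> \<eta> * (1 / 2) ^ Suc j"
proof -
  define b where "b n = \<eta> * (1 / 2) ^ Suc n" for n :: nat
  have b: "b n > 0" for n using \<eta> by (simp add: b_def)
  have b_mono: "b m \<le> b n" if "n \<le> m" for m n
    unfolding b_def using \<eta> that by (intro mult_left_mono power_decreasing) auto
  define P where "P r n m \<longleftrightarrow> (\<forall>i<n. r i < m \<and> norm (a m (r i)) \<le> b n \<and> norm (a (r i) m) \<le> b n) \<and> norm (d m) \<le> \<eta>"
    for r :: "nat \<Rightarrow> nat" and n m
  have "\<exists>r. \<forall>n. P r n (r n)"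
  proof (rule dependent_wellorder_choice)
    show "P r n m = P r' n m" if "\<And>i. i < n \<Longrightarrow> r i = r' i" for m r r' n
      using that by (simp add: P_def)
    fix n and r :: "nat \<Rightarrow> nat"
    have small: "\<forall>\<^sub>F m in sequentially. norm (X m) \<le> e" if "X \<longlonglongrightarrow> 0" "e > 0" for X :: "nat \<Rightarrow> 'c::real_normed_vector" and e
      using tendstoD[OF that] by (rule eventually_mono) simp
    have "\<forall>\<^sub>F m in sequentially. \<forall>i\<in>{..<n}. r i < m \<and> norm (a m (r i)) \<le> b n \<and> norm (a (r i) m) \<le> b n"
      by (intro eventually_ball_finite ballI eventually_conj eventually_gt_at_top small col row b) simp
    moreover have "\<forall>\<^sub>F m in sequentially. norm (d m) \<le> \<eta>"
      using tendstoD[OF d \<eta>] by (rule eventually_mono) simp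
    ultimately have "\<forall>\<^sub>F m in sequentially. P r n m"
      by eventually_elim (auto simp: P_def)
    then show "\<exists>m. P r n m" by (rule eventually_happens'[OF sequentially_bot])
  qed
  then obtain r where "\<And>n. P r n (r n)" by blast
  then have r: "\<And>i n. i < n \<Longrightarrow> r i < r n" "\<And>i n. i < n \<Longrightarrow> norm (a (r n) (r i)) \<le> b n"
    "\<And>i n. i < n \<Longrightarrow> norm (a (r i) (r n)) \<le> b n" "\<And>n. norm (d (r n)) \<le> \<eta>"
    unfolding P_def by blast+
  show ?thesis
  proof (rule that[of r])
    show "strict_mono r" using r(1) by (rule strict_monoI)
    fix k j :: nat assume "k \<noteq> j"
    then consider "k < j" | "j < k" by linarith
    then have "norm (a (r k) (r j)) \<le> b j"
      using r(2)[of j k] r(3)[of k j] b_mono[of j k] by cases auto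
    then show "norm (a (r k) (r j)) \<le> \<eta> * (1 / 2) ^ Suc j" by (simp add: b_def)
  qed (rule r)
qed

text \<open>The functions \<open>v j\<close> separate \<open>x j\<close> from the other points, so the bumps can be cut out of them.
  The product in \<open>u j\<close> vanishes where an earlier bump does not, which needs only finitely many factors.\<close>

lemma biorthogonal_bumps_exist:
  fixes v :: "nat \<Rightarrow> 'a::topological_space \<Rightarrow>\<^sub>C 'k::{real_normed_field,euclidean_space}"
  assumes x: "x \<longlonglongrightarrow> x0" and \<eta>: "\<eta> < c"
    and diag: "\<And>j. c \<le> norm (apply_bcontfun (v j) (x j) - apply_bcontfun (v j) x0)"
    and off: "\<And>k j. k \<noteq> j \<Longrightarrow> norm (apply_bcontfun (v j) (x k) - apply_bcontfun (v j) x0) \<le> \<eta>"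
    and \<eta>0: "0 \<le> \<eta>"
  obtains h :: "nat \<Rightarrow> 'a \<Rightarrow>\<^sub>C 'k" where "biorthogonal_bumps x x0 h"
proof -
  define w where "w j z = min 1 (max 0 ((norm (apply_bcontfun (v j) z - apply_bcontfun (v j) x0) - \<eta>) / (c - \<eta>)))" for j z
  have w_cont: "continuous_on UNIV (w j)" for j
    unfolding w_def by (intro continuous_intros continuous_on_apply_bcontfun) (use \<eta> in auto)
  have w: "0 \<le> w j z" "w j z \<le> 1" for j z by (auto simp: w_def)
  have w_diag: "w j (x j) = 1" for j
  proof -
    have "1 \<le> (norm (apply_bcontfun (v j) (x j) - apply_bcontfun (v j) x0) - \<eta>) / (c - \<eta>)"
      using diag[of j] \<eta> by (simp add: le_divide_eq)
    then show ?thesis by (simp add: w_def)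
  qed
  have w_zero: "w j z = 0" if "norm (apply_bcontfun (v j) z - apply_bcontfun (v j) x0) \<le> \<eta>" for j z
  proof -
    have "(norm (apply_bcontfun (v j) z - apply_bcontfun (v j) x0) - \<eta>) / (c - \<eta>) \<le> 0"
      using that \<eta> by (intro divide_nonpos_pos) auto
    then show ?thesis by (simp add: w_def)
  qed
  have w_off: "w j (x k) = 0" if "k \<noteq> j" for j k by (rule w_zero[OF off[OF that]])
  have w_x0: "w j x0 = 0" for j by (rule w_zero) (simp add: \<eta>0)
  define u where "u j z = max 0 (2 * w j z - 1) * (\<Prod>i<j. 1 - min 1 (2 * w i z))" for j z
  have u_cont: "continuous_on UNIV (u j)" for j
    unfolding u_def by (intro continuous_intros w_cont)
  have prod: "0 \<le> (\<Prod>i<j. 1 - min 1 (2 * w i z))" "(\<Prod>i<j. 1 - min 1 (2 * w i z)) \<le> 1" for j z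
    using w by (auto intro!: prod_nonneg prod_le_1)
  have u: "0 \<le> u j z" "u j z \<le> 1" for j z
    using w[of j z] prod[where j=j and z=z] by (auto simp: u_def intro!: mult_le_one)
  define h :: "nat \<Rightarrow> 'a \<Rightarrow>\<^sub>C 'k" where "h j = pointwise_scale (u j) (const_bcontfun 1)" for j
  have h: "apply_bcontfun (h j) z = of_real (u j z)" for j z
    unfolding h_def pointwise_scale_apply[OF u_cont u] by (simp add: of_real_def)
  have u_disj: "u i z = 0 \<or> u j z = 0" if "i < j" for i j z
  proof (cases "2 * w i z < 1")
    case True
    then show ?thesis by (simp add: u_def)
  next
    case False
    then have "(\<Prod>i<j. 1 - min 1 (2 * w i z)) = 0" using that by (intro prod_zero bexI[of _ i]) auto
    then show ?thesis by (simp add: u_def)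
  qed
  have "biorthogonal_bumps x x0 h"
  proof
    show "disjointly_supported UNIV h"
      unfolding disjointly_supported_def h using u_disj by (metis nat_neq_iff of_real_0)
    show "norm (h k) \<le> 1" for k
      by (rule norm_bound) (use u[of k] in \<open>simp add: h\<close>)
    show "apply_bcontfun (h k) (x j) = (if k = j then 1 else 0)" for k j
      using w_diag[of j] w_off[of j] by (auto simp: h u_def)
    show "apply_bcontfun (h k) x0 = 0" for k by (simp add: h u_def w_x0)
  qed (rule x)
  then show ?thesis by (rule that)
qed

text \<open>Disjoint functions in the unit ball are weakly null, because the values of a functional on them are
  absolutely summable.\<close>

lemma disjoint_evaluations_null:
  assumes "disjointly_supported (UNIV :: nat set) g" "\<And>n. norm (g n) \<le> 1"
  shows "(\<lambda>n. ev \<phi> (g n)) \<longlonglongrightarrow> 0"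
proof -
  have "(\<Sum>n<m. norm (ev \<phi> (g n))) \<le> norm \<phi>" for m
    by (rule disjoint_evaluation_sum) (use assms in \<open>auto simp: disjointly_supported_def\<close>)
  then have "summable (\<lambda>n. norm (ev \<phi> (g n)))" by (intro summableI_nonneg_bounded[where x="norm \<phi>"]) auto
  then have "(\<lambda>n. norm (ev \<phi> (g n))) \<longlonglongrightarrow> 0" by (rule summable_LIMSEQ_zero)
  then show ?thesis by (rule tendsto_norm_zero_cancel)
qed

lemma disjointly_supported_subsequence:
  "disjointly_supported UNIV g \<Longrightarrow> inj s \<Longrightarrow> disjointly_supported UNIV (\<lambda>n. g (s n))"
  unfolding disjointly_supported_def by (metis UNIV_I injD)

text \<open>The bumps \<open>g n\<close> with \<open>\<bar>(T (g n)) (y n)\<bar> > c\<close> are thinned out so that the points converge and the matrix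
  \<open>(T (g j)) (y k) - (T (g j)) x0\<close> is nearly diagonal. Rescaling makes the diagonal constant; the rescaled images
  separate the points and so provide the biorthogonal bumps.\<close>

lemma algebra_norm_ge_approx:
  fixes T :: "('a::topological_space \<Rightarrow>\<^sub>C 'k::{real_normed_field,euclidean_space}) \<Rightarrow>\<^sub>L ('a \<Rightarrow>\<^sub>C 'k)"
  assumes K: "compact (UNIV :: 'a set)" and K': "seq_compact (UNIV :: 'a set)"
    and N: "weak_calkin_algebra_norm N"
    and N_le: "\<And>T. T \<in> operators ck_scale \<Longrightarrow> N (weak_coset T) \<le> dual_weak_essential_norm T"
    and T: "T \<in> operators ck_scale"
    and c: "c < dual_weak_essential_norm T" and \<eta>: "0 < \<eta>" "2 * \<eta> < c"
  shows "c - 2 * \<eta> \<le> N (weak_coset T)"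
proof -
  let ?\<mu> = "\<lambda>x. blinfun_apply (adjoint_op T) (point_mass x) :: ('a, 'k) ck_dual"
  have \<mu>: "ev (?\<mu> x) f = apply_bcontfun (T f) x" for x f
    by (simp add: ev_adjoint_op[OF T] ev_point_mass)
  have M: "norm (?\<mu> x) \<le> norm (adjoint_op T)" for x
  proof -
    have "norm (?\<mu> x) \<le> norm (adjoint_op T) * norm (point_mass x :: ('a, 'k) ck_dual)" by (rule norm_blinfun)
    also have "\<dots> \<le> norm (adjoint_op T)" by (rule mult_left_le[OF norm_point_mass_le norm_ge_zero])
    finally show ?thesis .
  qed
  define c1 where "c1 = (c + dual_weak_essential_norm T) / 2"
  have c1: "0 \<le> c1" "c < c1" "c1 < dual_weak_essential_norm T" "0 \<le> c" using c \<eta> by (auto simp: c1_def)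
  obtain y :: "nat \<Rightarrow> 'a" and g :: "nat \<Rightarrow> 'a \<Rightarrow>\<^sub>C 'k" where g: "\<And>n. norm (g n) \<le> 1" "disjointly_supported UNIV g"
    "\<And>n. c < norm (ev (?\<mu> (y n)) (g n))"
    by (rule escapes_disjoint_sequence[OF point_images_escape[OF K T c1(1,3)] M c1(4,2)]) blast
  obtain x0 s where s: "strict_mono s" "(y \<circ> s) \<longlonglongrightarrow> x0"
    using K' unfolding seq_compact_def by blast
  have g': "disjointly_supported UNIV (\<lambda>n. g (s n))"
    by (rule disjointly_supported_subsequence[OF g(2) strict_mono_imp_inj_on[OF s(1)]])
  define a where "a k j = ev (?\<mu> (y (s k)) - ?\<mu> x0) (g (s j))" for k j
  have a: "a k j = apply_bcontfun (T (g (s j))) (y (s k)) - apply_bcontfun (T (g (s j))) x0" for k j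
    by (simp add: a_def ev_simps \<mu>)
  have col: "(\<lambda>k. a k j) \<longlonglongrightarrow> 0" for j
  proof -
    have "(\<lambda>k. apply_bcontfun (T (g (s j))) ((y \<circ> s) k)) \<longlonglongrightarrow> apply_bcontfun (T (g (s j))) x0"
      by (rule continuous_on_tendsto_compose[OF continuous_on_apply_bcontfun[of UNIV] s(2)]) auto
    then show ?thesis unfolding a by (intro LIM_zero) simp
  qed
  have row: "(\<lambda>j. a k j) \<longlonglongrightarrow> 0" for k
    unfolding a_def by (rule disjoint_evaluations_null[OF g' g(1)])
  have dn: "(\<lambda>j. ev (?\<mu> x0) (g (s j))) \<longlonglongrightarrow> 0" by (rule disjoint_evaluations_null[OF g' g(1)])
  obtain r where r: "strict_mono r" "\<And>k. norm (ev (?\<mu> x0) (g (s (r k)))) \<le> \<eta>"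
    "\<And>k j. k \<noteq> j \<Longrightarrow> norm (a (r k) (r j)) \<le> \<eta> * (1 / 2) ^ Suc j"
    by (rule double_sequence_diagonalization[OF col row dn \<eta>(1)]) blast
  define x where "x k = y (s (r k))" for k
  define G where "G k = g (s (r k))" for k
  define A where "A k j = a (r k) (r j)" for k j
  have x: "x \<longlonglongrightarrow> x0"
    using LIMSEQ_subseq_LIMSEQ[OF s(2) r(1)] by (simp add: x_def[abs_def] comp_def)
  have G: "disjointly_supported UNIV G" "\<And>k. norm (G k) \<le> 1"
    using disjointly_supported_subsequence[OF g' strict_mono_imp_inj_on[OF r(1)]] g(1) by (simp_all add: G_def[abs_def])
  have A: "A k j = apply_bcontfun (T (G j)) (x k) - apply_bcontfun (T (G j)) x0" for k j
    by (simp add: A_def a x_def G_def)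
  have diag: "c - \<eta> < norm (A k k)" for k
  proof -
    have "A k k = ev (?\<mu> (x k)) (G k) - ev (?\<mu> x0) (G k)" by (simp add: A \<mu>)
    moreover have "c < norm (ev (?\<mu> (x k)) (G k))" unfolding x_def G_def by (rule g(3))
    moreover have "norm (ev (?\<mu> x0) (G k)) \<le> \<eta>" unfolding G_def by (rule r(2))
    ultimately show ?thesis using norm_triangle_ineq2[of "ev (?\<mu> (x k)) (G k)" "ev (?\<mu> x0) (G k)"] by simp
  qed
  \<comment> \<open>Dividing by the diagonal entry gives the common value \<open>c2\<close>; since \<open>c2 < \<bar>A k k\<bar>\<close>, the
    rescaled functions stay in the unit ball.\<close>
  define c2 where "c2 = c - \<eta>"
  have c2: "\<eta> < c2" "0 < c2" using \<eta> by (auto simp: c2_def)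
  define t where "t k = of_real c2 / A k k" for k
  have t: "norm (t k) \<le> 1" "t k * A k k = of_real c2" for k
  proof -
    have "c2 < norm (A k k)" using diag[of k] by (simp add: c2_def)
    then show "norm (t k) \<le> 1" "t k * A k k = of_real c2"
      using c2 by (auto simp: t_def norm_divide divide_le_eq)
  qed
  define f where "f k = ck_scale (t k) (G k)" for k
  have f: "disjointly_supported UNIV f" "\<And>k. norm (f k) \<le> 1"
    using G t(1) by (auto simp: f_def disjointly_supported_def norm_ck_scale intro: mult_le_one)
  have Tf: "apply_bcontfun (T (f j)) z = t j * apply_bcontfun (T (G j)) z" for j z
    using T by (simp add: f_def klinear_maps_def)
  have D: "apply_bcontfun (T (f j)) (x k) - apply_bcontfun (T (f j)) x0 = t j * A k j" for k j
    by (simp add: Tf A right_diff_distrib)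
  have off: "norm (t j * A k j) \<le> \<eta> * (1 / 2) ^ Suc j" if "k \<noteq> j" for k j
    using mult_mono[OF t(1)[of j] r(3)[OF that]] by (simp add: norm_mult A_def)
  have off': "norm (t j * A k j) \<le> \<eta>" if "k \<noteq> j" for k j
  proof -
    have "\<eta> * (1 / 2) ^ Suc j \<le> \<eta> * 1" using \<eta> by (intro mult_left_mono power_le_one) auto
    then show ?thesis using off[OF that] by simp
  qed
  obtain h :: "nat \<Rightarrow> 'a \<Rightarrow>\<^sub>C 'k" where h: "biorthogonal_bumps x x0 h"
  proof (rule biorthogonal_bumps_exist[OF x c2(1)])
    show "c2 \<le> norm (apply_bcontfun (T (f j)) (x j) - apply_bcontfun (T (f j)) x0)" for j
      unfolding D t(2) using c2 by simp
    show "norm (apply_bcontfun (T (f j)) (x k) - apply_bcontfun (T (f j)) x0) \<le> \<eta>" if "k \<noteq> j" for k j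
      unfolding D by (rule off'[OF that])
  qed (use \<eta> in auto)
  interpret biorthogonal_bumps x x0 h by (rule h)
  have "c2 - \<eta> \<le> N (weak_coset T)"
  proof (rule algebra_norm_ge[OF N N_le T f])
    fix F and b :: "nat \<Rightarrow> 'k" and \<rho> k
    assume F: "finite F" "0 \<le> \<rho>" "\<And>j. j \<in> F \<Longrightarrow> norm (b j) \<le> \<rho>"
    have "H.differences (T (\<Sum>j\<in>F. ck_scale (b j) (f j))) k = (\<Sum>j\<in>F. b j * (t j * A k j))"
    proof -
      have "T (\<Sum>j\<in>F. ck_scale (b j) (f j)) = (\<Sum>j\<in>F. ck_scale (b j) (T (f j)))"
        using T by (simp add: blinfun.sum_right klinear_maps_def)
      then show ?thesis
        by (simp add: H.differences_def apply_bcontfun_sum sum_subtractf[symmetric] right_diff_distrib[symmetric] D)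
    qed
    also have "\<dots> = (if k \<in> F then of_real c2 * b k else 0) + (\<Sum>j\<in>F - {k}. b j * (t j * A k j))"
      using F(1) by (simp add: sum.remove[of F k] t(2) mult.commute)
    finally have "norm ((if k \<in> F then of_real c2 * b k else 0) - H.differences (T (\<Sum>j\<in>F. ck_scale (b j) (f j))) k)
        = norm (\<Sum>j\<in>F - {k}. b j * (t j * A k j))"
      by simp
    also have "\<dots> \<le> (\<Sum>j\<in>F - {k}. \<rho> * (\<eta> * (1 / 2) ^ Suc j))"
    proof (rule sum_norm_le)
      fix j assume j: "j \<in> F - {k}"
      have "norm (b j) * norm (t j * A k j) \<le> \<rho> * (\<eta> * (1 / 2) ^ Suc j)"
        by (intro mult_mono F off) (use j F in auto)
      then show "norm (b j * (t j * A k j)) \<le> \<rho> * (\<eta> * (1 / 2) ^ Suc j)" by (simp only: norm_mult)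
    qed
    also have "\<dots> = \<rho> * \<eta> * (\<Sum>j\<in>F - {k}. (1 / 2) ^ Suc j)" by (simp add: sum_distrib_left mult.assoc)
    also have "\<dots> \<le> \<rho> * \<eta> * 1"
    proof (rule mult_left_mono)
      have "(\<Sum>j\<in>F - {k}. (1 / 2) ^ Suc j) \<le> (\<Sum>j. (1 / 2 :: real) ^ Suc j)"
        by (rule sum_le_suminf[OF sums_summable[OF power_half_series]]) (use F(1) in auto)
      also have "\<dots> = 1" by (rule sums_unique[OF power_half_series, symmetric])
      finally show "(\<Sum>j\<in>F - {k}. (1 / 2) ^ Suc j) \<le> (1::real)" .
    qed (use F \<eta> in auto)
    finally show "norm ((if k \<in> F then of_real c2 * b k else 0) - H.differences (T (\<Sum>j\<in>F. ck_scale (b j) (f j))) k) \<le> \<eta> * \<rho>"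
      by (simp add: mult.commute)
  qed (use c2 \<eta> in auto)
  then show ?thesis by (simp add: c2_def)
qed

lemma dual_weak_essential_norm_minimal:
  assumes K: "compact (UNIV :: 'a::topological_space set)" and K': "seq_compact (UNIV :: 'a set)"
  shows "bonsall_minimal (dual_weak_essential_norm ::
    (('a \<Rightarrow>\<^sub>C 'k::{real_normed_field,euclidean_space}) \<Rightarrow>\<^sub>L ('a \<Rightarrow>\<^sub>C 'k)) \<Rightarrow> real)"
  unfolding bonsall_minimal_def
proof (intro allI impI ballI)
  fix N :: "(('a \<Rightarrow>\<^sub>C 'k) \<Rightarrow>\<^sub>L ('a \<Rightarrow>\<^sub>C 'k)) set \<Rightarrow> real" and T :: "('a \<Rightarrow>\<^sub>C 'k) \<Rightarrow>\<^sub>L ('a \<Rightarrow>\<^sub>C 'k)"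
  assume N: "weak_calkin_algebra_norm N" and T: "T \<in> operators ck_scale"
    and le: "\<forall>T\<in>operators ck_scale. N (weak_coset T) \<le> dual_weak_essential_norm T"
  show "N (weak_coset T) = dual_weak_essential_norm T"
  proof (rule ccontr)
    let ?n = "N (weak_coset T)" and ?\<nu> = "dual_weak_essential_norm T"
    assume "?n \<noteq> ?\<nu>"
    then have lt: "?n < ?\<nu>" using le T by force
    have n0: "0 \<le> ?n" using N T unfolding weak_calkin_algebra_norm_def by blast
    define c where "c = (?n + ?\<nu>) / 2"
    define \<eta> where "\<eta> = (c - ?n) / 4"
    have "c < ?\<nu>" "0 < \<eta>" "2 * \<eta> < c" using lt n0 by (auto simp: c_def \<eta>_def field_simps)
    then have "c - 2 * \<eta> \<le> ?n"
      by (intro algebra_norm_ge_approx[OF K K' N _ T]) (use le in auto)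
    then show False using lt by (simp add: c_def \<eta>_def field_simps)
  qed
qed

theorem corollary1p13:
  assumes "compact (UNIV :: 'a::t2_space set)"
    and "seq_compact (UNIV :: 'a set)"
  shows "bonsall_minimal
           (dual_weak_essential_norm :: (('a \<Rightarrow>\<^sub>C real) \<Rightarrow>\<^sub>L ('a \<Rightarrow>\<^sub>C real)) \<Rightarrow> real) \<and>
         bonsall_minimal
           (dual_weak_essential_norm :: (('a \<Rightarrow>\<^sub>C complex) \<Rightarrow>\<^sub>L ('a \<Rightarrow>\<^sub>C complex)) \<Rightarrow> real)"
  by (intro conjI dual_weak_essential_norm_minimal assms)

end
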